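(* Let $N\in\mathbb N_+$, let $\boldsymbol{\bar\jmath}=(j_1,\dots,j_N)$ be an $N$-tuple of spins in $\frac12\mathbb N_+$ and $\bar v=(v_1,\dots,v_N)\in(\mathbb C^* )^N$. For all $j\in\frac12\mathbb N_+$ the spin-chain representation $\psi^{(N)}_{\boldsymbol{\bar\jmath},\bar v}$ satisfies $$(\psi^{(N)}_{\boldsymbol{\bar\jmath},\bar v}\otimes\mathrm{id})\big(\mathcal K^{(j,N)}(u)\big)=L^{(j_N,j)}_{[N]}(uv_N)\cdots L^{(j_1,j)}_{[1]}(uv_1)\,K^{(j)}(u)\,L^{(j_1,j)}_{[1]}(uv_1^{-1})\cdots L^{(j_N,j)}_{[N]}(uv_N^{-1}),$$ where the parameters $d_k^{(N)}$, $\varepsilon_\pm^{(N)}$ of $\mathcal A_q^{(N)}$ are identified as in the context.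
   Context: **Conventions.** $q\in\mathbb C^*$ is not a root of unity, $\mathbb N=\{0,1,\dots\}$, $\mathbb N_+=\{1,2,\dots\}$, $\overline\ell=\ell\bmod2$, $[n]_q=\frac{q^n-q^{-n}}{q-q^{-1}}$, $[X,Y]_q=qXY-q^{-1}YX$, $c(u)=u-u^{-1}$, $X_1=X\otimes\mathbb I$, $X_2=\mathbb I\otimes X$. Fix $k_\pm\in\mathbb C^*$, $\varepsilon_\pm\in\mathbb C$, $\rho=k_+k_-(q+q^{-1})^2$. **$\mathcal A_q$** is the unital associative algebra generated by $\mathsf W_{-k},\mathsf W_{k+1},\mathsf G_{k+1},\tilde{\mathsf G}_{k+1}$ ($k\in\mathbb N$) with, for $k,l\in\mathbb N$: $[\mathsf W_0,\mathsf W_{k+1}]=[\mathsf W_{-k},\mathsf W_1]=\frac{\tilde{\mathsf G}_{k+1}-\mathsf G_{k+1}}{q+q^{-1}}$; $[\mathsf W_0,\mathsf G_{k+1}]_q=[\tilde{\mathsf G}_{k+1},\mathsf W_0]_q=\rho(\mathsf W_{-k-1}-\mathsf W_{k+1})$; $[\mathsf G_{k+1},\mathsf W_1]_q=[\mathsf W_1,\tilde{\mathsf G}_{k+1}]_q=\rho(\mathsf W_{k+2}-\mathsf W_{-k})$; $[\mathsf W_{-k},\mathsf W_{-l}]=[\mathsf W_{k+1},\mathsf W_{l+1}]=[\mathsf G_{k+1},\mathsf G_{l+1}]=[\tilde{\mathsf G}_{k+1},\tilde{\mathsf G}_{l+1}]=0$; and $[X_k,Y_l]+[Y_k,X_l]=0$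 for every pair $(X_k,Y_k)$ chosen from the families $\mathsf W_{-k},\mathsf W_{k+1},\mathsf G_{k+1},\tilde{\mathsf G}_{k+1}$. **$\mathcal A_q^{(N)}$** is the quotient of $\mathcal A_q$ by, for all $\ell\in\mathbb N$: $\sum_{k=0}^Nd_k^{(N)}\mathsf W_{-k-\ell}+\overline{\ell+1}\,\varepsilon_+^{(N)}+\overline\ell\,\varepsilon_-^{(N)}=0$, $\sum_{k=0}^Nd_k^{(N)}\mathsf W_{k+1+\ell}+\overline{\ell+1}\,\varepsilon_-^{(N)}+\overline\ell\,\varepsilon_+^{(N)}=0$, $\sum_{k=0}^Nd_k^{(N)}\mathsf G_{k+1+\ell}=0=\sum_{k=0}^Nd_k^{(N)}\tilde{\mathsf G}_{k+1+\ell}$; images of generators carry a superscript $(N)$. **Identification of parameters.** $w_0^{(j)}=q^{2j+1}+q^{-2j-1}$; $\varepsilon_\pm^{(0)}=\varepsilon_\pm$, $\varepsilon_\pm^{(n)}=w_0^{(j_n)}\varepsilon_\mp^{(n-1)}-(v_n^2+v_n^{-2})\varepsilon_\pm^{(n-1)}$; $d_n^{(N)}=(-1)^{N+1-n}(q+q^{-1})^n\sum_{k_1<\dots<k_{N-n}}\alpha_{k_1}\cdots\alpha_{k_{N-n}}$ ($0\le n\le N$), with $\alpha_1=\frac{(v_1^2+v_1^{-2})w_0^{(j_1)}}{q+q^{-1}}+\frac{\varepsilon_+\varepsilon_-(q-q^{-1})^2}{k_+k_-(q+q^{-1})}$, $\alpha_n=\frac{(v_n^2+v_n^{-2})w_0^{(j_n)}}{q+q^{-1}}$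 for $n\ge2$. **Truncated K-operators.** $U=\frac{qu^2+q^{-1}u^{-2}}{q+q^{-1}}$, $P_{-k}^{(N)}(u)=-\frac1{q+q^{-1}}\sum_{n=k}^{N-1}d_{n+1}^{(N)}U^{n-k}$, and $\mathsf W_+^{(N)}(u)=\sum_{k=0}^{N-1}P_{-k}^{(N)}(u)\mathsf W_{-k}^{(N)}$, $\mathsf W_-^{(N)}(u)=\sum P_{-k}^{(N)}(u)\mathsf W_{k+1}^{(N)}$, $\mathsf G_+^{(N)}(u)=\sum P_{-k}^{(N)}(u)\mathsf G_{k+1}^{(N)}$, $\mathsf G_-^{(N)}(u)=\sum P_{-k}^{(N)}(u)\tilde{\mathsf G}_{k+1}^{(N)}$. $\mathcal K^{(\frac12,N)}(u)=\begin{pmatrix}\mathcal A&\mathcal B\\\mathcal C&\mathcal D\end{pmatrix}$ with $\mathcal A=u\varepsilon_+^{(N)}+u^{-1}\varepsilon_-^{(N)}+c(u^2)(uq\mathsf W_+^{(N)}(u)-u^{-1}q^{-1}\mathsf W_-^{(N)}(u))$, $\mathcal D=u\varepsilon_-^{(N)}+u^{-1}\varepsilon_+^{(N)}+c(u^2)(uq\mathsf W_-^{(N)}(u)-u^{-1}q^{-1}\mathsf W_+^{(N)}(u))$, $\mathcal B=\frac{c(u^2)}{k_-}\Big(\frac{k_+k_-(u^2q+u^{-2}q^{-1})}{q-q^{-1}}P_0^{(N)}(u)+\frac{\mathsf G_+^{(N)}(u)}{q+q^{-1}}+\omega_0^{(N)}\Big)$, $\mathcal C$ the same with $\frac1{k_-}\to\frac1{k_+}$,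 $\mathsf G_+^{(N)}\to\mathsf G_-^{(N)}$, and $\omega_0^{(N)}=-\frac{k_+k_-}{q-q^{-1}}d_0^{(N)}$. **Fusion.** $B_{j,j'}=\sqrt{[j+j']_q[j-j'+1]_q}$; spin-$j$ matrices $(S_+)_{mn}=B_{j,j+1-m}\delta_{m,n-1}$, $(S_-)_{mn}=B_{j,j+1-n}\delta_{m-1,n}$, $(S_3)_{mn}=2(j+1-n)\delta_{mn}$. $\mathcal E^{(j)}:\mathbb C^{2j+1}\to\mathbb C^2\otimes\mathbb C^{2j}$ has nonzero entries $\mathcal E_{1,1}=1$, $\mathcal E_{1+n,1+n}=\prod_{p=0}^{n-1}\frac{B_{j-1/2,j-p-1/2}}{B_{j,j-p}}$ ($1\le n\le2j-1$), $\mathcal E_{2j+m,1+m}=[m]_q\mathcal E_{m,m}/B_{j,j+1-m}$ ($1\le m\le2j$). $\mathcal F^{(j)}:\mathbb C^2\otimes\mathbb C^{2j}\to\mathbb C^{2j+1}$ has nonzero entries $\mathcal F_{1,1}=1$, $\mathcal F_{n,n+2j-1}=\frac{\mathcal E_{n+2j-1,n}}{\mathcal E_{n,n}^2+\mathcal E_{n+2j-1,n}^2}$, $\mathcal F_{n,n}=\frac{1-\mathcal F_{n,n+2j-1}\mathcal E_{n+2j-1,n}}{\mathcal E_{n,n}}$ ($2\le n\le2j$), $\mathcal F_{2j+1,4j}=\mathcal E_{4j,2j+1}^{-1}$. $R^{(\frac12,0)}=\mathbb I_2$, $R^{(\frac12,j)}(u)=\prod_{k=0}^{2j-2}c(uq^{j-\frac12-k})\Big((q-q^{-1})(\sigma_+\otimes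 S_-+\sigma_-\otimes S_+)+uq^{\frac12(\mathbb I+\sigma_z\otimes S_3)}-u^{-1}q^{-\frac12(\mathbb I+\sigma_z\otimes S_3)}\Big)$. Fused operators: $\mathcal K^{(j,N)}(u)=\mathcal F^{(j)}\mathcal K_1^{(\frac12,N)}(uq^{-j+\frac12})R^{(\frac12,j-\frac12)}(u^2q^{-j+1})\mathcal K_2^{(j-\frac12,N)}(uq^{\frac12})\mathcal E^{(j)}$, $\mathcal K^{(0,N)}=1$; the scalar K-matrices $K^{(j)}(u)$ are given by the same recursion with $K^{(0)}=1$, $K^{(\frac12)}(u)=\begin{pmatrix}u\varepsilon_++u^{-1}\varepsilon_-&k_+c(u^2)/(q-q^{-1})\\k_-c(u^2)/(q-q^{-1})&u\varepsilon_-+u^{-1}\varepsilon_+\end{pmatrix}$. **Lax operators.** With $U_qsl_2$ generators $E,F,K^{\pm\frac12}$ ($K^{\frac12}E=qEK^{\frac12}$, $K^{\frac12}F=q^{-1}FK^{\frac12}$, $[E,F]=\frac{K-K^{-1}}{q-q^{-1}}$), $\mathcal L^{(\frac12)}(u)=\begin{pmatrix}uq^{\frac12}K^{\frac12}-u^{-1}q^{-\frac12}K^{-\frac12}&(q-q^{-1})F\\(q-q^{-1})E&uq^{\frac12}K^{-\frac12}-u^{-1}q^{-\frac12}K^{\frac12}\end{pmatrix}$, $\mathcal L^{(0)}=1$, $\mathcal L^{(j)}(u)=\mathcal F^{(j)}\mathcal L_1^{(\frac12)}(uq^{-j+\frac12})\mathcal L_2^{(j-\frac12)}(uq^{\frac12})\mathcal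 E^{(j)}$, and $L^{(j',j)}(u)=(\pi^{j'}\otimes\mathrm{id})(\mathcal L^{(j)}(u))$ where $\pi^{j'}(E)=S_+$, $\pi^{j'}(F)=S_-$, $\pi^{j'}(K^{\pm\frac12})=q^{\pm S_3/2}$ (spin $j'$). The first tensorand is the quantum space, the second the auxiliary space; $L_{[n]}$ acts on the quantum space $\mathbb C^{2j_n+1}$, in the ordering $\mathbb C^{2j_N+1}\otimes\dots\otimes\mathbb C^{2j_1+1}$, and products are matrix products in the auxiliary space. **Spin-chain representation.** $\psi^{(N)}_{\boldsymbol{\bar\jmath},\bar v}:\mathcal A_q^{(N)}\to\mathrm{End}(\mathbb C^{2j_N+1}\otimes\dots\otimes\mathbb C^{2j_1+1})$ is the algebra map defined by identification of matrix entries in $(\psi^{(N)}_{\boldsymbol{\bar\jmath},\bar v}\otimes\mathrm{id})(\mathcal K^{(\frac12,N)}(u))=L^{(j_N,\frac12)}_{[N]}(uv_N)\cdots L^{(j_1,\frac12)}_{[1]}(uv_1)K^{(\frac12)}(u)L^{(j_1,\frac12)}_{[1]}(uv_1^{-1})\cdots L^{(j_N,\frac12)}_{[N]}(uv_N^{-1})$ (it is known that this is a well-defined representation). *)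

theory Defs
  imports
    Complex_Main
    "HOL-Library.Poly_Mapping"
    "HOL-Algebra.Module"
    "HOL-Algebra.QuotRing"
    "Jordan_Normal_Form.Matrix"
begin

text \<open>
  Conventions. A spin \<open>j\<close> in half the natural numbers is encoded by the natural number \<open>t = 2j\<close>.
  \<open>h\<close> is a chosen square root of \<open>q\<close>; every half-integer power \<open>q^(n/2)\<close> is read as \<open>h^n\<close>.
  Unital associative complex algebras are records of type \<open>(complex, 'a) module\<close>
  (which extend those of rings).
  Matrices over an algebra are \<open>'a mat\<close> (indexed from 0); \<open>\<psi> \<otimes> id\<close> is then \<open>map_mat \<psi>\<close>.
\<close>

section \<open>Algebras given by generators and relations\<close>

instantiation list :: (type) monoid_add
begin
definition zero_list :: "'a list" where "0 = []"
definition plus_list :: "'a list \<Rightarrow> 'a list \<Rightarrow> 'a list" where "xs + ys = xs @ ys"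
instance by standard (simp_all add: zero_list_def plus_list_def)
end

text \<open>With concatenation as addition of words, the convolution product of
  \<open>'g list \<Rightarrow>\<^sub>0 complex\<close> is the product of the free unital associative algebra on \<open>'g\<close>.\<close>

type_synonym 'g free = "'g list \<Rightarrow>\<^sub>0 complex"

definition gen :: "'g \<Rightarrow> 'g free" where
  "gen g = Poly_Mapping.single [g] 1"

definition const :: "complex \<Rightarrow> 'g free" where
  "const c = Poly_Mapping.single [] c"

definition free_alg :: "(complex, 'g free) module" where
  "free_alg = \<lparr>carrier = UNIV, monoid.mult = (*), one = 1, zero = 0, add = (+),
               smult = (\<lambda>c p. const c * p)\<rparr>"

definition quot_alg :: "(complex, 'a) module \<Rightarrow> 'a set \<Rightarrow> (complex, 'a set) module" where
  "quot_alg A S = (let I = genideal A S in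
     ring.extend (A Quot I)
       (module.fields (\<lambda>c X. rcoset_mult A I (I +>\<^bsub>A\<^esub> (c \<odot>\<^bsub>A\<^esub> \<one>\<^bsub>A\<^esub>)) X)))"

definition quot_proj :: "(complex, 'a) module \<Rightarrow> 'a set \<Rightarrow> 'a \<Rightarrow> 'a set" where
  "quot_proj A S x = genideal A S +>\<^bsub>A\<^esub> x"

definition alg_hom :: "(complex, 'a) module \<Rightarrow> (complex, 'b) module \<Rightarrow> ('a \<Rightarrow> 'b) set" where
  "alg_hom A B = {f \<in> Ring.ring_hom A B. \<forall>c. \<forall>x\<in>carrier A. f (c \<odot>\<^bsub>A\<^esub> x) = c \<odot>\<^bsub>B\<^esub> f x}"

definition free_eval :: "(complex, 'a) module \<Rightarrow> ('g \<Rightarrow> 'a) \<Rightarrow> 'g free \<Rightarrow> 'a" where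
  "free_eval A f p =
     (\<Oplus>\<^bsub>A\<^esub>w\<in>Poly_Mapping.keys p.
        Poly_Mapping.lookup p w \<odot>\<^bsub>A\<^esub> foldr (\<lambda>g x. f g \<otimes>\<^bsub>A\<^esub> x) w \<one>\<^bsub>A\<^esub>)"

text \<open>The map induced by \<open>f\<close> on a quotient of the free algebra; \<open>free_eval A f\<close> has to be
  constant on cosets.\<close>

definition induced_hom :: "(complex, 'a) module \<Rightarrow> ('g \<Rightarrow> 'a) \<Rightarrow> 'g free set \<Rightarrow> 'a" where
  "induced_hom A f X = the_elem (free_eval A f ` X)"

definition complex_alg :: "(complex, complex) module" where
  "complex_alg = \<lparr>carrier = UNIV, monoid.mult = (*), one = 1, zero = 0, add = (+), smult = (*)\<rparr>"

definition End_alg :: "nat \<Rightarrow> (complex, complex mat) module" where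
  "End_alg n = module_mat TYPE(complex) n n"


section \<open>Matrices over an algebra\<close>

definition mat_mul :: "(complex, 'a) module \<Rightarrow> 'a mat \<Rightarrow> 'a mat \<Rightarrow> 'a mat" (infixl \<open>\<star>\<index>\<close> 70) where
  "X \<star>\<^bsub>A\<^esub> Y = mat (dim_row X) (dim_col Y)
     (\<lambda>(i,k). \<Oplus>\<^bsub>A\<^esub>l\<in>{..<dim_col X}. X $$ (i,l) \<otimes>\<^bsub>A\<^esub> Y $$ (l,k))"

definition kron :: "(complex, 'a) module \<Rightarrow> 'a mat \<Rightarrow> 'a mat \<Rightarrow> 'a mat" where
  "kron A X Y = mat (dim_row X * dim_row Y) (dim_col X * dim_col Y)
     (\<lambda>(i,k). X $$ (i div dim_row Y, k div dim_col Y)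
              \<otimes>\<^bsub>A\<^esub> Y $$ (i mod dim_row Y, k mod dim_col Y))"

definition id_mat :: "(complex, 'a) module \<Rightarrow> nat \<Rightarrow> 'a mat" where
  "id_mat A n = mat n n (\<lambda>(i,k). if i = k then \<one>\<^bsub>A\<^esub> else \<zero>\<^bsub>A\<^esub>)"

definition scalar_mat :: "(complex, 'a) module \<Rightarrow> complex mat \<Rightarrow> 'a mat" where
  "scalar_mat A M = map_mat (\<lambda>c. c \<odot>\<^bsub>A\<^esub> \<one>\<^bsub>A\<^esub>) M"

text \<open>Matrix given by its entries with indices starting at 1.\<close>

definition mat1 :: "nat \<Rightarrow> nat \<Rightarrow> (nat \<Rightarrow> nat \<Rightarrow> 'a) \<Rightarrow> 'a mat" where
  "mat1 nr nc f = mat nr nc (\<lambda>(i,k). f (Suc i) (Suc k))"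


section \<open>Spin matrices, fusion matrices and the R-matrix\<close>

definition qint :: "complex \<Rightarrow> int \<Rightarrow> complex" where
  "qint q n = (q powi n - q powi (- n)) / (q - inverse q)"

definition cc :: "complex \<Rightarrow> complex" where
  "cc u = u - inverse u"

text \<open>\<open>Bco q (2j) (2j')\<close> is \<open>B\<^sub>j\<^sub>,\<^sub>j\<^sub>'\<close>; the two arguments always have the same parity.
  The square root is the principal one.\<close>

definition Bco :: "complex \<Rightarrow> int \<Rightarrow> int \<Rightarrow> complex" where
  "Bco q a b = csqrt (qint q ((a + b) div 2) * qint q ((a - b) div 2 + 1))"

definition S_plus :: "complex \<Rightarrow> nat \<Rightarrow> complex mat" where
  "S_plus q t = mat1 (t + 1) (t + 1)
     (\<lambda>m n. if n = m + 1 then Bco q (int t) (int t + 2 - 2 * int m) else 0)"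

definition S_minus :: "complex \<Rightarrow> nat \<Rightarrow> complex mat" where
  "S_minus q t = mat1 (t + 1) (t + 1)
     (\<lambda>m n. if m = n + 1 then Bco q (int t) (int t + 2 - 2 * int n) else 0)"

text \<open>Diagonal entries of \<open>S\<^sub>3\<close>, for \<open>n\<close> from \<open>1\<close> to \<open>2j + 1\<close>.\<close>

definition S3_entry :: "nat \<Rightarrow> nat \<Rightarrow> int" where
  "S3_entry t n = int t + 2 - 2 * int n"

definition E_diag :: "complex \<Rightarrow> nat \<Rightarrow> nat \<Rightarrow> complex" where
  "E_diag q t n = (\<Prod>p<n. Bco q (int t - 1) (int t - 2 * int p - 1) / Bco q (int t) (int t - 2 * int p))"

definition fuse_E_entry :: "complex \<Rightarrow> nat \<Rightarrow> nat \<Rightarrow> nat \<Rightarrow> complex" where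
  "fuse_E_entry q t i k =
     (if i = k \<and> 1 \<le> k \<and> k \<le> t then E_diag q t (k - 1)
      else if i + 1 = t + k \<and> 2 \<le> k \<and> k \<le> t + 1
        then qint q (int k - 1) * E_diag q t (k - 2) / Bco q (int t) (int t + 2 - 2 * (int k - 1))
      else 0)"

definition fuse_E :: "complex \<Rightarrow> nat \<Rightarrow> complex mat" where
  "fuse_E q t = mat1 (2 * t) (t + 1) (fuse_E_entry q t)"

definition fuse_F_off :: "complex \<Rightarrow> nat \<Rightarrow> nat \<Rightarrow> complex" where
  "fuse_F_off q t n = fuse_E_entry q t (n + t - 1) n /
     ((fuse_E_entry q t n n)\<^sup>2 + (fuse_E_entry q t (n + t - 1) n)\<^sup>2)"

definition fuse_F :: "complex \<Rightarrow> nat \<Rightarrow> complex mat" where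
  "fuse_F q t = mat1 (t + 1) (2 * t) (\<lambda>n k.
     if n = 1 \<and> k = 1 then 1
     else if 2 \<le> n \<and> n \<le> t \<and> k = n + t - 1 then fuse_F_off q t n
     else if 2 \<le> n \<and> n \<le> t \<and> k = n
       then (1 - fuse_F_off q t n * fuse_E_entry q t (n + t - 1) n) / fuse_E_entry q t n n
     else if n = t + 1 \<and> k = 2 * t then inverse (fuse_E_entry q t (2 * t) (t + 1))
     else 0)"

text \<open>Exponents \<open>a\<close> in the diagonal entries \<open>h^a\<close> of \<open>q^((I + \<sigma>\<^sub>z \<otimes> S\<^sub>3)/2)\<close>.\<close>

definition R_exponent :: "nat \<Rightarrow> nat \<Rightarrow> int" where
  "R_exponent t i = (if i \<le> t + 1 then 1 + S3_entry t i else 1 - S3_entry t (i - (t + 1)))"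

definition sigma_plus :: "complex mat" where "sigma_plus = mat_of_rows_list 2 [[0, 1], [0, 0]]"
definition sigma_minus :: "complex mat" where "sigma_minus = mat_of_rows_list 2 [[0, 0], [1, 0]]"

text \<open>\<open>R_mat h t\<close> is \<open>R\<close> for the pair of spins \<open>(1/2, t/2)\<close>.\<close>

definition R_mat :: "complex \<Rightarrow> nat \<Rightarrow> complex \<Rightarrow> complex mat" where
  "R_mat h t u = (if t = 0 then 1\<^sub>m 2 else
     (let q = h\<^sup>2 in
      (\<Prod>k<t - 1. cc (u * h powi (int t - 1 - 2 * int k))) \<cdot>\<^sub>m
      ((q - inverse q) \<cdot>\<^sub>m (kron complex_alg sigma_plus (S_minus q t)
                           + kron complex_alg sigma_minus (S_plus q t))
       + mat1 (2 * (t + 1)) (2 * (t + 1))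
           (\<lambda>i k. if i = k then u * h powi R_exponent t i - inverse u * h powi (- R_exponent t i)
                  else 0))))"


section \<open>Fused K-operators\<close>

text \<open>Fusion recursion over an algebra \<open>A\<close>, starting from a spin-1/2 operator \<open>K\<close>; the last step
  leading to \<open>t = Suc n\<close> has \<open>j = (n + 1)/2\<close>.\<close>

primrec fused_K ::
  "(complex, 'a) module \<Rightarrow> complex \<Rightarrow> (complex \<Rightarrow> 'a mat) \<Rightarrow> nat \<Rightarrow> complex \<Rightarrow> 'a mat" where
  "fused_K A h K 0 u = id_mat A 1"
| "fused_K A h K (Suc n) u =
     scalar_mat A (fuse_F (h\<^sup>2) (Suc n))
     \<star>\<^bsub>A\<^esub> kron A (K (u * h powi (- int n))) (id_mat A (Suc n))
     \<star>\<^bsub>A\<^esub> scalar_mat A (R_mat h n (u\<^sup>2 * h powi (1 - int n)))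
     \<star>\<^bsub>A\<^esub> kron A (id_mat A 2) (fused_K A h K n (u * h))
     \<star>\<^bsub>A\<^esub> scalar_mat A (fuse_E (h\<^sup>2) (Suc n))"

definition K_half :: "complex \<Rightarrow> complex \<Rightarrow> complex \<Rightarrow> complex \<Rightarrow> complex \<Rightarrow> complex \<Rightarrow> complex mat" where
  "K_half q kp km ep em u = mat_of_rows_list 2
     [[u * ep + inverse u * em, kp * cc (u\<^sup>2) / (q - inverse q)],
      [km * cc (u\<^sup>2) / (q - inverse q), u * em + inverse u * ep]]"

definition K_spin ::
  "complex \<Rightarrow> complex \<Rightarrow> complex \<Rightarrow> complex \<Rightarrow> complex \<Rightarrow> nat \<Rightarrow> complex \<Rightarrow> complex mat" where
  "K_spin h kp km ep em t u = fused_K complex_alg h (K_half (h\<^sup>2) kp km ep em) t u"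


section \<open>The quantum group and the Lax operators\<close>

datatype uq_gen = UE | UF | UK | UKi  \<comment> \<open>\<open>E\<close>, \<open>F\<close>, \<open>K^(1/2)\<close>, \<open>K^(-1/2)\<close>\<close>

definition Uq_rels :: "complex \<Rightarrow> uq_gen free set" where
  "Uq_rels q =
     {gen UK * gen UKi - 1,
      gen UKi * gen UK - 1,
      gen UK * gen UE - const q * gen UE * gen UK,
      gen UK * gen UF - const (inverse q) * gen UF * gen UK,
      gen UE * gen UF - gen UF * gen UE
        - const (inverse (q - inverse q)) * (gen UK * gen UK - gen UKi * gen UKi)}"

definition Uq :: "complex \<Rightarrow> (complex, uq_gen free set) module" where
  "Uq q = quot_alg free_alg (Uq_rels q)"

definition Uq_gen :: "complex \<Rightarrow> uq_gen \<Rightarrow> uq_gen free set" where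
  "Uq_gen q g = quot_proj free_alg (Uq_rels q) (gen g)"

definition K_power_mat :: "complex \<Rightarrow> int \<Rightarrow> nat \<Rightarrow> complex mat" where
  "K_power_mat h s t = mat1 (t + 1) (t + 1) (\<lambda>m n. if m = n then h powi (s * S3_entry t n) else 0)"

fun spin_rep_gen :: "complex \<Rightarrow> nat \<Rightarrow> uq_gen \<Rightarrow> complex mat" where
  "spin_rep_gen h t UE = S_plus (h\<^sup>2) t"
| "spin_rep_gen h t UF = S_minus (h\<^sup>2) t"
| "spin_rep_gen h t UK = K_power_mat h 1 t"
| "spin_rep_gen h t UKi = K_power_mat h (- 1) t"

definition spin_rep :: "complex \<Rightarrow> nat \<Rightarrow> uq_gen free set \<Rightarrow> complex mat" where
  "spin_rep h t = induced_hom (End_alg (t + 1)) (spin_rep_gen h t)"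

definition Lax_half :: "complex \<Rightarrow> complex \<Rightarrow> uq_gen free set mat" where
  "Lax_half h u = (let q = h\<^sup>2; A = Uq q; E = Uq_gen q UE; F = Uq_gen q UF;
       K = Uq_gen q UK; Ki = Uq_gen q UKi in
     mat_of_rows_list 2
       [[((u * h) \<odot>\<^bsub>A\<^esub> K) \<ominus>\<^bsub>A\<^esub> (inverse (u * h) \<odot>\<^bsub>A\<^esub> Ki), (q - inverse q) \<odot>\<^bsub>A\<^esub> F],
        [(q - inverse q) \<odot>\<^bsub>A\<^esub> E, ((u * h) \<odot>\<^bsub>A\<^esub> Ki) \<ominus>\<^bsub>A\<^esub> (inverse (u * h) \<odot>\<^bsub>A\<^esub> K)]])"

primrec Lax :: "complex \<Rightarrow> nat \<Rightarrow> complex \<Rightarrow> uq_gen free set mat" where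
  "Lax h 0 u = id_mat (Uq (h\<^sup>2)) 1"
| "Lax h (Suc n) u = (let A = Uq (h\<^sup>2) in
     scalar_mat A (fuse_F (h\<^sup>2) (Suc n))
     \<star>\<^bsub>A\<^esub> kron A (Lax_half h (u * h powi (- int n))) (id_mat A (Suc n))
     \<star>\<^bsub>A\<^esub> kron A (id_mat A 2) (Lax h n (u * h))
     \<star>\<^bsub>A\<^esub> scalar_mat A (fuse_E (h\<^sup>2) (Suc n)))"


section \<open>The algebra \<open>A\<^sub>q\<close> and its quotients\<close>

text \<open>\<open>Wm k\<close>, \<open>Wp k\<close>, \<open>Gp k\<close>, \<open>Gt k\<close> stand for \<open>W\<^sub>-\<^sub>k\<close>, \<open>W\<^sub>k\<^sub>+\<^sub>1\<close>, \<open>G\<^sub>k\<^sub>+\<^sub>1\<close> and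
  \<open>G\<close>-tilde\<open>\<^sub>k\<^sub>+\<^sub>1\<close>.\<close>

datatype aq_gen = Wm nat | Wp nat | Gp nat | Gt nat

definition comm :: "'a::ring \<Rightarrow> 'a \<Rightarrow> 'a" where
  "comm x y = x * y - y * x"

definition qcomm :: "complex \<Rightarrow> 'g free \<Rightarrow> 'g free \<Rightarrow> 'g free" where
  "qcomm q x y = const q * x * y - const (inverse q) * y * x"

definition rho_par :: "complex \<Rightarrow> complex \<Rightarrow> complex \<Rightarrow> complex" where
  "rho_par q kp km = kp * km * (q + inverse q)\<^sup>2"

definition Aq_rels :: "complex \<Rightarrow> complex \<Rightarrow> aq_gen free set" where
  "Aq_rels q rho =
     (\<Union>k. let W0 = gen (Wm 0); W1 = gen (Wp 0);
              D = const (inverse (q + inverse q)) * (gen (Gt k) - gen (Gp k)) in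
       {comm W0 (gen (Wp k)) - D,
        comm (gen (Wm k)) W1 - D,
        qcomm q W0 (gen (Gp k)) - const rho * (gen (Wm (k + 1)) - gen (Wp k)),
        qcomm q (gen (Gt k)) W0 - const rho * (gen (Wm (k + 1)) - gen (Wp k)),
        qcomm q (gen (Gp k)) W1 - const rho * (gen (Wp (k + 1)) - gen (Wm k)),
        qcomm q W1 (gen (Gt k)) - const rho * (gen (Wp (k + 1)) - gen (Wm k))})
     \<union> {comm (gen (X k)) (gen (X l)) | X k l. X \<in> {Wm, Wp, Gp, Gt}}
     \<union> {comm (gen (X k)) (gen (Y l)) + comm (gen (Y k)) (gen (X l)) | X Y k l.
          X \<in> {Wm, Wp, Gp, Gt} \<and> Y \<in> {Wm, Wp, Gp, Gt}}"

definition Aq :: "complex \<Rightarrow> complex \<Rightarrow> (complex, aq_gen free set) module" where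
  "Aq q rho = quot_alg free_alg (Aq_rels q rho)"

definition Aq_gen :: "complex \<Rightarrow> complex \<Rightarrow> aq_gen \<Rightarrow> aq_gen free set" where
  "Aq_gen q rho g = quot_proj free_alg (Aq_rels q rho) (gen g)"

text \<open>\<open>eP\<close>, \<open>eM\<close> are the parameters \<open>\<epsilon>\<^sub>+\<close>, \<open>\<epsilon>\<^sub>-\<close> at level \<open>N\<close>.\<close>

definition AqN_rels ::
  "complex \<Rightarrow> complex \<Rightarrow> nat \<Rightarrow> (nat \<Rightarrow> complex) \<Rightarrow> complex \<Rightarrow> complex \<Rightarrow> aq_gen free set set" where
  "AqN_rels q rho N d eP eM =
     (let A = Aq q rho; g = Aq_gen q rho in
      \<Union>l. {(\<Oplus>\<^bsub>A\<^esub>k\<in>{..N}. d k \<odot>\<^bsub>A\<^esub> g (Wm (k + l)))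
              \<oplus>\<^bsub>A\<^esub> (of_nat ((l + 1) mod 2) * eP + of_nat (l mod 2) * eM) \<odot>\<^bsub>A\<^esub> \<one>\<^bsub>A\<^esub>,
            (\<Oplus>\<^bsub>A\<^esub>k\<in>{..N}. d k \<odot>\<^bsub>A\<^esub> g (Wp (k + l)))
              \<oplus>\<^bsub>A\<^esub> (of_nat ((l + 1) mod 2) * eM + of_nat (l mod 2) * eP) \<odot>\<^bsub>A\<^esub> \<one>\<^bsub>A\<^esub>,
            (\<Oplus>\<^bsub>A\<^esub>k\<in>{..N}. d k \<odot>\<^bsub>A\<^esub> g (Gp (k + l))),
            (\<Oplus>\<^bsub>A\<^esub>k\<in>{..N}. d k \<odot>\<^bsub>A\<^esub> g (Gt (k + l)))})"

definition AqN ::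
  "complex \<Rightarrow> complex \<Rightarrow> nat \<Rightarrow> (nat \<Rightarrow> complex) \<Rightarrow> complex \<Rightarrow> complex \<Rightarrow>
   (complex, aq_gen free set set) module" where
  "AqN q rho N d eP eM = quot_alg (Aq q rho) (AqN_rels q rho N d eP eM)"

definition AqN_gen ::
  "complex \<Rightarrow> complex \<Rightarrow> nat \<Rightarrow> (nat \<Rightarrow> complex) \<Rightarrow> complex \<Rightarrow> complex \<Rightarrow>
   aq_gen \<Rightarrow> aq_gen free set set" where
  "AqN_gen q rho N d eP eM g = quot_proj (Aq q rho) (AqN_rels q rho N d eP eM) (Aq_gen q rho g)"


section \<open>Truncated K-operators\<close>

definition U_fun :: "complex \<Rightarrow> complex \<Rightarrow> complex" where
  "U_fun q u = (q * u\<^sup>2 + inverse q * inverse (u\<^sup>2)) / (q + inverse q)"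

definition P_pol :: "complex \<Rightarrow> nat \<Rightarrow> (nat \<Rightarrow> complex) \<Rightarrow> nat \<Rightarrow> complex \<Rightarrow> complex" where
  "P_pol q N d k u = - (1 / (q + inverse q)) * (\<Sum>n\<in>{k..<N}. d (n + 1) * U_fun q u ^ (n - k))"

definition KN_half ::
  "complex \<Rightarrow> complex \<Rightarrow> complex \<Rightarrow> nat \<Rightarrow> (nat \<Rightarrow> complex) \<Rightarrow> complex \<Rightarrow> complex \<Rightarrow>
   complex \<Rightarrow> aq_gen free set set mat" where
  "KN_half q kp km N d eP eM u =
     (let rho = rho_par q kp km;
          A = AqN q rho N d eP eM;
          cur = (\<lambda>X. \<Oplus>\<^bsub>A\<^esub>k\<in>{..<N}. P_pol q N d k u \<odot>\<^bsub>A\<^esub> AqN_gen q rho N d eP eM (X k));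
          omega = - (kp * km / (q - inverse q)) * d 0;
          s = kp * km * (u\<^sup>2 * q + inverse (u\<^sup>2) * inverse q) / (q - inverse q) * P_pol q N d 0 u
              + omega;
          diag = (\<lambda>e e' X Y. ((u * e + inverse u * e') \<odot>\<^bsub>A\<^esub> \<one>\<^bsub>A\<^esub>)
              \<oplus>\<^bsub>A\<^esub> (cc (u\<^sup>2) \<odot>\<^bsub>A\<^esub> (((u * q) \<odot>\<^bsub>A\<^esub> cur X) \<ominus>\<^bsub>A\<^esub> ((inverse u * inverse q) \<odot>\<^bsub>A\<^esub> cur Y))));
          offd = (\<lambda>k X. (cc (u\<^sup>2) / k) \<odot>\<^bsub>A\<^esub>
              ((s \<odot>\<^bsub>A\<^esub> \<one>\<^bsub>A\<^esub>) \<oplus>\<^bsub>A\<^esub> (inverse (q + inverse q) \<odot>\<^bsub>A\<^esub> cur X)))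
      in mat_of_rows_list 2
           [[diag eP eM Wm Wp, offd km Gp],
            [offd kp Gt, diag eM eP Wp Wm]])"


section \<open>Parameters of the spin chain\<close>

text \<open>Spins and inhomogeneities are indexed by \<open>1..N\<close>: \<open>ts n = 2 j\<^sub>n\<close> and \<open>v n = v\<^sub>n\<close>.\<close>

definition w0_par :: "complex \<Rightarrow> nat \<Rightarrow> complex" where
  "w0_par q t = q ^ (t + 1) + inverse q ^ (t + 1)"

text \<open>The pair of \<open>\<epsilon>\<^sub>+\<close> and \<open>\<epsilon>\<^sub>-\<close> at level \<open>n\<close>.\<close>

primrec eps_par ::
  "complex \<Rightarrow> complex \<Rightarrow> complex \<Rightarrow> (nat \<Rightarrow> nat) \<Rightarrow> (nat \<Rightarrow> complex) \<Rightarrow> nat \<Rightarrow> complex \<times> complex" where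
  "eps_par q ep em ts v 0 = (ep, em)"
| "eps_par q ep em ts v (Suc n) =
     (let (a, b) = eps_par q ep em ts v n; w = w0_par q (ts (Suc n));
          x = (v (Suc n))\<^sup>2 + inverse ((v (Suc n))\<^sup>2)
      in (w * b - x * a, w * a - x * b))"

definition alpha_par ::
  "complex \<Rightarrow> complex \<Rightarrow> complex \<Rightarrow> complex \<Rightarrow> complex \<Rightarrow> (nat \<Rightarrow> nat) \<Rightarrow> (nat \<Rightarrow> complex) \<Rightarrow>
   nat \<Rightarrow> complex" where
  "alpha_par q kp km ep em ts v n =
     ((v n)\<^sup>2 + inverse ((v n)\<^sup>2)) * w0_par q (ts n) / (q + inverse q)
     + (if n = 1 then ep * em * (q - inverse q)\<^sup>2 / (kp * km * (q + inverse q)) else 0)"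

definition d_par ::
  "complex \<Rightarrow> complex \<Rightarrow> complex \<Rightarrow> complex \<Rightarrow> complex \<Rightarrow> nat \<Rightarrow> (nat \<Rightarrow> nat) \<Rightarrow> (nat \<Rightarrow> complex) \<Rightarrow>
   nat \<Rightarrow> complex" where
  "d_par q kp km ep em N ts v n =
     (- 1) ^ (N + 1 - n) * (q + inverse q) ^ n
     * (\<Sum>S\<in>{S. S \<subseteq> {1..N} \<and> card S = N - n}. \<Prod>k\<in>S. alpha_par q kp km ep em ts v k)"

definition chain_alg ::
  "complex \<Rightarrow> complex \<Rightarrow> complex \<Rightarrow> complex \<Rightarrow> complex \<Rightarrow> nat \<Rightarrow> (nat \<Rightarrow> nat) \<Rightarrow> (nat \<Rightarrow> complex) \<Rightarrow>
   (complex, aq_gen free set set) module" where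
  "chain_alg q kp km ep em N ts v =
     AqN q (rho_par q kp km) N (d_par q kp km ep em N ts v)
       (fst (eps_par q ep em ts v N)) (snd (eps_par q ep em ts v N))"

definition chain_KN_half ::
  "complex \<Rightarrow> complex \<Rightarrow> complex \<Rightarrow> complex \<Rightarrow> complex \<Rightarrow> nat \<Rightarrow> (nat \<Rightarrow> nat) \<Rightarrow> (nat \<Rightarrow> complex) \<Rightarrow>
   complex \<Rightarrow> aq_gen free set set mat" where
  "chain_KN_half q kp km ep em N ts v =
     KN_half q kp km N (d_par q kp km ep em N ts v)
       (fst (eps_par q ep em ts v N)) (snd (eps_par q ep em ts v N))"

definition chain_KN ::
  "complex \<Rightarrow> complex \<Rightarrow> complex \<Rightarrow> complex \<Rightarrow> complex \<Rightarrow> nat \<Rightarrow> (nat \<Rightarrow> nat) \<Rightarrow> (nat \<Rightarrow> complex) \<Rightarrow>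
   nat \<Rightarrow> complex \<Rightarrow> aq_gen free set set mat" where
  "chain_KN h kp km ep em N ts v t u =
     fused_K (chain_alg (h\<^sup>2) kp km ep em N ts v) h (chain_KN_half (h\<^sup>2) kp km ep em N ts v) t u"


section \<open>The spin-chain representation\<close>

definition chain_dim :: "nat \<Rightarrow> (nat \<Rightarrow> nat) \<Rightarrow> nat" where
  "chain_dim N ts = (\<Prod>n\<in>{1..N}. ts n + 1)"

text \<open>\<open>X\<close> acting on site \<open>n\<close>; the tensor factors are ordered \<open>N, ..., 1\<close>.\<close>

definition site_op :: "nat \<Rightarrow> (nat \<Rightarrow> nat) \<Rightarrow> nat \<Rightarrow> complex mat \<Rightarrow> complex mat" where
  "site_op N ts n X =
     kron complex_alg (1\<^sub>m (\<Prod>k\<in>{n+1..N}. ts k + 1))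
       (kron complex_alg X (1\<^sub>m (\<Prod>k\<in>{1..<n}. ts k + 1)))"

definition site_Lax ::
  "complex \<Rightarrow> nat \<Rightarrow> (nat \<Rightarrow> nat) \<Rightarrow> (complex \<Rightarrow> uq_gen free set mat) \<Rightarrow> nat \<Rightarrow> complex \<Rightarrow> complex mat mat"
  where
  "site_Lax h N ts L n u = map_mat (site_op N ts n) (map_mat (spin_rep h (ts n)) (L u))"

text \<open>\<open>dressing h N ts v L K u n\<close> is
  \<open>L[n](u v\<^sub>n) ... L[1](u v\<^sub>1) K(u) L[1](u/v\<^sub>1) ... L[n](u/v\<^sub>n)\<close>, where the product is that of matrices in the
  auxiliary space with entries in the endomorphisms of the whole quantum space.\<close>

primrec dressing ::
  "complex \<Rightarrow> nat \<Rightarrow> (nat \<Rightarrow> nat) \<Rightarrow> (nat \<Rightarrow> complex) \<Rightarrow> (complex \<Rightarrow> uq_gen free set mat) \<Rightarrow>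
   (complex \<Rightarrow> complex mat) \<Rightarrow> complex \<Rightarrow> nat \<Rightarrow> complex mat mat" where
  "dressing h N ts v L K u 0 = scalar_mat (End_alg (chain_dim N ts)) (K u)"
| "dressing h N ts v L K u (Suc n) = (let A = End_alg (chain_dim N ts) in
     site_Lax h N ts L (Suc n) (u * v (Suc n))
     \<star>\<^bsub>A\<^esub> dressing h N ts v L K u n
     \<star>\<^bsub>A\<^esub> site_Lax h N ts L (Suc n) (u * inverse (v (Suc n))))"

definition spin_chain_rep ::
  "complex \<Rightarrow> complex \<Rightarrow> complex \<Rightarrow> complex \<Rightarrow> complex \<Rightarrow> nat \<Rightarrow> (nat \<Rightarrow> nat) \<Rightarrow> (nat \<Rightarrow> complex) \<Rightarrow>
   (aq_gen free set set \<Rightarrow> complex mat) \<Rightarrow> bool" where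
  "spin_chain_rep h kp km ep em N ts v \<psi> \<longleftrightarrow>
     \<psi> \<in> alg_hom (chain_alg (h\<^sup>2) kp km ep em N ts v) (End_alg (chain_dim N ts)) \<and>
     (\<forall>u. u \<noteq> 0 \<longrightarrow>
        map_mat \<psi> (chain_KN_half (h\<^sup>2) kp km ep em N ts v u)
        = dressing h N ts v (Lax_half h) (K_half (h\<^sup>2) kp km ep em) u N)"

end

theory Submission
  imports Defs
begin

text \<open>Both sides of the identity are matrices over the endomorphisms of the chain. They are compared by
induction on the auxiliary spin. Write \<open>E\<close>, \<open>F\<close> for the fusion matrices (\<open>F E = 1\<close>), and \<open>D\<^sub>1\<close>, \<open>D\<^sub>2\<close> for
the dressed K-matrices of spins \<open>1/2\<close> and \<open>n/2\<close>, placed in the two tensor factors of the auxiliary space.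
As \<open>\<psi>\<close> is an algebra map, the induction step amounts to
\<open>D\<^sub>1(a) R(a b) D\<^sub>2(b) E = E D'(u)\<close> with \<open>a = u h\<^sup>-\<^sup>n\<close>, \<open>b = u h\<close>, where \<open>D'\<close> is the dressed K-matrix of spin
\<open>(n + 1)/2\<close> (lemma \<open>dress_image\<close>). This is an induction on the number of sites. Three facts carry it.

\<^item> Fusion (\<open>fuseL_image\<close>): \<open>L\<^sub>1(a) L\<^sub>2(b) E = E L'(u)\<close>, that is, the product preserves the image of \<open>E\<close>.
\<^item> Exchange (\<open>RLL_fused\<close>): \<open>L\<^sub>1(x) R(x y) L\<^sub>2(y) = L\<^sub>2(y) R(x y) L\<^sub>1(x)\<close>.
\<^item> Fusion of the scalar K-matrix (\<open>fuseK_image\<close>): \<open>K\<^sub>1(a) R(a b) K\<^sub>2(b) E = E K'(u)\<close>.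

The exchange relation brings the inner Lax operators past \<open>R\<close>; operators of different sites commute; then
the Lax operators of the last site are absorbed by fusion on either side of the induction hypothesis.

The two fusion statements have the same reason. Pushing \<open>E\<close> for the preceding spin through the second
factor turns membership in the image of \<open>E\<close> into invariance under exchange of two neighbouring spins 1/2
(\<open>column_in_image_of_E_Suc\<close>). So it suffices that the antisymmetric covector of two spins 1/2 is an eigenvector
of a product of two Lax operators, R-matrices or K-matrices with arguments \<open>x\<close> and \<open>q x\<close>: a quantum
determinant (\<open>quantum_det\<close>, \<open>Rop_det\<close>, \<open>reflection_det\<close>). The exchange relation follows from its spin-1/2
case (\<open>RLL_half\<close>), because the given R-matrix is itself obtained by fusion (\<open>Rop_E\<close>).

All this is carried out in one ring of operators, on functions of an auxiliary index and a quantum index.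
It contains the auxiliary spin matrices of every size, the fusion matrices, and the endomorphisms of the
chain, so that no matrix sizes have to be tracked. An operator on \<open>\<complex>\<^sup>2 \<otimes> V\<close> is a family of four operators on
\<open>V\<close>, indexed by two booleans; \<open>False\<close> stands for the first basis vector of \<open>\<complex>\<^sup>2\<close>. The second half of the text
translates the matrices over the record algebras into this ring.\<close>

section \<open>Linear operators on functions of two indices\<close>

text \<open>Linear operators on functions of an auxiliary index (first component) and a quantum index (second
component). As the indices are unbounded, matrices of all sizes act on the same space.\<close>

typedef aop = "{f :: (nat \<times> nat \<Rightarrow> complex) \<Rightarrow> (nat \<times> nat \<Rightarrow> complex).
    (\<forall>x y. f (\<lambda>i. x i + y i) = (\<lambda>i. f x i + f y i)) \<and> (\<forall>c x. f (\<lambda>i. c * x i) = (\<lambda>i. c * f x i))}"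
  morphisms app Aop
  by (rule exI[of _ "\<lambda>x. x"]) simp

setup_lifting type_definition_aop

lemma app_add: "app A (\<lambda>i. x i + y i) = (\<lambda>i. app A x i + app A y i)"
  using app[of A] by simp

lemma app_scale: "app A (\<lambda>i. c * x i) = (\<lambda>i. c * app A x i)"
  using app[of A] by simp

lemma app_zero: "app A (\<lambda>i. 0) = (\<lambda>i. 0)"
  using app_scale[of A 0 "\<lambda>i. 0"] by simp

instantiation aop :: ring_1
begin
lift_definition zero_aop :: aop is "\<lambda>x i. 0" by simp
lift_definition one_aop :: aop is "\<lambda>x. x" by simp
lift_definition plus_aop :: "aop \<Rightarrow> aop \<Rightarrow> aop" is "\<lambda>f g x i. f x i + g x i"
  by (simp add: algebra_simps)
lift_definition minus_aop :: "aop \<Rightarrow> aop \<Rightarrow> aop" is "\<lambda>f g x i. f x i - g x i"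
  by (simp add: algebra_simps)
lift_definition uminus_aop :: "aop \<Rightarrow> aop" is "\<lambda>f x i. - f x i"
  by simp
lift_definition times_aop :: "aop \<Rightarrow> aop \<Rightarrow> aop" is "\<lambda>f g x. f (g x)"
  by simp
instance
proof
  fix a b c :: aop
  show "a * b * c = a * (b * c)" by transfer simp
  show "1 * a = a" by transfer simp
  show "a * 1 = a" by transfer simp
  show "(a + b) * c = a * c + b * c" by transfer simp
  show "a * (b + c) = a * b + a * c" by transfer simp
  show "a + b + c = a + (b + c)" by transfer (simp add: algebra_simps)
  show "a + b = b + a" by transfer (simp add: algebra_simps)
  show "0 + a = a" by transfer simp
  show "- a + a = 0" by transfer simp
  show "a - b = a + - b" by transfer simp
  show "(0::aop) \<noteq> 1"
    by transfer (metis zero_neq_one)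
qed
end

lemma app_zero_op [simp]: "app 0 x i = 0" by transfer simp
lemma app_one_op [simp]: "app 1 x = x" by transfer simp
lemma app_plus_op [simp]: "app (A + B) x i = app A x i + app B x i" by transfer simp
lemma app_minus_op [simp]: "app (A - B) x i = app A x i - app B x i" by transfer simp
lemma app_uminus_op [simp]: "app (- A) x i = - app A x i" by transfer simp
lemma app_times_op [simp]: "app (A * B) x = app A (app B x)" by transfer simp

lemma app_sum_op [simp]: "app (sum f S) x i = (\<Sum>k\<in>S. app (f k) x i)"
  by (induction S rule: infinite_finite_induct) simp_all

lemma aop_eqI: "(\<And>x a s. app A x (a, s) = app B x (a, s)) \<Longrightarrow> A = B"
  by (metis app_inject ext prod.exhaust)

text \<open>Scalar multiplication of operators.\<close>

lift_definition scl :: "complex \<Rightarrow> aop \<Rightarrow> aop" (infixr \<open>\<cdot>\<^sub>C\<close> 75) is "\<lambda>c f x i. c * f x i"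
  by (simp add: algebra_simps)

abbreviation cst :: "complex \<Rightarrow> aop" where "cst c \<equiv> c \<cdot>\<^sub>C 1"

lemma app_scl [simp]: "app (c \<cdot>\<^sub>C A) x = (\<lambda>i. c * app A x i)" by transfer simp

lemma scl_simps [simp]:
  "c \<cdot>\<^sub>C A * B = c \<cdot>\<^sub>C (A * B)" "A * c \<cdot>\<^sub>C B = c \<cdot>\<^sub>C (A * B)" "c \<cdot>\<^sub>C d \<cdot>\<^sub>C A = (c * d) \<cdot>\<^sub>C A"
  "1 \<cdot>\<^sub>C A = A" "0 \<cdot>\<^sub>C A = 0" "c \<cdot>\<^sub>C 0 = 0"
  by (auto intro!: aop_eqI simp: app_scale mult.assoc)

lemma scl_distrib:
  "c \<cdot>\<^sub>C (A + B) = c \<cdot>\<^sub>C A + c \<cdot>\<^sub>C B" "c \<cdot>\<^sub>C (A - B) = c \<cdot>\<^sub>C A - c \<cdot>\<^sub>C B"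
  "c \<cdot>\<^sub>C (- A) = (- c) \<cdot>\<^sub>C A"
  "(c + d) \<cdot>\<^sub>C A = c \<cdot>\<^sub>C A + d \<cdot>\<^sub>C A" "(c - d) \<cdot>\<^sub>C A = c \<cdot>\<^sub>C A - d \<cdot>\<^sub>C A"
  by (auto intro!: aop_eqI simp: algebra_simps)

lemma scl_sum: "c \<cdot>\<^sub>C sum f S = (\<Sum>k\<in>S. c \<cdot>\<^sub>C f k)"
  by (induction S rule: infinite_finite_induct) (simp_all add: scl_distrib)

lemma uminus_scl: "- A = (-1) \<cdot>\<^sub>C A"
  by (auto intro!: aop_eqI)

lemma sum_bool: "(\<Sum>i\<in>UNIV. f i) = f False + f True" for f :: "bool \<Rightarrow> 'a::comm_monoid_add"
  by (simp add: UNIV_bool add.commute)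

lemma scl_minus: "c \<cdot>\<^sub>C (- A) = - (c \<cdot>\<^sub>C A)" "(- c) \<cdot>\<^sub>C A = - (c \<cdot>\<^sub>C A)"
  by (simp_all add: uminus_scl)

text \<open>Diagonal operators and the two shifts of the auxiliary index. As matrices, \<open>Up\<close> has its entries
  on the first superdiagonal and \<open>Dn\<close> on the first subdiagonal.\<close>

lift_definition Dg :: "(nat \<Rightarrow> complex) \<Rightarrow> aop" is "\<lambda>c x (a, s). c a * x (a, s)"
  by (auto simp: fun_eq_iff algebra_simps)
lift_definition Up :: aop is "\<lambda>x (a, s). x (Suc a, s)"
  by (auto simp: fun_eq_iff algebra_simps)
lift_definition Dn :: aop is "\<lambda>x (a, s). if a = 0 then 0 else x (a - 1, s)"
  by (auto simp: fun_eq_iff algebra_simps)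

lemma app_Dg [simp]: "app (Dg c) x = (\<lambda>(a, s). c a * x (a, s))" by transfer simp
lemma app_Up [simp]: "app Up x = (\<lambda>(a, s). x (Suc a, s))" by transfer simp
lemma app_Dn [simp]: "app Dn x = (\<lambda>(a, s). if a = 0 then 0 else x (a - 1, s))" by transfer simp

text \<open>The matrix units of the auxiliary index.\<close>

lift_definition un :: "nat \<Rightarrow> nat \<Rightarrow> aop" is "\<lambda>i j x (a, s). if a = i then x (j, s) else 0"
  by (auto simp: fun_eq_iff algebra_simps)

lemma app_un [simp]: "app (un i j) x = (\<lambda>(a, s). if a = i then x (j, s) else 0)" by transfer simp

lemma un_mult: "un i j * un k l = (if j = k then un i l else 0)"
  by (auto intro!: aop_eqI)

text \<open>A \<open>d \<times> d\<close> matrix acts on the quantum index: the quantum indices are cut into consecutive blocks of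
  length \<open>d\<close>, and the matrix acts on each block. This makes \<open>qm d\<close> a unital embedding.\<close>

lift_definition qm :: "nat \<Rightarrow> complex mat \<Rightarrow> aop" is
  "\<lambda>d A x (a, s). \<Sum>r<d. A $$ (s mod d, r) * x (a, d * (s div d) + r)"
  by (auto simp: fun_eq_iff distrib_left sum.distrib sum_distrib_left mult.left_commute)

lemma app_qm [simp]:
  "app (qm d A) x = (\<lambda>(a, s). \<Sum>r<d. A $$ (s mod d, r) * x (a, d * (s div d) + r))"
  by (rule qm.rep_eq[THEN fun_cong])

lemma qm_one:
  assumes "d > 0" shows "qm d (1\<^sub>m d) = 1"
proof (rule aop_eqI)
  fix x :: "nat \<times> nat \<Rightarrow> complex" and a s
  have "(\<Sum>r<d. 1\<^sub>m d $$ (s mod d, r) * x (a, d * (s div d) + r))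
      = (\<Sum>r<d. if r = s mod d then x (a, d * (s div d) + r) else 0)"
    using assms by (intro sum.cong) auto
  also have "\<dots> = x (a, s)" using assms by simp
  finally show "app (qm d (1\<^sub>m d)) x (a, s) = app 1 x (a, s)" by simp
qed

lemma qm_mult:
  assumes "A \<in> carrier_mat d d" "B \<in> carrier_mat d d" "d > 0"
  shows "qm d (A * B) = qm d A * qm d B"
proof (rule aop_eqI)
  fix x a s
  have m: "s mod d < d" using assms by simp
  have "app (qm d A * qm d B) x (a, s) = (\<Sum>r<d. A $$ (s mod d, r) *
          (\<Sum>r'<d. B $$ (r, r') * x (a, d * (s div d) + r')))"
    by (auto intro!: sum.cong)
  also have "\<dots> = (\<Sum>r'<d. (\<Sum>r<d. A $$ (s mod d, r) * B $$ (r, r')) * x (a, d * (s div d) + r'))"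
    by (simp add: sum_distrib_left sum_distrib_right mult.assoc) (rule sum.swap)
  also have "\<dots> = app (qm d (A * B)) x (a, s)"
    using assms m by (auto simp: scalar_prod_def lessThan_atLeast0 intro!: sum.cong)
  finally show "app (qm d (A * B)) x (a, s) = app (qm d A * qm d B) x (a, s)" by simp
qed

lemma qm_add:
  assumes "A \<in> carrier_mat d d" "B \<in> carrier_mat d d" "d > 0"
  shows "qm d (A + B) = qm d A + qm d B"
  using assms by (intro aop_eqI) (auto simp: distrib_right sum.distrib[symmetric] intro!: sum.cong)

lemma qm_scl:
  assumes "A \<in> carrier_mat d d" "d > 0"
  shows "qm d (c \<cdot>\<^sub>m A) = c \<cdot>\<^sub>C qm d A"
  using assms by (intro aop_eqI) (auto simp: mult.assoc sum_distrib_left intro!: sum.cong)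

lemma qm_inj:
  assumes "A \<in> carrier_mat d d" "B \<in> carrier_mat d d" "qm d A = qm d B"
  shows "A = B"
proof (rule eq_matI)
  fix i j assume ij: "i < dim_row B" "j < dim_col B"
  let ?x = "\<lambda>(a::nat, s::nat). if s = j then 1 else 0 :: complex"
  have *: "app (qm d M) ?x (0, i) = M $$ (i, j)" if "M \<in> carrier_mat d d" for M
    using that ij assms by (simp add: if_distrib cong: if_cong)
  from * [OF assms(1)] * [OF assms(2)] assms(3) show "A $$ (i, j) = B $$ (i, j)" by simp
qed (use assms in auto)

text \<open>Operators that commute with all operators on the auxiliary index used here.\<close>

definition quantum :: "aop \<Rightarrow> bool" where
  "quantum Q \<longleftrightarrow> (\<forall>c. Q * Dg c = Dg c * Q) \<and> Q * Up = Up * Q \<and> Q * Dn = Dn * Q \<and> (\<forall>i j. Q * un i j = un i j * Q)"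

lemma quantum_qm: "quantum (qm d A)"
  unfolding quantum_def
  by (intro conjI allI aop_eqI) (simp_all add: sum_distrib_left mult.left_commute)

lemma quantum_scl_one: "quantum (c \<cdot>\<^sub>C 1)"
  by (simp add: quantum_def)

text \<open>The projection to the first \<open>n\<close> auxiliary indices.\<close>

definition Pr :: "nat \<Rightarrow> aop" where "Pr n = Dg (\<lambda>k. if k < n then 1 else 0)"

section \<open>Quantum integers\<close>

locale qparam =
  fixes q h :: complex
  assumes q_h: "h\<^sup>2 = q" and q_nz: "q \<noteq> 0" and q_nonroot: "\<And>n::nat. n \<ge> 1 \<Longrightarrow> q ^ n \<noteq> 1"
begin

lemma h_nz [simp]: "h \<noteq> 0" using q_h q_nz by auto

text \<open>The constant \<open>q - q\<^sup>-\<^sup>1\<close>.\<close>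

definition dlt :: complex where "dlt = q - inverse q"

lemma dlt_nz [simp]: "dlt \<noteq> 0"
proof
  assume "dlt = 0"
  then have "q ^ 2 = 1" using q_nz by (simp add: dlt_def field_simps power2_eq_square)
  then show False using q_nonroot[of 2] by simp
qed

lemma q_powi: "q powi n = h powi (2 * n)"
  unfolding q_h[symmetric] by (simp add: power_int_mult power_int_numeral)

lemma dlt_qint: "dlt * qint q n = h powi (2 * n) - h powi (- 2 * n)"
  using dlt_nz unfolding qint_def dlt_def q_powi by simp

lemma qint_eqI: "dlt * x = dlt * y \<Longrightarrow> x = y" by simp

lemma qint_0 [simp]: "qint q 0 = 0" by (simp add: qint_def)
lemma qint_1 [simp]: "qint q 1 = 1" using dlt_nz by (simp add: qint_def dlt_def)

lemma h_powi_add: "h powi (a + b) = h powi a * h powi b"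
  by (simp add: power_int_add)

lemma qint_add1: "qint q (n + 1) = q * qint q n + h powi (- 2 * n)"
proof (rule qint_eqI)
  have e1: "h powi (2 * (n + 1)) = q * h powi (2 * n)"
    by (simp add: q_h[symmetric] power_int_add distrib_left mult.commute)
  have e2: "h powi (- 2 * (n + 1)) = inverse q * h powi (- 2 * n)"
    by (simp add: q_h[symmetric] power_int_add distrib_left power_int_diff power_int_minus field_simps)
  have "dlt * (q * qint q n + h powi (- 2 * n)) = q * (dlt * qint q n) + dlt * h powi (- 2 * n)"
    by (simp add: algebra_simps)
  also have "\<dots> = q * h powi (2 * n) - inverse q * h powi (- 2 * n)"
    unfolding dlt_qint by (simp add: dlt_def algebra_simps)
  also have "\<dots> = dlt * qint q (n + 1)" unfolding dlt_qint e1 e2 ..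
  finally show "dlt * qint q (n + 1) = dlt * (q * qint q n + h powi (- 2 * n))" ..
qed

lemma q_powi_nat_neq: "n > 0 \<Longrightarrow> h powi (2 * int n) \<noteq> h powi (- 2 * int n)"
proof
  assume n: "n > 0" and e: "h powi (2 * int n) = h powi (- 2 * int n)"
  have "h powi (2 * int n) * h powi (2 * int n) = h powi (- 2 * int n) * h powi (2 * int n)" using e by simp
  also have "\<dots> = 1" by (simp add: power_int_minus)
  finally have "q powi (2 * int n) = 1" by (simp add: q_powi power_int_add[symmetric])
  then have "q ^ (2 * n) = 1" by (metis of_nat_mult of_nat_numeral power_int_of_nat)
  then show False using q_nonroot[of "2 * n"] n by simp
qed

lemma qint_nz: "n > 0 \<Longrightarrow> qint q (int n) \<noteq> 0"
  using q_powi_nat_neq[of n] dlt_qint[of "int n"] by auto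

section \<open>Spin matrices and fusion matrices as band operators\<close>

text \<open>The coefficient \<open>B\<^sub>j\<^sub>,\<^sub>j\<^sub>-\<^sub>k\<close> for \<open>j = n/2\<close>. Only its square matters, except in the quotients
that define \<open>E\<close>.\<close>

definition beta :: "nat \<Rightarrow> nat \<Rightarrow> complex" where
  "beta n k = Bco q (int n) (int n - 2 * int k)"

lemma beta_sq: "beta n k * beta n k = qint q (int n - int k) * qint q (int k + 1)"
proof -
  have "(int n + (int n - 2 * int k)) div 2 = int n - int k"
    "(int n - (int n - 2 * int k)) div 2 + 1 = int k + 1" by auto
  then show ?thesis
    by (simp add: beta_def Bco_def power2_eq_square[symmetric])
qed

lemma beta_self [simp]: "beta n n = 0"
  using beta_sq[of n n] by simp

lemma beta_nz: "k < n \<Longrightarrow> beta n k \<noteq> 0"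
  using beta_sq[of n k] qint_nz[of "n - k"] qint_nz[of "Suc k"]
  by (auto simp: of_nat_diff algebra_simps)

text \<open>The spin matrices \<open>S\<^sub>+\<close>, \<open>S\<^sub>-\<close> and \<open>q\<close> to the power \<open>s S\<^sub>3 / 2\<close>, for spin \<open>n/2\<close>. They are not cut off at the
dimension \<open>n + 1\<close>: given by the same formulas on all indices, they satisfy the relations of \<open>U\<^sub>qsl\<^sub>2\<close> with
the unit of the operator ring, and as \<open>beta n n = 0\<close> they commute with the projection \<open>Pr (n + 1)\<close>.\<close>

definition Sp :: "nat \<Rightarrow> aop" where "Sp n = Dg (beta n) * Up"
definition Sm :: "nat \<Rightarrow> aop" where "Sm n = Dn * Dg (beta n)"
definition kap :: "nat \<Rightarrow> int \<Rightarrow> aop" where "kap n s = Dg (\<lambda>k. h powi (s * (int n - 2 * int k)))"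

text \<open>The entries of the fusion matrices for spin \<open>(n + 1)/2\<close>. The matrix \<open>E\<close> consists of two blocks \<open>Eop n False\<close>
and \<open>Eop n True\<close>, one above the other, with entries \<open>eps n k\<close> at \<open>(k, k)\<close> and \<open>eta n k\<close> at \<open>(k, k + 1)\<close>; the
matrix \<open>F\<close> consists of two blocks side by side, with \<open>phi n k\<close> at \<open>(k, k)\<close> and \<open>psi n k\<close> at \<open>(k + 1, k)\<close>. All
entries vanish outside the matrices; for \<open>eps\<close> and \<open>eta\<close> this is automatic, as \<open>beta n n = 0\<close>.\<close>

definition eps :: "nat \<Rightarrow> nat \<Rightarrow> complex" where
  "eps n k = (\<Prod>p<k. beta n p / beta (Suc n) p)"
definition eta :: "nat \<Rightarrow> nat \<Rightarrow> complex" where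
  "eta n k = qint q (int k + 1) * eps n k / beta (Suc n) k"
definition psi :: "nat \<Rightarrow> nat \<Rightarrow> complex" where
  "psi n k = (if k < n then eta n k / ((eps n (Suc k))\<^sup>2 + (eta n k)\<^sup>2)
              else if k = n then inverse (eta n n) else 0)"
definition phi :: "nat \<Rightarrow> nat \<Rightarrow> complex" where
  "phi n k = (if k = 0 then 1 else if k \<le> n then (1 - psi n (k - 1) * eta n (k - 1)) / eps n k else 0)"

definition Eop :: "nat \<Rightarrow> bool \<Rightarrow> aop" where
  "Eop n i = (if i then Dg (eta n) * Up else Dg (eps n))"
definition Fop :: "nat \<Rightarrow> bool \<Rightarrow> aop" where
  "Fop n i = (if i then Dn * Dg (psi n) else Dg (phi n))"

lemma eps_0 [simp]: "eps n 0 = 1" by (simp add: eps_def)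
lemma eps_Suc: "eps n (Suc k) = eps n k * beta n k / beta (Suc n) k" by (simp add: eps_def)

lemma eps_zero: "k > n \<Longrightarrow> eps n k = 0"
  unfolding eps_def by (rule prod_zero) (auto intro!: bexI[of _ n])

lemma eps_nz: "k \<le> n \<Longrightarrow> eps n k \<noteq> 0"
  unfolding eps_def by (auto simp: beta_nz)

lemma eta_zero: "k > n \<Longrightarrow> eta n k = 0"
  by (simp add: eta_def eps_zero)

lemma eta_nz: "k \<le> n \<Longrightarrow> eta n k \<noteq> 0"
  unfolding eta_def using eps_nz[of k n] beta_nz[of k "Suc n"] qint_nz[of "Suc k"] by (auto simp: algebra_simps)

lemma eta_beta: "eta n k * beta (Suc n) k = qint q (int k + 1) * eps n k"
  by (cases "k \<le> n") (auto simp: eta_def beta_nz eps_zero)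

lemma eps_beta: "eps n (Suc k) * beta (Suc n) k = eps n k * beta n k"
  by (cases "k \<le> n") (auto simp: eps_Suc beta_nz eps_zero)

lemma beta_eta: "beta n k * eta n k = qint q (int k + 1) * eps n (Suc k)"
  by (simp add: eta_def eps_Suc)

lemma beta_eps: "beta n k * eps n (Suc k) = qint q (int n - int k) * eta n k"
proof -
  have "beta n k * eps n (Suc k) = (beta n k * beta n k) * eps n k / beta (Suc n) k" by (simp add: eps_Suc)
  then show ?thesis by (simp add: beta_sq eta_def)
qed

lemma eta_beta_Suc: "eta n k * beta (Suc n) (Suc k) = beta n k * eta n (Suc k)"
proof (cases "k < n")
  case True
  have nz: "beta (Suc n) k \<noteq> 0" "beta (Suc n) (Suc k) \<noteq> 0" using True by (simp_all add: beta_nz)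
  have b: "beta n k * beta n k = qint q (int n - int k) * qint q (int k + 1)"
    "beta (Suc n) (Suc k) * beta (Suc n) (Suc k) = qint q (int n - int k) * qint q (int k + 2)"
    using beta_sq[of n k] beta_sq[of "Suc n" "Suc k"] by (simp_all add: algebra_simps)
  have "(eta n k * beta (Suc n) (Suc k)) * (beta (Suc n) k * beta (Suc n) (Suc k))
      = (eta n k * beta (Suc n) k) * (beta (Suc n) (Suc k) * beta (Suc n) (Suc k))" by (simp add: mult_ac)
  also have "\<dots> = qint q (int k + 2) * (beta n k * beta n k) * eps n k"
    by (simp add: eta_beta b mult_ac)
  also have "\<dots> = beta n k * (eta n (Suc k) * beta (Suc n) (Suc k)) * beta (Suc n) k"
    using eta_beta[of n "Suc k"] eps_beta[of n k] by (simp add: algebra_simps)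
  finally show ?thesis using nz by (simp add: mult_ac)
next
  case False
  then show ?thesis by (cases "k = n") (auto simp: eta_zero)
qed

lemma eps_beta_up: "eps n k * beta (Suc n) k = q * beta n k * eps n (Suc k) + h powi (2 * int k - 2 * int n) * eta n k"
proof (cases "k \<le> n")
  case True
  have nz: "beta (Suc n) k \<noteq> 0" using True by (simp_all add: beta_nz)
  have b: "beta (Suc n) k * beta (Suc n) k = qint q (int n - int k + 1) * qint q (int k + 1)"
    using beta_sq[of "Suc n" k] by (simp add: algebra_simps)
  have "eps n k * beta (Suc n) k * beta (Suc n) k = qint q (int n - int k + 1) * (eta n k * beta (Suc n) k)"
    unfolding eta_beta by (simp add: b mult_ac)
  then have "eps n k * beta (Suc n) k = qint q (int n - int k + 1) * eta n k" using nz by simp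
  also have "\<dots> = q * (qint q (int n - int k) * eta n k) + h powi (2 * int k - 2 * int n) * eta n k"
    unfolding qint_add1 by (simp add: algebra_simps)
  finally show ?thesis unfolding beta_eps[symmetric] by (simp add: mult_ac)
next
  case False
  then show ?thesis by (simp add: eps_zero eta_zero)
qed

lemma eta_beta_down: "eta n k * beta (Suc n) k
    = q * (if k = 0 then 0 else beta n (k - 1) * eta n (k - 1)) + h powi (- 2 * int k) * eps n k"
  unfolding eta_beta qint_add1 by (cases k) (simp_all add: beta_eta algebra_simps)

lemma phi_psi: "phi n k * eps n k + (if k = 0 then 0 else psi n (k - 1) * eta n (k - 1)) = (if k < n + 2 then 1 else 0)"
proof (cases k)
  case (Suc m)
  consider "k \<le> n" | "k = n + 1" | "k > n + 1" by linarith
  then show ?thesis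
    by cases (use Suc in \<open>auto simp: phi_def eps_nz eps_zero eta_zero psi_def eta_nz\<close>)
qed (simp add: phi_def)

text \<open>The quotient of the two entries of \<open>E\<close> that mix is the same for neighbouring spins. This is what makes
  the iterated fusion matrix symmetric in neighbouring spins 1/2, see \<open>E_sym\<close> below.\<close>

lemma eta_eps_ratio: "eta (Suc m) k * eps m k = eta m k * eps (Suc m) (Suc k)"
proof -
  have "eta (Suc m) k * eps m k = qint q (int k + 1) * eps (Suc m) k * eps m k / beta (Suc (Suc m)) k"
    by (simp add: eta_def)
  also have "\<dots> = eta m k * beta (Suc m) k * eps (Suc m) k / beta (Suc (Suc m)) k"
    by (simp add: eta_beta)
  finally show ?thesis by (simp add: eps_Suc)
qed

lemma Pr_absorb [simp]:
  "Pr (Suc n) * Eop n i = Eop n i" "Eop n i * Pr (n + 2) = Eop n i"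
  "Pr (n + 2) * Fop n i = Fop n i" "Fop n i * Pr (Suc n) = Fop n i"
  by (auto intro!: aop_eqI simp: Pr_def Eop_def Fop_def eps_zero eta_zero phi_def psi_def)

lemma Pr_idem [simp]: "Pr n * Pr n = Pr n"
  by (auto intro!: aop_eqI simp: Pr_def)

lemma F_E: "Fop n False * Eop n False + Fop n True * Eop n True = Pr (n + 2)"
proof (rule aop_eqI)
  fix x :: "nat \<times> nat \<Rightarrow> complex" and a s
  show "app (Fop n False * Eop n False + Fop n True * Eop n True) x (a, s) = app (Pr (n + 2)) x (a, s)"
    using arg_cong[OF phi_psi[of n a], of "\<lambda>z. z * x (a, s)"]
    by (cases a) (simp_all add: Fop_def Eop_def Pr_def algebra_simps)
qed

text \<open>The image of two consecutive fusion matrices is symmetric in the first two spins 1/2.\<close>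

lemma E_sym: "Eop m False * Eop (Suc m) True = Eop m True * Eop (Suc m) False"
  by (rule aop_eqI) (simp add: Eop_def eta_eps_ratio[symmetric] mult_ac)

text \<open>The defect \<open>1 - E F\<close> factors through the antisymmetrization of the first two spins 1/2. Hence a column
  of two blocks \<open>V\<close> lies in the image of \<open>E\<close> once this antisymmetrization vanishes.\<close>

lemma E_F_defect:
  obtains G where
    "\<And>l. (if i = l then Pr (m + 2) else 0) - Eop (Suc m) i * Fop (Suc m) l
        = (if l then G * Eop m False else - (G * Eop m True))"
proof -
  let ?n = "Suc m"
  have ratio: "eta ?n k * eps m k = eta m k * eps ?n (Suc k)" for k by (rule eta_eps_ratio)
  show thesis
  proof (cases i)
    case False
    \<comment> \<open>The witness is forced by the second block, where \<open>Eop m False\<close> is diagonal and invertible.\<close>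
    let ?g = "\<lambda>k. if k < ?n then eps ?n (Suc k) * psi ?n k / eps m k else 0"
    define g where "g = ?g"
    have "?g k * eta m k = (if k < ?n then psi ?n k * eta ?n k else 0)" for k
      using ratio[of k] by (simp add: eps_nz field_simps)
    then have r: "g k * (eta m k * z) = (if k < ?n then psi ?n k * (eta ?n k * z) else 0)"
      "g k * (eps m k * z) = (if k < ?n then eps ?n (Suc k) * (psi ?n k * z) else 0)" for k z
      unfolding mult.assoc[symmetric] by (simp_all add: g_def eps_nz)
    show thesis
    proof (rule that, rule aop_eqI)
      fix l and x :: "nat \<times> nat \<Rightarrow> complex" and a s
      show "app ((if i = l then Pr (m + 2) else 0) - Eop ?n i * Fop ?n l) x (a, s)
          = app (if l then - (Dn * Dg g) * Eop m False else - (- (Dn * Dg g) * Eop m True)) x (a, s)"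
      proof (cases a)
        case 0 then show ?thesis using False by (auto simp: Eop_def Fop_def Pr_def phi_def)
      next
        case (Suc k)
        have d: "1 - eps ?n a * phi ?n a = psi ?n k * eta ?n k" if "k < ?n"
          using phi_psi[of ?n a] that Suc by (simp add: algebra_simps)
        have "x (a, s) - eps ?n a * (phi ?n a * x (a, s)) = (1 - eps ?n a * phi ?n a) * x (a, s)"
          by (simp add: algebra_simps)
        then have d': "x (a, s) - eps ?n a * (phi ?n a * x (a, s)) = psi ?n k * (eta ?n k * x (a, s))" if "k < ?n"
          using d[OF that] by simp
        show ?thesis
        proof (cases "k < ?n")
          case k: True
          then show ?thesis
            using False Suc d'
            by (auto simp: Eop_def Fop_def Pr_def r)
        next
          case k: False
          then show ?thesis using False Suc by (auto simp: Eop_def Fop_def Pr_def eps_zero r)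
        qed
      qed
    qed
  next
    case True
    let ?g = "\<lambda>k. if k < ?n then phi ?n (Suc k) * eps ?n (Suc k) / eps m k else 0"
    define g where "g = ?g"
    have "?g k * eta m k = (if k < ?n then eta ?n k * phi ?n (Suc k) else 0)" for k
      using ratio[of k] by (simp add: eps_nz field_simps)
    then have r: "g k * (eta m k * z) = (if k < ?n then eta ?n k * (phi ?n (Suc k) * z) else 0)"
      "g k * (eps m k * z) = (if k < ?n then phi ?n (Suc k) * (eps ?n (Suc k) * z) else 0)" for k z
      unfolding mult.assoc[symmetric] by (simp_all add: g_def eps_nz)
    show thesis
    proof (rule that, rule aop_eqI)
      fix l and x :: "nat \<times> nat \<Rightarrow> complex" and a s
      have d: "1 - eta ?n a * psi ?n a = phi ?n (Suc a) * eps ?n (Suc a)" if "a < ?n"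
        using phi_psi[of ?n "Suc a"] that by (simp add: algebra_simps)
      have "x (a, s) - eta ?n a * (psi ?n a * x (a, s)) = (1 - eta ?n a * psi ?n a) * x (a, s)"
        by (simp add: algebra_simps)
      then have d': "x (a, s) - eta ?n a * (psi ?n a * x (a, s)) = phi ?n (Suc a) * (eps ?n (Suc a) * x (a, s))" if "a < ?n"
        using d[OF that] by simp
      consider "a < ?n" | "a = ?n" | "a > ?n" by linarith
      then show "app ((if i = l then Pr (m + 2) else 0) - Eop ?n i * Fop ?n l) x (a, s)
          = app (if l then Dg g * Eop m False else - (Dg g * Eop m True)) x (a, s)"
      proof cases
        case 1
        then show ?thesis using True d'
          by (auto simp: Eop_def Fop_def Pr_def r)
      next
        case 2
        then show ?thesis using True by (auto simp: Eop_def Fop_def Pr_def eta_nz psi_def phi_def r)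
      next
        case 3
        then show ?thesis using True by (auto simp: Eop_def Fop_def Pr_def eta_zero r)
      qed
    qed
  qed
qed

lemma column_in_image_of_E_Suc:
  assumes "\<And>i. Pr (m + 2) * V i = V i"
    and "Eop m False * V True = Eop m True * V False"
  shows "V i = Eop (Suc m) i * (Fop (Suc m) False * V False + Fop (Suc m) True * V True)"
proof -
  obtain G where G: "\<And>l. (if i = l then Pr (m + 2) else 0) - Eop (Suc m) i * Fop (Suc m) l
        = (if l then G * Eop m False else - (G * Eop m True))"
    using E_F_defect by metis
  have "V i - Eop (Suc m) i * (Fop (Suc m) False * V False + Fop (Suc m) True * V True)
    = ((if i = False then Pr (m + 2) else 0) - Eop (Suc m) i * Fop (Suc m) False) * V False
      + ((if i = True then Pr (m + 2) else 0) - Eop (Suc m) i * Fop (Suc m) True) * V True"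
    using assms(1)[of i] by (cases i) (simp_all add: algebra_simps)
  also have "\<dots> = G * (Eop m False * V True) - G * (Eop m True * V False)"
    unfolding G by (simp add: algebra_simps)
  also have "\<dots> = 0" unfolding assms(2) by simp
  finally show ?thesis by simp
qed

lemma column_in_image_of_E_0:
  assumes "\<And>i. Pr 1 * V i = V i"
  shows "V i = Eop 0 i * (Fop 0 False * V False + Fop 0 True * V True)"
proof -
  have "Eop 0 i * Fop 0 l = (if i = l then Pr 1 else 0)" for l
    by (cases i; cases l; intro aop_eqI)
      (use eta_nz[of 0 0] in \<open>auto simp: Eop_def Fop_def Pr_def phi_def psi_def eps_zero eta_zero\<close>)
  then have "Eop 0 i * (Fop 0 False * V False + Fop 0 True * V True) = V i"
    using assms by (cases i) (simp_all add: distrib_left mult.assoc[symmetric])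
  then show ?thesis ..
qed

text \<open>\<open>E\<close> intertwines the spin operators of spin \<open>(n + 1)/2\<close> with their coproducts on spins \<open>1/2\<close> and \<open>n/2\<close>.
  The last two relations, \<open>Sp_E0\<close> and \<open>Sm_E1\<close>, describe its image.\<close>

lemma Sm_E0: "Sm n * Eop n False = Eop n False * Sm (Suc n)"
  by (rule aop_eqI) (auto simp: Sm_def Eop_def, metis Suc_pred eps_beta mult.commute)

lemma E1_Sm: "Eop n True * Sm (Suc n) = q \<cdot>\<^sub>C (Sm n * Eop n True) + h powi (- int n) \<cdot>\<^sub>C (kap n 1 * Eop n False)"
proof (rule aop_eqI)
  fix x :: "nat \<times> nat \<Rightarrow> complex" and a s
  have "h powi (- int n) * h powi (int n - 2 * int a) = h powi (- 2 * int a)"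
    by (subst h_powi_add[symmetric]) simp
  then show "app (Eop n True * Sm (Suc n)) x (a, s)
      = app (q \<cdot>\<^sub>C (Sm n * Eop n True) + h powi (- int n) \<cdot>\<^sub>C (kap n 1 * Eop n False)) x (a, s)"
    using arg_cong[OF eta_beta_down[of n a], of "\<lambda>z. z * x (a, s)"]
    by (cases a) (auto simp: Sm_def Eop_def kap_def algebra_simps)
qed

lemma E1_Sp: "Eop n True * Sp (Suc n) = Sp n * Eop n True"
  by (rule aop_eqI) (simp add: Sp_def Eop_def eta_beta_Suc)

lemma E0_Sp: "Eop n False * Sp (Suc n) = q \<cdot>\<^sub>C (Sp n * Eop n False) + h powi (- int n) \<cdot>\<^sub>C (kap n (- 1) * Eop n True)"
proof (rule aop_eqI)
  fix x :: "nat \<times> nat \<Rightarrow> complex" and a s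
  have "h powi (- int n) * h powi (2 * int a - int n) = h powi (2 * int a - 2 * int n)"
    by (subst h_powi_add[symmetric]) simp
  then show "app (Eop n False * Sp (Suc n)) x (a, s)
      = app (q \<cdot>\<^sub>C (Sp n * Eop n False) + h powi (- int n) \<cdot>\<^sub>C (kap n (- 1) * Eop n True)) x (a, s)"
    using arg_cong[OF eps_beta_up[of n a], of "\<lambda>z. z * x (Suc a, s)"]
    by (simp add: Sp_def Eop_def kap_def algebra_simps)
qed

lemma E0_kap: "Eop n False * kap (Suc n) s = h powi s \<cdot>\<^sub>C (kap n s * Eop n False)"
proof -
  have "h powi (s * (int (Suc n) - 2 * int a)) = h powi s * h powi (s * (int n - 2 * int a))" for a
    by (subst h_powi_add[symmetric]) (simp add: algebra_simps)
  then show ?thesis by (intro aop_eqI) (simp add: kap_def Eop_def)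
qed

lemma E1_kap: "Eop n True * kap (Suc n) s = h powi (- s) \<cdot>\<^sub>C (kap n s * Eop n True)"
proof -
  have "h powi (s * (int (Suc n) - 2 * int (Suc a))) = h powi (- s) * h powi (s * (int n - 2 * int a))" for a
    by (subst h_powi_add[symmetric]) (simp add: algebra_simps)
  then show ?thesis by (intro aop_eqI) (simp add: kap_def Eop_def)
qed

lemma Sp_E0: "dlt \<cdot>\<^sub>C (Sp n * Eop n False) = h powi int n \<cdot>\<^sub>C (kap n 1 * Eop n True) - h powi (- int n) \<cdot>\<^sub>C (kap n (- 1) * Eop n True)"
proof (rule aop_eqI)
  fix x :: "nat \<times> nat \<Rightarrow> complex" and a s
  have e: "h powi (int n) * h powi (int n - 2 * int a) = h powi (2 * (int n - int a))"
    "h powi (- int n) * h powi (2 * int a - int n) = h powi (- 2 * (int n - int a))"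
    by (subst h_powi_add[symmetric], simp)+
  have "dlt * (beta n a * eps n (Suc a)) = (dlt * qint q (int n - int a)) * eta n a" by (simp add: beta_eps)
  then have "dlt * (beta n a * eps n (Suc a)) * x (Suc a, s)
     = (h powi (int n) * h powi (int n - 2 * int a) - h powi (- int n) * h powi (2 * int a - int n)) * eta n a * x (Suc a, s)"
    unfolding e dlt_qint by simp
  then show "app (dlt \<cdot>\<^sub>C (Sp n * Eop n False)) x (a, s)
      = app (h powi int n \<cdot>\<^sub>C (kap n 1 * Eop n True) - h powi (- int n) \<cdot>\<^sub>C (kap n (- 1) * Eop n True)) x (a, s)"
    by (simp add: Sp_def Eop_def kap_def algebra_simps)
qed

lemma Sm_E1: "dlt \<cdot>\<^sub>C (Sm n * Eop n True) = h powi int n \<cdot>\<^sub>C (kap n (- 1) * Eop n False) - h powi (- int n) \<cdot>\<^sub>C (kap n 1 * Eop n False)"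
proof (rule aop_eqI)
  fix x :: "nat \<times> nat \<Rightarrow> complex" and a s
  have e: "h powi (int n) * h powi (2 * int a - int n) = h powi (2 * int a)"
    "h powi (- int n) * h powi (int n - 2 * int a) = h powi (- 2 * int a)"
    by (subst h_powi_add[symmetric], simp)+
  have "dlt * (if a = 0 then 0 else beta n (a - 1) * eta n (a - 1)) = (dlt * qint q (int a)) * eps n a"
    by (cases a) (simp_all add: beta_eta algebra_simps)
  then have "dlt * (if a = 0 then 0 else beta n (a - 1) * eta n (a - 1)) * x (a, s)
     = (h powi (int n) * h powi (2 * int a - int n) - h powi (- int n) * h powi (int n - 2 * int a)) * eps n a * x (a, s)"
    unfolding e dlt_qint by simp
  then show "app (dlt \<cdot>\<^sub>C (Sm n * Eop n True)) x (a, s)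
      = app (h powi int n \<cdot>\<^sub>C (kap n (- 1) * Eop n False) - h powi (- int n) \<cdot>\<^sub>C (kap n 1 * Eop n False)) x (a, s)"
    by (cases a) (simp_all add: Sm_def Eop_def kap_def algebra_simps)
qed

section \<open>Lax operators, R-matrices and quantum determinants\<close>

text \<open>A quadruple of operators satisfying the relations of \<open>U\<^sub>qsl\<^sub>2\<close>, in the order \<open>E\<close>, \<open>F\<close> and the powers \<open>1/2\<close>
  and \<open>-1/2\<close> of \<open>K\<close>.\<close>

definition Uq_quad :: "aop \<Rightarrow> aop \<Rightarrow> aop \<Rightarrow> aop \<Rightarrow> bool" where
  "Uq_quad e f k k' \<longleftrightarrow> k * k' = 1 \<and> k' * k = 1 \<and> k * e = q \<cdot>\<^sub>C (e * k) \<and> k * f = inverse q \<cdot>\<^sub>C (f * k)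
     \<and> e * f - f * e = inverse dlt \<cdot>\<^sub>C (k * k - k' * k')"

lemma Uq_quad_spin: "Uq_quad (Sp n) (Sm n) (kap n 1) (kap n (- 1))"
proof -
  have c: "h powi (int n - 2 * int k) * h powi (2 * int k - int n) = 1"
    "h powi (2 * int k - int n) * h powi (int n - 2 * int k) = 1" for k
    by (subst h_powi_add[symmetric], simp)+
  have k1: "kap n 1 * kap n (- 1) = 1" "kap n (- 1) * kap n 1 = 1"
    by (auto intro!: aop_eqI simp: kap_def c mult.assoc[symmetric])
  have st: "h powi (int n - 2 * int k) = q * h powi (int n - 2 * int (Suc k))" for k
    using h_powi_add[of 2 "int n - 2 * int (Suc k)"] by (simp add: q_h[symmetric] algebra_simps)
  have k2: "kap n 1 * Sp n = q \<cdot>\<^sub>C (Sp n * kap n 1)"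
  proof (rule aop_eqI)
    fix x :: "nat \<times> nat \<Rightarrow> complex" and a s
    show "app (kap n 1 * Sp n) x (a, s) = app (q \<cdot>\<^sub>C (Sp n * kap n 1)) x (a, s)"
      using st[of a] by (simp add: kap_def Sp_def del: of_nat_Suc)
  qed
  have k3: "kap n 1 * Sm n = inverse q \<cdot>\<^sub>C (Sm n * kap n 1)"
  proof (rule aop_eqI)
    fix x :: "nat \<times> nat \<Rightarrow> complex" and a s
    show "app (kap n 1 * Sm n) x (a, s) = app (inverse q \<cdot>\<^sub>C (Sm n * kap n 1)) x (a, s)"
      using q_nz st[of "a - 1"] by (cases a) (simp_all add: kap_def Sm_def)
  qed
  have k4: "Sp n * Sm n - Sm n * Sp n = inverse dlt \<cdot>\<^sub>C (kap n 1 * kap n 1 - kap n (- 1) * kap n (- 1))"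
  proof (rule aop_eqI)
    fix x :: "nat \<times> nat \<Rightarrow> complex" and a s
    have e: "h powi (int n - 2 * int a) * h powi (int n - 2 * int a) = h powi (2 * (int n - 2 * int a))"
      "h powi (2 * int a - int n) * h powi (2 * int a - int n) = h powi (- 2 * (int n - 2 * int a))"
      by (subst h_powi_add[symmetric], simp)+
    have "dlt * (dlt * (beta n a * beta n a - (if a = 0 then 0 else beta n (a - 1) * beta n (a - 1))))
      = dlt * (dlt * qint q (int n - 2 * int a))"
    proof -
      have b: "beta n a * beta n a - (if a = 0 then 0 else beta n (a - 1) * beta n (a - 1))
         = qint q (int n - int a) * qint q (int a + 1) - qint q (int n - int a + 1) * qint q (int a)"
        by (cases a) (simp_all add: beta_sq algebra_simps)
      have "dlt * (dlt * (qint q (int n - int a) * qint q (int a + 1) - qint q (int n - int a + 1) * qint q (int a)))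
         = (dlt * qint q (int n - int a)) * (dlt * h powi (- 2 * int a)) - (dlt * h powi (- 2 * (int n - int a))) * (dlt * qint q (int a))"
        unfolding qint_add1 by (simp add: algebra_simps)
      also have "\<dots> = dlt * (h powi (2 * (int n - int a) + - 2 * int a) - h powi (- 2 * (int n - int a) + 2 * int a))"
        unfolding dlt_qint h_powi_add by (simp add: algebra_simps)
      also have "\<dots> = dlt * (dlt * qint q (int n - 2 * int a))"
        unfolding dlt_qint by (simp add: algebra_simps)
      finally show ?thesis unfolding b .
    qed
    then have "beta n a * beta n a - (if a = 0 then 0 else beta n (a - 1) * beta n (a - 1)) = qint q (int n - 2 * int a)"
      by simp
    also have "\<dots> = inverse dlt * (dlt * qint q (int n - 2 * int a))" by simp
    finally have "(beta n a * beta n a - (if a = 0 then 0 else beta n (a - 1) * beta n (a - 1))) * x (a, s)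
      = inverse dlt * ((h powi (int n - 2 * int a) * h powi (int n - 2 * int a) - h powi (2 * int a - int n) * h powi (2 * int a - int n)) * x (a, s))"
      unfolding e dlt_qint by simp
    then show "app (Sp n * Sm n - Sm n * Sp n) x (a, s)
       = app (inverse dlt \<cdot>\<^sub>C (kap n 1 * kap n 1 - kap n (- 1) * kap n (- 1))) x (a, s)"
      by (cases a) (simp_all add: kap_def Sp_def Sm_def algebra_simps)
  qed
  show ?thesis unfolding Uq_quad_def using k1 k2 k3 k4 by blast
qed

end

context qparam begin

text \<open>The \<open>2 \<times> 2\<close> Lax matrix with entries built from such a quadruple.\<close>

definition lax :: "aop \<Rightarrow> aop \<Rightarrow> aop \<Rightarrow> aop \<Rightarrow> complex \<Rightarrow> bool \<Rightarrow> bool \<Rightarrow> aop" where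
  "lax e f k k' u i j =
     (if i then if j then (u * h) \<cdot>\<^sub>C k' - inverse (u * h) \<cdot>\<^sub>C k else dlt \<cdot>\<^sub>C e
      else if j then dlt \<cdot>\<^sub>C f else (u * h) \<cdot>\<^sub>C k - inverse (u * h) \<cdot>\<^sub>C k')"

lemma Uq_quadD:
  assumes "Uq_quad e f k k'"
  shows "k * k' = 1" "k' * k = 1" "k * e = q \<cdot>\<^sub>C (e * k)" "k * f = inverse q \<cdot>\<^sub>C (f * k)"
    "k' * e = inverse q \<cdot>\<^sub>C (e * k')" "k' * f = q \<cdot>\<^sub>C (f * k')"
    "e * f = f * e + inverse dlt \<cdot>\<^sub>C (k * k - k' * k')"
proof -
  show a: "k * k' = 1" "k' * k = 1" "k * e = q \<cdot>\<^sub>C (e * k)" "k * f = inverse q \<cdot>\<^sub>C (f * k)"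
    "e * f = f * e + inverse dlt \<cdot>\<^sub>C (k * k - k' * k')"
    using assms by (auto simp: Uq_quad_def algebra_simps)
  have "e * k' = k' * (k * e) * k'" by (simp add: mult.assoc[symmetric] a(1,2))
  also have "\<dots> = q \<cdot>\<^sub>C (k' * e)" by (simp add: a mult.assoc)
  finally show "k' * e = inverse q \<cdot>\<^sub>C (e * k')" using q_nz by simp
  have "f * k' = k' * (k * f) * k'" by (simp add: mult.assoc[symmetric] a(1,2))
  also have "\<dots> = inverse q \<cdot>\<^sub>C (k' * f)" by (simp add: a mult.assoc)
  finally show "k' * f = q \<cdot>\<^sub>C (f * k')" using q_nz by simp
qed

text \<open>The antisymmetric covector of two spins 1/2 is preserved, up to the factor \<open>D\<close>, by two Lax matrices with
arguments \<open>x\<close> and \<open>q x\<close>.\<close>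

lemma quantum_det:
  assumes "Uq_quad e f k k'" and x: "x \<noteq> 0"
  shows "\<exists>D. \<forall>i j. lax e f k k' x False i * lax e f k k' (q * x) True j
      - lax e f k k' x True i * lax e f k k' (q * x) False j = (if i = j then 0 else if j then D else - D)"
proof -
  note r = Uq_quadD[OF assms(1)]
  let ?d = "\<lambda>i j. lax e f k k' x False i * lax e f k k' (q * x) True j
      - lax e f k k' x True i * lax e f k k' (q * x) False j"
  have d0: "?d False False = 0" "?d True True = 0"
    using x q_nz by (auto intro!: aop_eqI simp: lax_def r algebra_simps scl_distrib simp del: app_times_op)
  have d1: "?d True False + ?d False True = 0"
    using x q_nz dlt_nz
    by (auto intro!: aop_eqI simp: lax_def r algebra_simps scl_distrib simp del: app_times_op)
      (simp add: dlt_def field_simps)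
  then have d1: "?d True False = - ?d False True" by (rule eq_neg_iff_add_eq_0[THEN iffD2])
  show ?thesis
  proof (intro exI allI)
    fix i j
    show "?d i j = (if i = j then 0 else if j then ?d False True else - ?d False True)"
      by (cases i; cases j; use d0 d1 in \<open>simp only: simp_thms if_True if_False\<close>)
  qed
qed

text \<open>Entries of the R-matrix of two spins 1/2; \<open>p\<close>, \<open>m\<close> are the row and column in the first factor, \<open>i\<close>, \<open>j\<close> those
  in the second.\<close>

definition rho :: "complex \<Rightarrow> bool \<Rightarrow> bool \<Rightarrow> bool \<Rightarrow> bool \<Rightarrow> complex" where
  "rho w p m i j = (if p = m \<and> i = j then if p = i then cc (w * q) else cc w
                    else if p \<noteq> m \<and> i \<noteq> j \<and> p \<noteq> i then dlt else 0)"

lemma RLL_half: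
  assumes "Uq_quad e f k k'" and x: "x \<noteq> 0" and y: "y \<noteq> 0"
  shows "(\<Sum>l\<in>UNIV. \<Sum>j\<in>UNIV. rho (x * y) l r i j \<cdot>\<^sub>C (lax e f k k' x p l * lax e f k k' y j j'))
       = (\<Sum>j\<in>UNIV. \<Sum>l\<in>UNIV. rho (x * y) p l j j' \<cdot>\<^sub>C (lax e f k k' y i j * lax e f k k' x l r))"
proof -
  note r = Uq_quadD[OF assms(1)]
  show ?thesis
    using x y q_nz dlt_nz
    by (cases p; cases r; cases i; cases j';
       intro aop_eqI; simp add: sum_bool lax_def rho_def cc_def r algebra_simps scl_distrib del: app_times_op;
       (simp add: field_simps)?; (simp add: dlt_def)?; (simp add: field_simps q_h[symmetric] power2_eq_square)?)
qed

text \<open>The R-matrix of spins \<open>1/2\<close> and \<open>n/2\<close> without its scalar prefactor: the Lax matrix built from the spin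
operators.\<close>

definition rr :: "nat \<Rightarrow> complex \<Rightarrow> bool \<Rightarrow> bool \<Rightarrow> aop" where
  "rr n w = lax (Sp n) (Sm n) (kap n 1) (kap n (- 1)) w"

text \<open>Two R-matrices acting on the image of \<open>E\<close> fuse to the R-matrix of the next spin. The scalar that appears is
the new factor of the prefactor.\<close>

lemma rr_E:
  assumes u: "u \<noteq> 0"
  shows "(\<Sum>m\<in>UNIV. \<Sum>j\<in>UNIV. rho (u * h powi (- int n)) p m i j \<cdot>\<^sub>C (rr n (u * h) m r * Eop n j))
      = cc (u * h powi (2 - int n)) \<cdot>\<^sub>C (Eop n i * rr (Suc n) u p r)"
proof -
  have s: "Sp n * Eop n False = inverse dlt \<cdot>\<^sub>C (h powi int n \<cdot>\<^sub>C (kap n 1 * Eop n True) - h powi (- int n) \<cdot>\<^sub>C (kap n (- 1) * Eop n True))"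
    "Sm n * Eop n True = inverse dlt \<cdot>\<^sub>C (h powi int n \<cdot>\<^sub>C (kap n (- 1) * Eop n False) - h powi (- int n) \<cdot>\<^sub>C (kap n 1 * Eop n False))"
    unfolding Sp_E0[symmetric] Sm_E1[symmetric] by simp_all
  define H where "H = h ^ n"
  have H: "H \<noteq> 0" "h powi (- int n) = inverse H" "h powi (2 - int n) = h * h * inverse H" "h ^ n = H"
    by (simp_all add: H_def power_int_minus power_int_diff power2_eq_square field_simps)
  show ?thesis
    using u q_nz dlt_nz H(1)
    by (cases p; cases r; cases i; intro aop_eqI; 
       simp add: sum_bool rr_def lax_def rho_def cc_def E0_kap E1_kap Sm_E0 [symmetric] E1_Sm E1_Sp E0_Sp s algebra_simps scl_distrib H power_int_minus del: app_times_op;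
       (simp add: field_simps)?; (simp add: dlt_def)?; (simp add: field_simps q_h[symmetric] power2_eq_square)?)
qed

text \<open>The R-matrix of spins \<open>1/2\<close> and \<open>n/2\<close> with its prefactor, cut down to the spin module; for \<open>n = 0\<close> it is
  the identity.\<close>

definition pref :: "nat \<Rightarrow> complex \<Rightarrow> complex" where
  "pref n w = (\<Prod>k<n - 1. cc (w * h powi (int n - 1 - 2 * int k)))"

definition Rop :: "nat \<Rightarrow> complex \<Rightarrow> bool \<Rightarrow> bool \<Rightarrow> aop" where
  "Rop n w i j = (if n = 0 then if i = j then Pr 1 else 0 else pref n w \<cdot>\<^sub>C (rr n w i j * Pr (Suc n)))"

lemma pref_Suc: "n > 0 \<Longrightarrow> pref (Suc n) w = pref n (w * h) * cc (w * h powi (2 - int n))"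
proof -
  assume "n > 0"
  then obtain m where m: "n = Suc m" by (cases n) auto
  have e: "w * h * h powi (int n - 1 - 2 * int k) = w * h powi (int (Suc n) - 1 - 2 * int k)" for k
  proof -
    have "h powi (int (Suc n) - 1 - 2 * int k) = h powi 1 * h powi (int n - 1 - 2 * int k)"
      by (subst h_powi_add[symmetric]) simp
    then show ?thesis by simp
  qed
  have "pref n (w * h) = (\<Prod>k<m. cc (w * h powi (int (Suc n) - 1 - 2 * int k)))"
    unfolding pref_def e by (simp add: m)
  then have "pref (Suc n) w = pref n (w * h) * cc (w * h powi (int (Suc n) - 1 - 2 * int m))"
    by (simp add: pref_def m)
  then show ?thesis by (simp add: m)
qed

lemma Sp_Pr: "Sp n * Pr (Suc n) = Pr (Suc n) * Sp n"
  and Sm_Pr: "Sm n * Pr (Suc n) = Pr (Suc n) * Sm n"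
  and kap_Pr: "kap n s * Pr m = Pr m * kap n s"
proof -
  show "Sp n * Pr (Suc n) = Pr (Suc n) * Sp n"
  proof (rule aop_eqI)
    fix x :: "nat \<times> nat \<Rightarrow> complex" and a s
    show "app (Sp n * Pr (Suc n)) x (a, s) = app (Pr (Suc n) * Sp n) x (a, s)"
      by (cases "a = n") (auto simp: Sp_def Pr_def)
  qed
  show "Sm n * Pr (Suc n) = Pr (Suc n) * Sm n"
  proof (rule aop_eqI)
    fix x :: "nat \<times> nat \<Rightarrow> complex" and a s
    show "app (Sm n * Pr (Suc n)) x (a, s) = app (Pr (Suc n) * Sm n) x (a, s)"
      by (cases "a = Suc n") (auto simp: Sm_def Pr_def)
  qed
  show "kap n s * Pr m = Pr m * kap n s" by (rule aop_eqI) (auto simp: kap_def Pr_def)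
qed

lemma rr_Pr: "rr n w i j * Pr (Suc n) = Pr (Suc n) * rr n w i j"
  by (simp add: rr_def lax_def Sp_Pr Sm_Pr kap_Pr algebra_simps)

lemma Rop_absorb [simp]: "Pr (Suc n) * Rop n w i j = Rop n w i j" "Rop n w i j * Pr (Suc n) = Rop n w i j"
  by (simp_all add: Rop_def mult.assoc) (simp_all add: rr_Pr mult.assoc[symmetric] flip: One_nat_def)

lemma Rop_E:
  assumes u: "u \<noteq> 0"
  shows "(\<Sum>m\<in>UNIV. \<Sum>j\<in>UNIV. rho (u * h powi (- int n)) p m i j \<cdot>\<^sub>C (Rop n (u * h) m r * Eop n j))
      = Eop n i * Rop (Suc n) u p r"
proof (cases "n = 0")
  case True
  have b: "beta 0 m * (eps 0 m * z) = 0" "beta 0 m * (eta 0 m * z) = 0"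
    "h powi - (s * (2 * int m)) * (eps 0 m * z) = eps 0 m * z"
    "h powi - (s * (2 * int m)) * (eta 0 m * z) = eta 0 m * z" for m z s
    by (cases m; simp add: eps_zero eta_zero)+
  \<comment> \<open>For \<open>n = 0\<close> the lemma \<open>rr_E\<close> carries a factor that may vanish, so this case is computed directly.\<close>
  have z: "Sp 0 * Eop 0 j = 0" "Sm 0 * Eop 0 j = 0" "kap 0 s * Eop 0 j = Eop 0 j" for j s
    by (cases j; intro aop_eqI; simp add: Sp_def Sm_def kap_def Eop_def eps_zero eta_zero b)+
  have *: "(\<Sum>m\<in>UNIV. \<Sum>j\<in>UNIV. rho u p m i j \<cdot>\<^sub>C ((if m = r then 1 else 0) * Eop 0 j)) = Eop 0 i * rr 1 u p r"
    using E0_Sp[of 0] E1_Sp[of 0] E1_Sm[of 0] Sm_E0[of 0] E0_kap[of 0] E1_kap[of 0]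
    using u q_nz dlt_nz
    by (cases p; cases r; cases i; intro aop_eqI;
       simp add: sum_bool rr_def lax_def rho_def cc_def z algebra_simps scl_distrib del: app_times_op;
       (simp add: field_simps)?; (simp add: dlt_def)?; (simp add: field_simps q_h[symmetric] power2_eq_square)?)
  have **: "(if m = r then Pr 1 else 0) * Eop 0 j = (if m = r then 1 else 0) * Eop 0 j" for m j
    using Pr_absorb(1)[of 0 j] by simp
  have "Eop 0 i * (rr 1 u p r * Pr 2) = Eop 0 i * rr 1 u p r"
    using rr_Pr[of 1 u p r] Pr_absorb(2)[of 0 i] by (simp add: numeral_2_eq_2 mult.assoc[symmetric])
  then have "Eop 0 i * Rop 1 u p r = Eop 0 i * rr 1 u p r" by (simp add: Rop_def pref_def numeral_2_eq_2)
  then show ?thesis unfolding True using * by (simp add: Rop_def **)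
next
  case False
  have a: "Rop n (u * h) m r * Eop n j = pref n (u * h) \<cdot>\<^sub>C (rr n (u * h) m r * Eop n j)" for m j
    using False by (simp add: Rop_def mult.assoc)
  have b: "Eop n i * Rop (Suc n) u p r = pref (Suc n) u \<cdot>\<^sub>C (Eop n i * rr (Suc n) u p r)"
    using rr_Pr[of "Suc n" u p r] Pr_absorb(2)[of n i] by (simp add: Rop_def mult.assoc[symmetric])
  show ?thesis
    unfolding a b using arg_cong[OF rr_E[OF u, of n p i r], of "scl (pref n (u * h))"]
    using False by (simp add: pref_Suc scl_sum mult.commute)
qed

section \<open>Fusion\<close>

text \<open>The fusion recursions for Lax operators and for K-operators, written with the blocks of \<open>F\<close>, \<open>R\<close> and \<open>E\<close>.
  The number \<open>n\<close> is twice the spin.\<close>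

primrec fuseL :: "(complex \<Rightarrow> bool \<Rightarrow> bool \<Rightarrow> aop) \<Rightarrow> nat \<Rightarrow> complex \<Rightarrow> aop" where
  "fuseL L 0 u = Pr 1"
| "fuseL L (Suc n) u = (\<Sum>i\<in>UNIV. \<Sum>j\<in>UNIV. Fop n i * L (u * h powi (- int n)) i j * fuseL L n (u * h) * Eop n j)"

primrec fuseK :: "(complex \<Rightarrow> bool \<Rightarrow> bool \<Rightarrow> aop) \<Rightarrow> nat \<Rightarrow> complex \<Rightarrow> aop" where
  "fuseK K 0 u = Pr 1"
| "fuseK K (Suc n) u = (\<Sum>i\<in>UNIV. \<Sum>l\<in>UNIV. \<Sum>m\<in>UNIV.
     Fop n i * K (u * h powi (- int n)) i l * Rop n (u\<^sup>2 * h powi (1 - int n)) l m * fuseK K n (u * h) * Eop n m)"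

lemma fuseL_absorb [simp]: "Pr (Suc n) * fuseL L n u = fuseL L n u" "fuseL L n u * Pr (Suc n) = fuseL L n u"
proof -
  show "Pr (Suc n) * fuseL L n u = fuseL L n u"
    using Pr_absorb(3) by (cases n) (simp_all add: sum_bool distrib_left mult.assoc[symmetric])
  show "fuseL L n u * Pr (Suc n) = fuseL L n u"
    using Pr_absorb(2) by (cases n) (simp_all add: sum_bool distrib_right mult.assoc)
qed

lemma fuseK_absorb [simp]: "Pr (Suc n) * fuseK L n u = fuseK L n u" "fuseK L n u * Pr (Suc n) = fuseK L n u"
proof -
  show "Pr (Suc n) * fuseK L n u = fuseK L n u"
    using Pr_absorb(3) by (cases n) (simp_all add: sum_bool distrib_left mult.assoc[symmetric])
  show "fuseK L n u * Pr (Suc n) = fuseK L n u"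
    using Pr_absorb(2) by (cases n) (simp_all add: sum_bool distrib_right mult.assoc)
qed

lemma quantum_comm:
  assumes "quantum Q"
  shows "Eop n i * Q = Q * Eop n i" "Fop n i * Q = Q * Fop n i" "Pr n * Q = Q * Pr n" "Rop n w i j * Q = Q * Rop n w i j"
    "Eop n i * (Q * z) = Q * (Eop n i * z)" "Fop n i * (Q * z) = Q * (Fop n i * z)" "Pr n * (Q * z) = Q * (Pr n * z)"
    "Rop n w i j * (Q * z) = Q * (Rop n w i j * z)"
proof -
  have c: "Dg c * Q = Q * Dg c" "Up * Q = Q * Up" "Dn * Q = Q * Dn"
    "Dg c * (Q * z) = Q * (Dg c * z)" "Up * (Q * z) = Q * (Up * z)" "Dn * (Q * z) = Q * (Dn * z)" for c z
    using assms by (auto simp: quantum_def mult.assoc[symmetric])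
  show 1: "Eop n i * Q = Q * Eop n i" "Fop n i * Q = Q * Fop n i" "Pr n * Q = Q * Pr n"
    by (auto simp: Eop_def Fop_def Pr_def c mult.assoc)
  show 2: "Rop n w i j * Q = Q * Rop n w i j"
    by (auto simp: Rop_def rr_def lax_def Sp_def Sm_def kap_def Pr_def c mult.assoc distrib_left distrib_right
      left_diff_distrib right_diff_distrib)
  show "Eop n i * (Q * z) = Q * (Eop n i * z)" "Fop n i * (Q * z) = Q * (Fop n i * z)" "Pr n * (Q * z) = Q * (Pr n * z)"
    "Rop n w i j * (Q * z) = Q * (Rop n w i j * z)"
    by (simp_all add: mult.assoc[symmetric] 1 2)
qed

lemma quantum_lax: "quantum e \<Longrightarrow> quantum f \<Longrightarrow> quantum k \<Longrightarrow> quantum k' \<Longrightarrow> quantum (lax e f k k' u i j)"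
  by (auto simp: quantum_def lax_def algebra_simps)

lemma column_in_image_of_E:
  assumes "\<And>i. Pr (Suc n) * V i = V i"
    and "\<And>m. n = Suc m \<Longrightarrow> Eop m False * V True - Eop m True * V False = 0"
  shows "V i = Eop n i * (\<Sum>l\<in>UNIV. Fop n l * V l)"
proof (cases n)
  case 0
  with column_in_image_of_E_0[of V i] assms show ?thesis by (simp add: sum_bool)
next
  case (Suc m)
  with column_in_image_of_E_Suc[of m V i] assms show ?thesis by (simp add: sum_bool)
qed

text \<open>The product of two Lax operators at shifted arguments preserves the image of \<open>E\<close>.\<close>

lemma fuseL_image:
  assumes q: "Uq_quad e f k k'" and qu: "quantum e" "quantum f" "quantum k" "quantum k'" and u: "u \<noteq> 0"
  defines "L \<equiv> lax e f k k'"
  shows "(\<Sum>j\<in>UNIV. L (u * h powi (- int n)) i j * fuseL L n (u * h) * Eop n j) = Eop n i * fuseL L (Suc n) u"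
  using u
proof (induction n arbitrary: u i)
  case (0 u)
  have quL: "quantum (L u i j)" for u i j unfolding L_def using qu by (rule quantum_lax)
  note c = quantum_comm[OF quL]
  let ?V = "\<lambda>i. \<Sum>j\<in>UNIV. L (u * h powi (- int 0)) i j * fuseL L 0 (u * h) * Eop 0 j"
  have "?V i = Eop 0 i * (\<Sum>l\<in>UNIV. Fop 0 l * ?V l)"
    by (rule column_in_image_of_E[of 0 ?V i]) (simp_all add: sum_bool algebra_simps c)
  also have "(\<Sum>l\<in>UNIV. Fop 0 l * ?V l) = fuseL L (Suc 0) u"
    by (simp add: sum_bool algebra_simps)
  finally show ?case .
next
  case (Suc m u)
  have quL: "quantum (L u i j)" for u i j unfolding L_def using qu by (rule quantum_lax)
  note c = quantum_comm[OF quL]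
  let ?n = "Suc m"
  let ?V = "\<lambda>i. \<Sum>j\<in>UNIV. L (u * h powi (- int ?n)) i j * fuseL L ?n (u * h) * Eop ?n j"
  have sh: "u * h * h powi (- int m) = q * (u * h powi (- int ?n))"
    by (simp add: q_h[symmetric] power_int_diff power_int_minus power2_eq_square field_simps)
  have uh: "u * h \<noteq> 0" using Suc by simp
  have a: "u * h powi (- int ?n) \<noteq> 0" using Suc by simp
  obtain D where "\<forall>i j. lax e f k k' (u * h powi (- int ?n)) False i * lax e f k k' (q * (u * h powi (- int ?n))) True j
      - lax e f k k' (u * h powi (- int ?n)) True i * lax e f k k' (q * (u * h powi (- int ?n))) False j
      = (if i = j then 0 else if j then D else - D)"
    using quantum_det[OF q a] by blast
  note D = this[folded L_def sh, rule_format]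
  \<comment> \<open>The induction hypothesis splits the second factor, so that two spins 1/2 stand in front, with arguments
    \<open>x\<close> and \<open>q x\<close>.\<close>
  have EV: "Eop m i * ?V p = (\<Sum>j\<in>UNIV. \<Sum>k\<in>UNIV. L (u * h powi (- int ?n)) p j * L (u * h * h powi (- int m)) i k
       * (fuseL L m (u * h * h) * (Eop m k * Eop ?n j)))" for i p
  proof -
    have "Eop m i * ?V p = (\<Sum>j\<in>UNIV. L (u * h powi (- int ?n)) p j * (Eop m i * fuseL L ?n (u * h)) * Eop ?n j)"
      by (simp only: sum_distrib_left mult.assoc c)
    also have "\<dots> = (\<Sum>j\<in>UNIV. L (u * h powi (- int ?n)) p j * (\<Sum>k\<in>UNIV. L (u * h * h powi (- int m)) i k * fuseL L m (u * h * h) * Eop m k) * Eop ?n j)"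
      by (simp only: Suc.IH[OF uh])
    finally show ?thesis by (simp only: sum_distrib_left sum_distrib_right mult.assoc)
  qed
  have "?V i = Eop ?n i * (\<Sum>l\<in>UNIV. Fop ?n l * ?V l)"
  proof (rule column_in_image_of_E[of ?n ?V i])
    show "Pr (Suc ?n) * ?V i = ?V i" for i
      by (simp only: sum_distrib_left mult.assoc c) (simp only: mult.assoc[symmetric] fuseL_absorb)
    show "Eop m' False * ?V True - Eop m' True * ?V False = 0" if "Suc m = Suc m'" for m'
    proof -
      have m': "m' = m" using that by simp
      have "Eop m False * ?V True - Eop m True * ?V False
        = - (\<Sum>j\<in>UNIV. \<Sum>k\<in>UNIV. (L (u * h powi (- int ?n)) False j * L (u * h * h powi (- int m)) True k
            - L (u * h powi (- int ?n)) True j * L (u * h * h powi (- int m)) False k) * (fuseL L m (u * h * h) * (Eop m k * Eop ?n j)))"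
        unfolding EV by (simp only: sum_bool algebra_simps) simp
      also have "\<dots> = 0" unfolding D by (simp add: sum_bool E_sym)
      finally show ?thesis unfolding m' .
    qed
  qed
  also have "(\<Sum>l\<in>UNIV. Fop ?n l * ?V l) = fuseL L (Suc ?n) u"
    by (simp only: fuseL.simps(2)[of L ?n u] sum_distrib_left mult.assoc)
  finally show ?case .
qed

text \<open>The exchange relation, by induction on the spin of the second auxiliary space. The prefactor of \<open>R\<close> is
  kept, so that nothing has to be cancelled.\<close>

lemma RLL_fused:
  assumes q: "Uq_quad e f k k'" and qu: "quantum e" "quantum f" "quantum k" "quantum k'"
    and x: "x \<noteq> 0" and y: "y \<noteq> 0"
  defines "L \<equiv> lax e f k k'"
  shows "(\<Sum>l\<in>UNIV. L x p l * Rop n (x * y) l r * fuseL L n y) = (\<Sum>l\<in>UNIV. fuseL L n y * Rop n (x * y) p l * L x l r)"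
  using y
proof (induction n arbitrary: y p r)
  case (0 y)
  have quL: "quantum (L u i j)" for u i j unfolding L_def using qu by (rule quantum_lax)
  note c = quantum_comm[OF quL]
  show ?case by (cases p; cases r) (simp_all add: sum_bool Rop_def c mult.assoc)
next
  case (Suc n y)
  have quL: "quantum (L u i j)" for u i j unfolding L_def using qu by (rule quantum_lax)
  note c = quantum_comm[OF quL]
  have ynz: "y * h \<noteq> 0" "x * y \<noteq> 0" "y * h powi (- int n) \<noteq> 0" using Suc.prems x by simp_all
  define R T R' T' ly w where "R = Rop n (x * y * h)" and "T = fuseL L n (y * h)" and "R' = Rop (Suc n) (x * y)"
    and "T' = fuseL L (Suc n) y" and "ly = L (y * h powi (- int n))" and "w = x * y * h powi (- int n)"
  have E_R: "Eop n i * R' p r = (\<Sum>m\<in>UNIV. \<Sum>j\<in>UNIV. rho w p m i j \<cdot>\<^sub>C (R m r * Eop n j))" for i p r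
    unfolding R_def R'_def w_def using Rop_E[OF ynz(2), of n p i r] by (simp only: mult.assoc)
  have E_T: "Eop n i * T' = (\<Sum>j\<in>UNIV. ly i j * T * Eop n j)" for i
    unfolding T_def T'_def ly_def L_def by (rule fuseL_image[OF q qu Suc.prems, symmetric])
  have IH: "(\<Sum>l\<in>UNIV. L x p l * R l r * T) = (\<Sum>l\<in>UNIV. T * R p l * L x l r)" for p r
    unfolding R_def T_def using Suc.IH[OF ynz(1), of p r] by (simp only: mult.assoc)
  have base: "(\<Sum>l\<in>UNIV. \<Sum>j\<in>UNIV. rho w l r i j \<cdot>\<^sub>C (L x p l * ly j j'))
       = (\<Sum>j\<in>UNIV. \<Sum>l\<in>UNIV. rho w p l j j' \<cdot>\<^sub>C (ly i j * L x l r))" for p r i j'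
    unfolding w_def ly_def L_def using RLL_half[OF q x ynz(3), of r i p j'] by (simp only: mult.assoc)
  have cL: "Eop n i * L x p l = L x p l * Eop n i" "Eop n i * (L x p l * z) = L x p l * (Eop n i * z)"
    "R p' r' * ly p l = ly p l * R p' r'" "R p' r' * (ly p l * z) = ly p l * (R p' r' * z)" for i p l z p' r'
    unfolding ly_def R_def by (rule c)+
  have main: "Eop n i * (\<Sum>l\<in>UNIV. L x p l * R' l r * T') = Eop n i * (\<Sum>l\<in>UNIV. T' * R' p l * L x l r)" for i
  proof -
    have "Eop n i * (\<Sum>l\<in>UNIV. L x p l * R' l r * T') = (\<Sum>l\<in>UNIV. L x p l * (Eop n i * R' l r) * T')"
      by (simp only: sum_distrib_left mult.assoc cL)
    also have "\<dots> = (\<Sum>l\<in>UNIV. \<Sum>m\<in>UNIV. \<Sum>j\<in>UNIV. rho w l m i j \<cdot>\<^sub>C (L x p l * R m r * (Eop n j * T')))"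
      unfolding E_R by (simp add: sum_distrib_left sum_distrib_right mult.assoc)
    also have "\<dots> = (\<Sum>m\<in>UNIV. \<Sum>j'\<in>UNIV. (\<Sum>l\<in>UNIV. \<Sum>j\<in>UNIV. rho w l m i j \<cdot>\<^sub>C (L x p l * ly j j')) * (R m r * T * Eop n j'))"
      unfolding E_T by (simp add: sum_bool distrib_left distrib_right mult.assoc cL scl_distrib add_ac)
    also have "\<dots> = (\<Sum>j'\<in>UNIV. \<Sum>j\<in>UNIV. \<Sum>l\<in>UNIV. rho w p l j j' \<cdot>\<^sub>C (ly i j * (\<Sum>m\<in>UNIV. L x l m * R m r * T) * Eop n j'))"
      unfolding base by (simp add: sum_bool distrib_left distrib_right mult.assoc scl_distrib add_ac)
    also have "\<dots> = (\<Sum>m\<in>UNIV. \<Sum>j\<in>UNIV. ly i j * T * (\<Sum>l\<in>UNIV. \<Sum>j'\<in>UNIV. rho w p l j j' \<cdot>\<^sub>C (R l m * Eop n j')) * L x m r)"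
      unfolding IH by (simp add: sum_bool distrib_left distrib_right mult.assoc scl_distrib add_ac cL)
    also have "\<dots> = (\<Sum>m\<in>UNIV. (\<Sum>j\<in>UNIV. ly i j * T * Eop n j) * R' p m * L x m r)"
      unfolding E_R[symmetric] by (simp only: sum_distrib_right mult.assoc)
    also have "\<dots> = Eop n i * (\<Sum>l\<in>UNIV. T' * R' p l * L x l r)"
      unfolding E_T[symmetric] by (simp only: sum_distrib_left mult.assoc)
    finally show ?thesis .
  qed
  have FE: "Fop n False * (Eop n False * z) + Fop n True * (Eop n True * z) = Pr (Suc (Suc n)) * z" for z
    using F_E[of n] by (simp add: mult.assoc[symmetric] distrib_right[symmetric])
  have ab: "Pr (Suc (Suc n)) * (\<Sum>l\<in>UNIV. L x p l * R' l r * T') = (\<Sum>l\<in>UNIV. L x p l * R' l r * T')"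
    "Pr (Suc (Suc n)) * (\<Sum>l\<in>UNIV. T' * R' p l * L x l r) = (\<Sum>l\<in>UNIV. T' * R' p l * L x l r)"
  proof -
    have "Pr (Suc (Suc n)) * R' l r = R' l r" "Pr (Suc (Suc n)) * T' = T'" for l r
      by (simp_all only: R'_def T'_def Rop_absorb fuseL_absorb)
    then show "Pr (Suc (Suc n)) * (\<Sum>l\<in>UNIV. L x p l * R' l r * T') = (\<Sum>l\<in>UNIV. L x p l * R' l r * T')"
      "Pr (Suc (Suc n)) * (\<Sum>l\<in>UNIV. T' * R' p l * L x l r) = (\<Sum>l\<in>UNIV. T' * R' p l * L x l r)"
      by (simp_all only: sum_distrib_left mult.assoc c) (simp_all only: mult.assoc[symmetric])
  qed
  have "(\<Sum>l\<in>UNIV. L x p l * R' l r * T') = (\<Sum>l\<in>UNIV. T' * R' p l * L x l r)"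
    using FE[of "\<Sum>l\<in>UNIV. L x p l * R' l r * T'"] FE[of "\<Sum>l\<in>UNIV. T' * R' p l * L x l r"]
    unfolding main ab by simp
  then show ?case unfolding R'_def T'_def .
qed

text \<open>The entries of the scalar K-matrix of spin 1/2.\<close>

definition kmat :: "complex \<Rightarrow> complex \<Rightarrow> complex \<Rightarrow> complex \<Rightarrow> complex \<Rightarrow> bool \<Rightarrow> bool \<Rightarrow> complex" where
  "kmat kp km ep em u i j = 
     (if i then if j then u * em + inverse u * ep else km * cc (u\<^sup>2) / dlt
      else if j then kp * cc (u\<^sup>2) / dlt else u * ep + inverse u * em)"

text \<open>The antisymmetric covector is preserved, up to the factor \<open>X\<close>, by \<open>K\<^sub>1(a) R(a b) K\<^sub>2(b)\<close> at \<open>b = q a\<close>, where the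
reflection equation degenerates.\<close>

lemma reflection_det:
  fixes kp km ep em :: complex
  assumes "a \<noteq> 0"
  defines "K \<equiv> kmat kp km ep em"
  shows "\<exists>X. \<forall>m r. (\<Sum>l\<in>UNIV. \<Sum>k\<in>UNIV. K a False l * rho (a * (q * a)) l m True k * K (q * a) k r
       - K a True l * rho (a * (q * a)) l m False k * K (q * a) k r) = (if m = r then 0 else if r then X else - X)"
proof -
  let ?d = "\<lambda>m r. (\<Sum>l\<in>UNIV. \<Sum>k\<in>UNIV. K a False l * rho (a * (q * a)) l m True k * K (q * a) k r
       - K a True l * rho (a * (q * a)) l m False k * K (q * a) k r)"
  define c0 c1 c2 where "c0 = cc (q * a\<^sup>2)" and "c1 = cc (a\<^sup>2)" and "c2 = cc ((q * a)\<^sup>2)"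
  have rho_eq: "rho (a * (q * a)) p m i j = (if p = m \<and> i = j then if p = i then c2 else c0
      else if p \<noteq> m \<and> i \<noteq> j \<and> p \<noteq> i then dlt else 0)" for p m i j
    by (simp add: rho_def c0_def c2_def power2_eq_square mult_ac)
  define A1 D1 A2 D2 where "A1 = K a False False" and "D1 = K a True True"
    and "A2 = K (q * a) False False" and "D2 = K (q * a) True True"
  have off: "K a False True = kp * c1 / dlt" "K a True False = km * c1 / dlt"
    "K (q * a) False True = kp * c2 / dlt" "K (q * a) True False = km * c2 / dlt"
    by (simp_all add: K_def kmat_def c1_def c2_def)
  have rel: "A1 * c0 = c1 * A2 + dlt * D1" "D1 * c0 = c1 * D2 + dlt * A1"
    using assms(1) q_nz
    by (simp_all add: A1_def D1_def A2_def D2_def K_def kmat_def cc_def c0_def c1_def dlt_def field_simps power2_eq_square)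
  have "?d False False = km * c2 / dlt * (A1 * c0 - (c1 * A2 + dlt * D1))"
    "?d True True = kp * c2 / dlt * (c1 * D2 + dlt * A1 - D1 * c0)"
    by (simp_all add: sum_bool rho_eq off A1_def[symmetric] D1_def[symmetric] A2_def[symmetric] D2_def[symmetric])
      (simp_all add: field_simps)
  then have d0: "?d False False = 0" "?d True True = 0" unfolding rel by simp_all
  have "?d True False + ?d False True = (A1 * c0) * D2 - (D1 * c0) * A2 + dlt * (A1 * A2 - D1 * D2)"
    by (simp add: sum_bool rho_eq off A1_def[symmetric] D1_def[symmetric] A2_def[symmetric] D2_def[symmetric])
      (simp add: field_simps)
  also have "\<dots> = 0" unfolding rel by (simp add: algebra_simps)
  finally have "?d True False + ?d False True = 0" .
  then have d1: "?d True False = - ?d False True" by (rule eq_neg_iff_add_eq_0[THEN iffD2])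
  show ?thesis
  proof (intro exI allI)
    fix i j
    show "?d i j = (if i = j then 0 else if j then ?d False True else - ?d False True)"
      by (cases i; cases j; use d0 d1 in \<open>simp only: simp_thms if_True if_False\<close>)
  qed
qed

lemma Rop_det:
  assumes "x \<noteq> 0"
  shows "\<exists>D. \<forall>i j. Rop n x False i * Rop n (q * x) True j - Rop n x True i * Rop n (q * x) False j
    = (if i = j then 0 else if j then D else - D)"
proof (cases "n = 0")
  case True
  then show ?thesis by (intro exI[of _ "Pr 1"]) (auto simp: Rop_def)
next
  case False
  obtain D where D: "\<forall>i j. rr n x False i * rr n (q * x) True j - rr n x True i * rr n (q * x) False j
      = (if i = j then 0 else if j then D else - D)"
    using quantum_det[OF Uq_quad_spin assms] unfolding rr_def by blast
  have P: "rr n x i j * Pr (Suc n) * (rr n (q * x) i' j' * Pr (Suc n)) = rr n x i j * rr n (q * x) i' j' * Pr (Suc n)" for i j i' j'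
    using rr_Pr[of n "q * x" i' j'] by (simp add: mult.assoc) (simp add: mult.assoc[symmetric])
  have "Rop n x False i * Rop n (q * x) True j - Rop n x True i * Rop n (q * x) False j
      = (pref n x * pref n (q * x)) \<cdot>\<^sub>C ((rr n x False i * rr n (q * x) True j - rr n x True i * rr n (q * x) False j) * Pr (Suc n))" for i j
    using False by (simp add: Rop_def P left_diff_distrib scl_distrib mult.commute)
  then have E: "Rop n x False i * Rop n (q * x) True j - Rop n x True i * Rop n (q * x) False j
      = (pref n x * pref n (q * x)) \<cdot>\<^sub>C ((if i = j then 0 else if j then D else - D) * Pr (Suc n))" for i j
    using D by simp
  show ?thesis unfolding E
    by (intro exI[of _ "(pref n x * pref n (q * x)) \<cdot>\<^sub>C (D * Pr (Suc n))"]) (simp add: uminus_scl mult.commute)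
qed

text \<open>The same for the scalar K-matrix. Here the antisymmetric covector passes through \<open>K\<^sub>1 R\<^sub>1\<^sub>2 K\<^sub>2\<close>, by
\<open>reflection_det\<close>, and then through the R-matrices \<open>R\<^sub>1\<^sub>3 R\<^sub>2\<^sub>3\<close>, by \<open>Rop_det\<close>.\<close>

lemma fuseK_image:
  fixes kp km ep em :: complex
  assumes u: "u \<noteq> 0"
  defines "K \<equiv> \<lambda>u i j. kmat kp km ep em u i j \<cdot>\<^sub>C 1"
  shows "(\<Sum>l\<in>UNIV. \<Sum>j\<in>UNIV. K (u * h powi (- int n)) i l * Rop n (u\<^sup>2 * h powi (1 - int n)) l j * fuseK K n (u * h) * Eop n j)
    = Eop n i * fuseK K (Suc n) u"
  using u
proof (induction n arbitrary: u i)
  case (0 u)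
  let ?V = "\<lambda>i. \<Sum>l\<in>UNIV. \<Sum>j\<in>UNIV. K (u * h powi (- int 0)) i l * Rop 0 (u\<^sup>2 * h powi (1 - int 0)) l j * fuseK K 0 (u * h) * Eop 0 j"
  have "?V i = Eop 0 i * (\<Sum>l\<in>UNIV. Fop 0 l * ?V l)"
    by (rule column_in_image_of_E[of 0 ?V i]) (simp_all add: sum_bool algebra_simps K_def Rop_def)
  also have "(\<Sum>l\<in>UNIV. Fop 0 l * ?V l) = fuseK K (Suc 0) u"
    by (simp add: sum_bool algebra_simps)
  finally show ?case .
next
  case (Suc m u)
  let ?n = "Suc m"
  define a where "a = u * h powi (- int ?n)"
  define w where "w = u\<^sup>2 * h powi (1 - int m)"
  have a: "a \<noteq> 0" "u * h \<noteq> 0" "w \<noteq> 0" using Suc.prems by (simp_all add: a_def w_def)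
  have pw: "h powi (1 - int m) = h * h powi (- int m)" "h powi (- int m) = h * h powi (- int ?n)"
    "h powi (1 - int ?n) = h powi (- int m)"
    using h_powi_add[of 1 "- int m"] h_powi_add[of 1 "- int ?n"] by simp_all
  have e1: "u * h * h powi (- int m) = q * a"
    unfolding a_def pw(2) q_h[symmetric] by (simp add: power2_eq_square mult_ac)
  have e2: "u\<^sup>2 * h powi (1 - int ?n) * h = w" unfolding w_def pw by (simp add: mult_ac)
  have e3: "(u * h)\<^sup>2 * h powi (1 - int m) = q * w" unfolding w_def q_h[symmetric] by (simp add: power2_eq_square mult_ac)
  have e4: "u\<^sup>2 * h powi (1 - int ?n) * h powi (- int m) = a * (q * a)"
    unfolding a_def pw(3) pw(2) q_h[symmetric] by (simp add: power2_eq_square mult_ac)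
  have e5: "u\<^sup>2 * h powi (1 - int ?n) \<noteq> 0" using Suc.prems by simp
  define R where "R = Rop m w"
  define R' where "R' = Rop m (q * w)"
  define T where "T = fuseK K m (u * h * h)"
  let ?k = "kmat kp km ep em"
  let ?V = "\<lambda>i. \<Sum>l\<in>UNIV. \<Sum>j\<in>UNIV. K a i l * Rop ?n (u\<^sup>2 * h powi (1 - int ?n)) l j * fuseK K ?n (u * h) * Eop ?n j"
  have ER: "Eop m p * Rop ?n (u\<^sup>2 * h powi (1 - int ?n)) l j
      = (\<Sum>s\<in>UNIV. \<Sum>k\<in>UNIV. rho (a * (q * a)) l s p k \<cdot>\<^sub>C (R s j * Eop m k))" for p l j
    using Rop_E[OF e5, of m l p j] unfolding e2 e4 R_def by simp
  have ET: "Eop m k * fuseK K ?n (u * h) = (\<Sum>k'\<in>UNIV. \<Sum>j'\<in>UNIV. ?k (q * a) k k' \<cdot>\<^sub>C (R' k' j' * T * Eop m j'))" for k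
    using Suc.IH[OF a(2), of k] unfolding e1 e3 R'_def T_def by (simp add: K_def)
  have EV: "Eop m p * ?V i = (\<Sum>s\<in>UNIV. \<Sum>k'\<in>UNIV. \<Sum>j\<in>UNIV. \<Sum>j'\<in>UNIV.
      (\<Sum>l\<in>UNIV. \<Sum>k\<in>UNIV. ?k a i l * rho (a * (q * a)) l s p k * ?k (q * a) k k')
        \<cdot>\<^sub>C (R s j * R' k' j' * T * (Eop m j' * Eop ?n j)))" for i p
  proof -
    have "Eop m p * ?V i = (\<Sum>l\<in>UNIV. \<Sum>j\<in>UNIV. ?k a i l \<cdot>\<^sub>C ((Eop m p * Rop ?n (u\<^sup>2 * h powi (1 - int ?n)) l j) * fuseK K ?n (u * h) * Eop ?n j))"
      by (simp add: K_def sum_distrib_left mult.assoc del: fuseK.simps)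
    also have "\<dots> = (\<Sum>l\<in>UNIV. \<Sum>j\<in>UNIV. \<Sum>s\<in>UNIV. \<Sum>k\<in>UNIV. (?k a i l * rho (a * (q * a)) l s p k) \<cdot>\<^sub>C (R s j * (Eop m k * fuseK K ?n (u * h)) * Eop ?n j))"
      unfolding ER by (simp add: sum_distrib_left sum_distrib_right mult.assoc scl_sum del: fuseK.simps)
    also have "\<dots> = (\<Sum>l\<in>UNIV. \<Sum>j\<in>UNIV. \<Sum>s\<in>UNIV. \<Sum>k\<in>UNIV. \<Sum>k'\<in>UNIV. \<Sum>j'\<in>UNIV.
        (?k a i l * rho (a * (q * a)) l s p k * ?k (q * a) k k') \<cdot>\<^sub>C (R s j * R' k' j' * T * (Eop m j' * Eop ?n j)))"
      unfolding ET by (simp add: sum_distrib_left sum_distrib_right mult.assoc scl_sum)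
    also have "\<dots> = (\<Sum>s\<in>UNIV. \<Sum>k'\<in>UNIV. \<Sum>j\<in>UNIV. \<Sum>j'\<in>UNIV.
      (\<Sum>l\<in>UNIV. \<Sum>k\<in>UNIV. ?k a i l * rho (a * (q * a)) l s p k * ?k (q * a) k k')
        \<cdot>\<^sub>C (R s j * R' k' j' * T * (Eop m j' * Eop ?n j)))"
      by (simp only: sum_bool scl_distrib add_ac)
    finally show ?thesis .
  qed
  obtain X where X: "\<And>s r. (\<Sum>l\<in>UNIV. \<Sum>k\<in>UNIV. ?k a False l * rho (a * (q * a)) l s True k * ?k (q * a) k r
       - ?k a True l * rho (a * (q * a)) l s False k * ?k (q * a) k r) = (if s = r then 0 else if r then X else - X)"
    using reflection_det[OF a(1), of kp km ep em] by blast
  obtain D where D: "\<And>i j. R False i * R' True j - R True i * R' False j = (if i = j then 0 else if j then D else - D)"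
    using Rop_det[OF a(3), of m] unfolding R_def R'_def by blast
  have "?V i = Eop ?n i * (\<Sum>l\<in>UNIV. Fop ?n l * ?V l)"
  proof (rule column_in_image_of_E[of ?n ?V i])
    have "Pr (Suc ?n) * Rop ?n z l j = Rop ?n z l j" for z l j by (rule Rop_absorb)
    then show "Pr (Suc ?n) * ?V i = ?V i" for i
      by (simp add: K_def sum_distrib_left mult.assoc[symmetric] del: fuseK.simps)
    show "Eop m' False * ?V True - Eop m' True * ?V False = 0" if "Suc m = Suc m'" for m'
    proof -
      have m': "m' = m" using that by simp
      have "Eop m True * ?V False - Eop m False * ?V True
        = (\<Sum>s\<in>UNIV. \<Sum>k'\<in>UNIV. \<Sum>j\<in>UNIV. \<Sum>j'\<in>UNIV.
           (\<Sum>l\<in>UNIV. \<Sum>k\<in>UNIV. ?k a False l * rho (a * (q * a)) l s True k * ?k (q * a) k k'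
              - ?k a True l * rho (a * (q * a)) l s False k * ?k (q * a) k k')
           \<cdot>\<^sub>C (R s j * R' k' j' * T * (Eop m j' * Eop ?n j)))"
        unfolding EV by (simp only: sum_subtractf scl_distrib)
      also have "\<dots> = (\<Sum>j\<in>UNIV. \<Sum>j'\<in>UNIV. X \<cdot>\<^sub>C ((R False j * R' True j' - R True j * R' False j') * (T * (Eop m j' * Eop ?n j))))"
        unfolding X by (simp add: sum_bool algebra_simps scl_distrib(1,2,4,5) scl_minus)
      also have "\<dots> = 0" unfolding D by (simp add: sum_bool E_sym scl_minus)
      finally show ?thesis unfolding m' by simp
    qed
  qed
  also have "(\<Sum>l\<in>UNIV. Fop ?n l * ?V l) = fuseK K (Suc ?n) u"
    by (simp only: fuseK.simps(2)[of K ?n u] sum_distrib_left mult.assoc a_def)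
  finally show ?case unfolding a_def .
qed

section \<open>Dressing\<close>

text \<open>The spin-1/2 K-matrix and the fused K-operator, dressed with the Lax operators of the sites \<open>1, \<dots>, m\<close>.\<close>

primrec dressH :: "(nat \<Rightarrow> complex \<Rightarrow> bool \<Rightarrow> bool \<Rightarrow> aop) \<Rightarrow> (complex \<Rightarrow> bool \<Rightarrow> bool \<Rightarrow> aop) \<Rightarrow> (nat \<Rightarrow> complex)
    \<Rightarrow> nat \<Rightarrow> complex \<Rightarrow> bool \<Rightarrow> bool \<Rightarrow> aop" where
  "dressH L K v 0 u i j = K u i j"
| "dressH L K v (Suc m) u i j = (\<Sum>k\<in>UNIV. \<Sum>l\<in>UNIV. L (Suc m) (u * v (Suc m)) i k * dressH L K v m u k l
      * L (Suc m) (u * inverse (v (Suc m))) l j)"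

primrec dressF :: "(nat \<Rightarrow> complex \<Rightarrow> bool \<Rightarrow> bool \<Rightarrow> aop) \<Rightarrow> (complex \<Rightarrow> bool \<Rightarrow> bool \<Rightarrow> aop) \<Rightarrow> (nat \<Rightarrow> complex)
    \<Rightarrow> nat \<Rightarrow> nat \<Rightarrow> complex \<Rightarrow> aop" where
  "dressF L K v n 0 u = fuseK K n u"
| "dressF L K v n (Suc m) u = fuseL (L (Suc m)) n (u * v (Suc m)) * dressF L K v n m u
      * fuseL (L (Suc m)) n (u * inverse (v (Suc m)))"

lemma dressF_absorb: "Pr (Suc n) * dressF L K v n m u = dressF L K v n m u"
  by (cases m) (simp_all add: mult.assoc[symmetric])

lemma fuseL_comm:
  assumes "quantum Z" "\<And>u i j. Z * L u i j = L u i j * Z"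
  shows "Z * fuseL L n u = fuseL L n u * Z"
proof (induction n arbitrary: u)
  case (Suc n)
  note c = quantum_comm[OF assms(1), symmetric]
  have c': "Z * (Fop n i * z) = Fop n i * (Z * z)" "Z * (L u i j * z) = L u i j * (Z * z)"
     "Z * (fuseL L n u * z) = fuseL L n u * (Z * z)" for i j u z
    using assms(2) Suc by (simp_all add: c mult.assoc[symmetric])
  show ?case by (simp add: sum_distrib_left sum_distrib_right c' c mult.assoc)
qed (simp add: quantum_comm[OF assms(1)])

lemma quantum_mult: "quantum A \<Longrightarrow> quantum B \<Longrightarrow> quantum (A * B)"
  unfolding quantum_def by (metis mult.assoc)

lemma quantum_sum: "(\<And>i. i \<in> S \<Longrightarrow> quantum (f i)) \<Longrightarrow> quantum (sum f S)"
  unfolding quantum_def by (simp add: sum_distrib_left sum_distrib_right cong: sum.cong)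

lemma fuseK_comm:
  assumes "quantum Z" "\<And>u i j. Z * K u i j = K u i j * Z"
  shows "Z * fuseK K n u = fuseK K n u * Z"
proof (induction n arbitrary: u)
  case (Suc n)
  note c = quantum_comm[OF assms(1), symmetric]
  have c': "Z * (Fop n i * z) = Fop n i * (Z * z)" "Z * (K u i j * z) = K u i j * (Z * z)"
     "Z * (Rop n w i j * z) = Rop n w i j * (Z * z)"
     "Z * (fuseK K n u * z) = fuseK K n u * (Z * z)" for i j u z w
    using assms(2) Suc by (simp_all add: c mult.assoc[symmetric])
  show ?case by (simp add: sum_distrib_left sum_distrib_right c' c mult.assoc)
qed (simp add: quantum_comm[OF assms(1)])

text \<open>The dressed K-matrices fuse: this is the induction on the sites.\<close>

lemma dress_image:
  fixes kp km ep em :: complex and N :: nat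
  assumes q: "\<And>s. s \<in> {1..N} \<Longrightarrow> Uq_quad (e s) (f s) (k s) (k' s)"
    and qu: "\<And>s. s \<in> {1..N} \<Longrightarrow> quantum (e s) \<and> quantum (f s) \<and> quantum (k s) \<and> quantum (k' s)"
    and v: "\<And>s. s \<in> {1..N} \<Longrightarrow> v s \<noteq> 0"
  defines "L \<equiv> \<lambda>s. lax (e s) (f s) (k s) (k' s)"
  assumes comm: "\<And>s s' u u' i j i' j'. s \<in> {1..N} \<Longrightarrow> s' \<in> {1..N} \<Longrightarrow> s \<noteq> s'
      \<Longrightarrow> L s u i j * L s' u' i' j' = L s' u' i' j' * L s u i j"
  defines "K \<equiv> \<lambda>u i j. kmat kp km ep em u i j \<cdot>\<^sub>C 1"
  assumes m: "m \<le> N" and u: "u \<noteq> 0"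
  shows "(\<Sum>l\<in>UNIV. \<Sum>r\<in>UNIV. dressH L K v m (u * h powi (- int n)) i l * Rop n (u\<^sup>2 * h powi (1 - int n)) l r
      * dressF L K v n m (u * h) * Eop n r) = Eop n i * dressF L K v (Suc n) m u"
  using m
proof (induction m arbitrary: i)
  case 0
  show ?case using fuseK_image[OF u, of kp km ep em n i] unfolding K_def by (simp del: fuseK.simps)
next
  case (Suc m)
  let ?M = "Suc m"
  have M: "?M \<in> {1..N}" and mN: "m \<le> N" using Suc.prems by auto
  have quL: "quantum (L s u i j)" if "s \<in> {1..N}" for s u i j
    unfolding L_def using qu[OF that] by (blast intro: quantum_lax)
  have quH: "quantum (dressH L K v m u i j)" if "m \<le> N" for m u i j
    using that
  proof (induction m arbitrary: i j)
    case 0 show ?case by (simp add: K_def quantum_scl_one)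
  next
    case (Suc m) then show ?case by (auto intro!: quantum_sum quantum_mult quL)
  qed
  have LH: "L ?M u' i' j' * dressH L K v m u i j = dressH L K v m u i j * L ?M u' i' j'" for u' i' j' u i j
  proof -
    have "l \<le> m \<Longrightarrow> L ?M u' i' j' * dressH L K v l u i j = dressH L K v l u i j * L ?M u' i' j'" for l i j
    proof (induction l arbitrary: i j)
      case 0 show ?case by (simp add: K_def)
    next
      case (Suc l)
      have 1: "L ?M u' i' j' * L (Suc l) w p r = L (Suc l) w p r * L ?M u' i' j'" for w p r
        using M Suc.prems by (intro comm) auto
      have 2: "L ?M u' i' j' * dressH L K v l u p r = dressH L K v l u p r * L ?M u' i' j'" for p r
        using Suc by simp
      have 3: "L ?M u' i' j' * (L (Suc l) w p r * z) = L (Suc l) w p r * (L ?M u' i' j' * z)"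
        "L ?M u' i' j' * (dressH L K v l u p r * z) = dressH L K v l u p r * (L ?M u' i' j' * z)" for w p r z
        by (simp_all add: 1 2 mult.assoc[symmetric])
      show ?case by (simp add: sum_distrib_left sum_distrib_right 1 2 3 mult.assoc)
    qed
    then show ?thesis by simp
  qed
  have LF: "L ?M u' i' j' * dressF L K v n m u = dressF L K v n m u * L ?M u' i' j'" for u' i' j' n u
  proof -
    have "l \<le> m \<Longrightarrow> L ?M u' i' j' * dressF L K v n l u = dressF L K v n l u * L ?M u' i' j'" for l
    proof (induction l)
      case 0 show ?case by (simp, rule fuseK_comm[OF quL[OF M]]) (simp add: K_def)
    next
      case (Suc l)
      have 1: "L ?M u' i' j' * fuseL (L (Suc l)) n w = fuseL (L (Suc l)) n w * L ?M u' i' j'" for w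
        using M Suc.prems by (intro fuseL_comm quL comm) auto
      have 2: "L ?M u' i' j' * dressF L K v n l u = dressF L K v n l u * L ?M u' i' j'"
        using Suc by simp
      have 3: "L ?M u' i' j' * (fuseL (L (Suc l)) n w * z) = fuseL (L (Suc l)) n w * (L ?M u' i' j' * z)"
        "L ?M u' i' j' * (dressF L K v n l u * z) = dressF L K v n l u * (L ?M u' i' j' * z)" for w z
        by (simp_all add: 1 2 mult.assoc[symmetric])
      show ?case by (simp add: 1 2 3 mult.assoc)
    qed
    then show ?thesis by simp
  qed
  define x y w where "x = u * inverse (v ?M)" and "y = u * v ?M" and "w = u\<^sup>2 * h powi (1 - int n)"
  have nz: "x \<noteq> 0" "y \<noteq> 0" "w \<noteq> 0" "x * h powi (- int n) \<noteq> 0" "y * h \<noteq> 0"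
    using u v[OF M] by (simp_all add: x_def y_def w_def)
  have h1: "h powi (1 - int n) = h * h powi (- int n)" using h_powi_add[of 1 "- int n"] by simp
  have w: "x * h powi (- int n) * (y * h) = w" 
    using v[OF M] unfolding x_def y_def w_def h1 by (simp add: power2_eq_square field_simps)
  define H G R where "H = dressH L K v m (u * h powi (- int n))" and "G = dressF L K v n m (u * h)" and "R = Rop n w"
  define Ly Lx T T' where "Ly = L ?M (y * h powi (- int n))" and "Lx = L ?M (x * h powi (- int n))"
    and "T = fuseL (L ?M) n (y * h)" and "T' = fuseL (L ?M) n (x * h)"
  have sh: "u * h powi (- int n) * v ?M = y * h powi (- int n)" "u * h powi (- int n) * inverse (v ?M) = x * h powi (- int n)"
    "u * h * v ?M = y * h" "u * h * inverse (v ?M) = x * h" by (simp_all add: x_def y_def)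
  have RLL: "(\<Sum>l\<in>UNIV. Lx p l * R l r * T) = (\<Sum>l\<in>UNIV. T * R p l * Lx l r)" for p r
    using RLL_fused[OF q[OF M] _ _ _ _ nz(4,5), of p n r] qu[OF M] unfolding w Lx_def R_def T_def L_def by blast
  have fx: "(\<Sum>j\<in>UNIV. Lx i j * T' * Eop n j) = Eop n i * fuseL (L ?M) (Suc n) x" for i
    using fuseL_image[OF q[OF M] _ _ _ _ nz(1), of n i] qu[OF M] unfolding Lx_def T'_def L_def by blast
  have fy: "(\<Sum>j\<in>UNIV. Ly i j * T * Eop n j) = Eop n i * fuseL (L ?M) (Suc n) y" for i
    using fuseL_image[OF q[OF M] _ _ _ _ nz(2), of n i] qu[OF M] unfolding Ly_def T_def L_def by blast
  have IH: "(\<Sum>l\<in>UNIV. \<Sum>r\<in>UNIV. H i l * R l r * G * Eop n r) = Eop n i * dressF L K v (Suc n) m u" for i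
    using Suc.IH[OF mN] unfolding H_def R_def G_def w_def .
  have HT: "H p r * T = T * H p r" "H p r * (T * z) = T * (H p r * z)" for p r z
  proof -
    show "H p r * T = T * H p r" unfolding H_def T_def by (rule fuseL_comm[OF quH[OF mN]]) (simp add: LH)
    then show "H p r * (T * z) = T * (H p r * z)" by (simp add: mult.assoc[symmetric])
  qed
  have GL: "Lx p r * (G * z) = G * (Lx p r * z)" for p r z
    using LF unfolding Lx_def G_def by (simp add: mult.assoc[symmetric])
  \<comment> \<open>Exchange of the inner Lax operators of site \<open>m + 1\<close>, fusion of the right ones, induction hypothesis,
    fusion of the left ones (by \<open>fy\<close>, below).\<close>
  have "(\<Sum>l\<in>UNIV. \<Sum>r\<in>UNIV. (\<Sum>k\<in>UNIV. \<Sum>p\<in>UNIV. Ly i k * H k p * Lx p l) * R l r * (T * G * T') * Eop n r)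
      = (\<Sum>k\<in>UNIV. \<Sum>p\<in>UNIV. \<Sum>r\<in>UNIV. Ly i k * H k p * (\<Sum>l\<in>UNIV. Lx p l * R l r * T) * (G * T' * Eop n r))"
    by (simp add: sum_bool distrib_left distrib_right mult.assoc add_ac)
  also have "\<dots> = (\<Sum>k\<in>UNIV. \<Sum>p\<in>UNIV. \<Sum>l\<in>UNIV. Ly i k * T * H k p * R p l * G * (\<Sum>r\<in>UNIV. Lx l r * T' * Eop n r))"
    unfolding RLL by (simp add: sum_bool distrib_left distrib_right mult.assoc add_ac HT GL)
  also have "\<dots> = (\<Sum>k\<in>UNIV. Ly i k * T * (\<Sum>p\<in>UNIV. \<Sum>l\<in>UNIV. H k p * R p l * G * Eop n l)) * fuseL (L ?M) (Suc n) x"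
    unfolding fx by (simp add: sum_bool distrib_left distrib_right mult.assoc add_ac del: fuseL.simps)
  also have "\<dots> = (\<Sum>k\<in>UNIV. Ly i k * T * Eop n k) * (dressF L K v (Suc n) m u * fuseL (L ?M) (Suc n) x)"
    unfolding IH by (simp add: sum_distrib_right mult.assoc del: fuseL.simps)
  finally show ?case
    unfolding fy by (simp only: dressH.simps dressF.simps sh H_def[symmetric] G_def[symmetric] Ly_def[symmetric] Lx_def[symmetric]
      T_def[symmetric] T'_def[symmetric] R_def[symmetric] w_def[symmetric] x_def[symmetric] y_def[symmetric]) (simp only: mult.assoc)
qed

text \<open>Fusing the dressed spin-1/2 K-matrix gives the dressed fused K-operator: the theorem, inside the ring of
operators.\<close>

lemma fuseK_dress:
  fixes kp km ep em :: complex and N :: nat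
  assumes q: "\<And>s. s \<in> {1..N} \<Longrightarrow> Uq_quad (e s) (f s) (k s) (k' s)"
    and qu: "\<And>s. s \<in> {1..N} \<Longrightarrow> quantum (e s) \<and> quantum (f s) \<and> quantum (k s) \<and> quantum (k' s)"
    and v: "\<And>s. s \<in> {1..N} \<Longrightarrow> v s \<noteq> 0"
  defines "L \<equiv> \<lambda>s. lax (e s) (f s) (k s) (k' s)"
  assumes comm: "\<And>s s' u u' i j i' j'. s \<in> {1..N} \<Longrightarrow> s' \<in> {1..N} \<Longrightarrow> s \<noteq> s'
      \<Longrightarrow> L s u i j * L s' u' i' j' = L s' u' i' j' * L s u i j"
  defines "K \<equiv> \<lambda>u i j. kmat kp km ep em u i j \<cdot>\<^sub>C 1"
  assumes KN: "\<And>u i j. u \<noteq> 0 \<Longrightarrow> KN u i j = dressH L K v N u i j" and u: "u \<noteq> 0"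
  shows "fuseK KN n u = dressF L K v n N u"
  using u
proof (induction n arbitrary: u)
  case 0
  have "dressF L K v 0 m u = Pr (Suc 0)" for m by (induction m) simp_all
  then show ?case by simp
next
  case (Suc n u)
  have nz: "u * h \<noteq> 0" "u * h powi (- int n) \<noteq> 0" using Suc.prems by simp_all
  have *: "(\<Sum>l\<in>UNIV. \<Sum>r\<in>UNIV. dressH L K v N (u * h powi (- int n)) i l * Rop n (u\<^sup>2 * h powi (1 - int n)) l r
      * dressF L K v n N (u * h) * Eop n r) = Eop n i * dressF L K v (Suc n) N u" for i
    using dress_image[of N e f k k' v N u kp km ep em n i] q qu v comm Suc.prems unfolding L_def K_def by blast
  have "fuseK KN (Suc n) u = (\<Sum>i\<in>UNIV. Fop n i * (\<Sum>l\<in>UNIV. \<Sum>r\<in>UNIV. dressH L K v N (u * h powi (- int n)) i l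
      * Rop n (u\<^sup>2 * h powi (1 - int n)) l r * dressF L K v n N (u * h) * Eop n r))"
    by (simp add: Suc.IH[OF nz(1)] KN[OF nz(2)] sum_distrib_left mult.assoc)
  also have "\<dots> = (\<Sum>i\<in>UNIV. Fop n i * Eop n i) * dressF L K v (Suc n) N u"
    unfolding * by (simp only: sum_distrib_right mult.assoc)
  also have "\<dots> = dressF L K v (Suc n) N u"
    using F_E[of n] dressF_absorb[of "Suc n"] by (simp add: sum_bool)
  finally show ?case .
qed

end

section \<open>Complex algebras as records\<close>

text \<open>Unital associative complex algebras, as far as needed: rings in which scalars act through multiples of
the unit.\<close>

definition calg :: "(complex, 'a) module \<Rightarrow> bool" where
  "calg A \<longleftrightarrow> ring A \<and> (\<forall>c. \<forall>x\<in>carrier A. c \<odot>\<^bsub>A\<^esub> x \<in> carrier A)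
     \<and> (\<forall>c. \<forall>x\<in>carrier A. c \<odot>\<^bsub>A\<^esub> x = (c \<odot>\<^bsub>A\<^esub> \<one>\<^bsub>A\<^esub>) \<otimes>\<^bsub>A\<^esub> x)"

lemma calgD:
  assumes "calg A"
  shows "ring A" "x \<in> carrier A \<Longrightarrow> c \<odot>\<^bsub>A\<^esub> x \<in> carrier A" "x \<in> carrier A \<Longrightarrow> c \<odot>\<^bsub>A\<^esub> x = (c \<odot>\<^bsub>A\<^esub> \<one>\<^bsub>A\<^esub>) \<otimes>\<^bsub>A\<^esub> x"
  using assms by (auto simp: calg_def)

lemma alg_homD:
  assumes "f \<in> alg_hom A B"
  shows "x \<in> carrier A \<Longrightarrow> f x \<in> carrier B" "f \<one>\<^bsub>A\<^esub> = \<one>\<^bsub>B\<^esub>"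
    "x \<in> carrier A \<Longrightarrow> y \<in> carrier A \<Longrightarrow> f (x \<otimes>\<^bsub>A\<^esub> y) = f x \<otimes>\<^bsub>B\<^esub> f y"
    "x \<in> carrier A \<Longrightarrow> y \<in> carrier A \<Longrightarrow> f (x \<oplus>\<^bsub>A\<^esub> y) = f x \<oplus>\<^bsub>B\<^esub> f y"
    "x \<in> carrier A \<Longrightarrow> f (c \<odot>\<^bsub>A\<^esub> x) = c \<odot>\<^bsub>B\<^esub> f x"
  using assms by (auto simp: alg_hom_def dest: ring_hom_closed ring_hom_one ring_hom_mult ring_hom_add)

lemma alg_homI:
  assumes "\<And>x. x \<in> carrier A \<Longrightarrow> f x \<in> carrier B" "f \<one>\<^bsub>A\<^esub> = \<one>\<^bsub>B\<^esub>"
    "\<And>x y. x \<in> carrier A \<Longrightarrow> y \<in> carrier A \<Longrightarrow> f (x \<otimes>\<^bsub>A\<^esub> y) = f x \<otimes>\<^bsub>B\<^esub> f y"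
    "\<And>x y. x \<in> carrier A \<Longrightarrow> y \<in> carrier A \<Longrightarrow> f (x \<oplus>\<^bsub>A\<^esub> y) = f x \<oplus>\<^bsub>B\<^esub> f y"
    "\<And>c x. x \<in> carrier A \<Longrightarrow> f (c \<odot>\<^bsub>A\<^esub> x) = c \<odot>\<^bsub>B\<^esub> f x"
  shows "f \<in> alg_hom A B"
  unfolding alg_hom_def using assms by (auto intro: ring_hom_memI)

lemma alg_hom_comp:
  assumes "f \<in> alg_hom A B" "g \<in> alg_hom B C"
  shows "(\<lambda>x. g (f x)) \<in> alg_hom A C"
  using assms by (intro alg_homI) (auto simp: alg_homD)

lemma alg_hom_zero:
  assumes "f \<in> alg_hom A B" "ring A" "ring B"
  shows "f \<zero>\<^bsub>A\<^esub> = \<zero>\<^bsub>B\<^esub>"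
  using assms ring_hom_zero[of f A B] by (simp add: alg_hom_def)

lemma alg_hom_a_minus:
  assumes "f \<in> alg_hom A B" "ring A" "ring B" "x \<in> carrier A" "y \<in> carrier A"
  shows "f (x \<ominus>\<^bsub>A\<^esub> y) = f x \<ominus>\<^bsub>B\<^esub> f y"
proof -
  interpret ring_hom_ring A B f
    using assms by (intro ring_hom_ringI2) (auto simp: alg_hom_def)
  show ?thesis using assms by (simp add: a_minus_def)
qed

lemma alg_hom_finsum:
  assumes "f \<in> alg_hom A B" "ring A" "ring B" "finite S" "\<And>i. i \<in> S \<Longrightarrow> g i \<in> carrier A"
  shows "f (\<Oplus>\<^bsub>A\<^esub>i\<in>S. g i) = (\<Oplus>\<^bsub>B\<^esub>i\<in>S. f (g i))"
proof -
  interpret A: ring A by fact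
  interpret B: ring B by fact
  show ?thesis using assms(4,5)
  proof (induction S rule: finite_induct)
    case empty then show ?case using alg_hom_zero[OF assms(1-3)] by simp
  next
    case (insert i S)
    then show ?case
      using assms(1) by (simp add: alg_homD Pi_def A.finsum_closed)
  qed
qed

subsection \<open>Quotients\<close>

lemma quot_alg_simps:
  "carrier (quot_alg A S) = carrier (A Quot (genideal A S))"
  "monoid.mult (quot_alg A S) = monoid.mult (A Quot (genideal A S))"
  "one (quot_alg A S) = one (A Quot (genideal A S))"
  "zero (quot_alg A S) = zero (A Quot (genideal A S))"
  "add (quot_alg A S) = add (A Quot (genideal A S))"
  "smult (quot_alg A S) = (\<lambda>c X. rcoset_mult A (genideal A S) (genideal A S +>\<^bsub>A\<^esub> (c \<odot>\<^bsub>A\<^esub> \<one>\<^bsub>A\<^esub>)) X)"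
  by (simp_all add: quot_alg_def Let_def ring.defs module.defs)

lemma ring_cong:
  assumes "ring R" "carrier S = carrier R" "monoid.mult S = monoid.mult R" "one S = one R" "zero S = zero R" "add S = add R"
  shows "ring S"
proof -
  interpret ring R by fact
  show ?thesis
  proof (rule ringI)
    show "abelian_group S"
      by (rule abelian_groupI) (auto simp: assms a_ac l_zero intro: exI dest: a_inv_closed l_neg)
    show "Group.monoid S" by (rule Group.monoidI) (auto simp: assms m_assoc)
  qed (auto simp: assms l_distr r_distr)
qed

context
  fixes A :: "(complex, 'a) module" and S :: "'a set"
  assumes A: "calg A" and S: "S \<subseteq> carrier A"
begin

interpretation A: ring A using A by (rule calgD)
interpretation I: ideal "genideal A S" A using S by (rule A.genideal_ideal)

lemma quot_alg_carrier: "X \<in> carrier (quot_alg A S) \<longleftrightarrow> (\<exists>x\<in>carrier A. X = quot_proj A S x)"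
  by (auto simp: quot_alg_simps(1) FactRing_def A_RCOSETS_def' quot_proj_def)

lemma quot_proj_ops:
  assumes "x \<in> carrier A" "y \<in> carrier A"
  shows "quot_proj A S x \<otimes>\<^bsub>quot_alg A S\<^esub> quot_proj A S y = quot_proj A S (x \<otimes>\<^bsub>A\<^esub> y)"
    "quot_proj A S x \<oplus>\<^bsub>quot_alg A S\<^esub> quot_proj A S y = quot_proj A S (x \<oplus>\<^bsub>A\<^esub> y)"
    "c \<odot>\<^bsub>quot_alg A S\<^esub> quot_proj A S x = quot_proj A S (c \<odot>\<^bsub>A\<^esub> x)"
proof -
  have c1: "c \<odot>\<^bsub>A\<^esub> \<one>\<^bsub>A\<^esub> \<in> carrier A" using calgD(2)[OF A] by simp
  show "quot_proj A S x \<otimes>\<^bsub>quot_alg A S\<^esub> quot_proj A S y = quot_proj A S (x \<otimes>\<^bsub>A\<^esub> y)"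
    "quot_proj A S x \<oplus>\<^bsub>quot_alg A S\<^esub> quot_proj A S y = quot_proj A S (x \<oplus>\<^bsub>A\<^esub> y)"
    using assms by (simp_all add: quot_alg_simps quot_proj_def FactRing_def I.rcoset_mult_add I.a_rcos_sum)
  show "c \<odot>\<^bsub>quot_alg A S\<^esub> quot_proj A S x = quot_proj A S (c \<odot>\<^bsub>A\<^esub> x)"
    unfolding calgD(3)[OF A assms(1), of c]
    using assms(1) c1 by (simp add: quot_alg_simps quot_proj_def I.rcoset_mult_add)
qed

lemma quot_alg_one: "\<one>\<^bsub>quot_alg A S\<^esub> = quot_proj A S \<one>\<^bsub>A\<^esub>"
  by (simp add: quot_alg_simps quot_proj_def FactRing_def)

lemma quot_alg_calg: "calg (quot_alg A S)"
proof -
  have r: "ring (quot_alg A S)"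
    by (rule ring_cong[OF I.quotient_is_ring]) (simp_all add: quot_alg_simps)
  note one = quot_alg_one
  have sm: "c \<odot>\<^bsub>A\<^esub> x \<in> carrier A" "c \<odot>\<^bsub>A\<^esub> x = (c \<odot>\<^bsub>A\<^esub> \<one>\<^bsub>A\<^esub>) \<otimes>\<^bsub>A\<^esub> x" if "x \<in> carrier A" for c x
    using calgD(2,3)[OF A that] .
  show ?thesis
    unfolding calg_def
  proof (intro conjI allI ballI r)
    fix c X assume "X \<in> carrier (quot_alg A S)"
    then obtain x where x: "x \<in> carrier A" "X = quot_proj A S x" by (auto simp: quot_alg_carrier)
    show "c \<odot>\<^bsub>quot_alg A S\<^esub> X \<in> carrier (quot_alg A S)"
      unfolding x(2) quot_proj_ops(3)[OF x(1) x(1)] quot_alg_carrier using sm x by blast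
    show "c \<odot>\<^bsub>quot_alg A S\<^esub> X = c \<odot>\<^bsub>quot_alg A S\<^esub> \<one>\<^bsub>quot_alg A S\<^esub> \<otimes>\<^bsub>quot_alg A S\<^esub> X"
      unfolding x(2) one quot_proj_ops(3)[OF x(1) x(1)] quot_proj_ops(3)[OF A.one_closed A.one_closed]
      using sm(2)[OF x(1), of c] sm(1)[OF A.one_closed, of c] x(1) by (simp add: quot_proj_ops(1))
  qed
qed

lemma hom_on_coset:
  assumes f: "f \<in> alg_hom A B" and B: "ring B" and k: "\<And>s. s \<in> S \<Longrightarrow> f s = \<zero>\<^bsub>B\<^esub>" and x: "x \<in> carrier A"
  shows "f ` quot_proj A S x = {f x}"
proof -
  have hom: "ring_hom_ring A B f"
    using f by (intro ring_hom_ringI2 A.ring_axioms B) (simp add: alg_hom_def)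
  have K: "a_kernel A B f = {x \<in> carrier A. f x = \<zero>\<^bsub>B\<^esub>}" by (rule a_kernel_def')
  have "S \<subseteq> a_kernel A B f" using S k unfolding K by blast
  then have ker: "genideal A S \<subseteq> a_kernel A B f"
    by (rule A.genideal_minimal[OF ring_hom_ring.kernel_is_ideal[OF hom]])
  have "f (i \<oplus>\<^bsub>A\<^esub> x) = f x" if "i \<in> genideal A S" for i
  proof -
    have i: "i \<in> carrier A" "f i = \<zero>\<^bsub>B\<^esub>" using ker that unfolding K by blast+
    have "f (i \<oplus>\<^bsub>A\<^esub> x) = \<zero>\<^bsub>B\<^esub> \<oplus>\<^bsub>B\<^esub> f x" using alg_homD(4)[OF f i(1) x] i(2) by (rule trans[OF _ arg_cong])
    also have "\<dots> = f x" using B alg_homD(1)[OF f x] by (rule ring.ring_simprules(8))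
    finally show ?thesis .
  qed
  then have img: "f y = f x" if "y \<in> quot_proj A S x" for y
    using that unfolding quot_proj_def a_r_coset_def' by blast
  have "x \<in> quot_proj A S x" unfolding quot_proj_def using x by (rule I.a_rcos_self)
  then have "(\<lambda>_. f x) ` quot_proj A S x = {f x}" by (rule image_constant)
  moreover have "f ` quot_proj A S x = (\<lambda>_. f x) ` quot_proj A S x"
    by (rule image_cong) (simp_all only: img)
  ultimately show ?thesis by (simp only:)
qed

lemma hom_factor:
  assumes f: "f \<in> alg_hom A B" and B: "ring B" and k: "\<And>s. s \<in> S \<Longrightarrow> f s = \<zero>\<^bsub>B\<^esub>"
  shows "(\<lambda>X. the_elem (f ` X)) \<in> alg_hom (quot_alg A S) B"
    "x \<in> carrier A \<Longrightarrow> the_elem (f ` quot_proj A S x) = f x"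
proof -
  have e: "the_elem (f ` quot_proj A S x) = f x" if "x \<in> carrier A" for x
    using hom_on_coset[OF f B k that] by simp
  then show "x \<in> carrier A \<Longrightarrow> the_elem (f ` quot_proj A S x) = f x" .
  have cl: "\<one>\<^bsub>A\<^esub> \<in> carrier A" "x \<in> carrier A \<Longrightarrow> y \<in> carrier A \<Longrightarrow> x \<otimes>\<^bsub>A\<^esub> y \<in> carrier A"
    "x \<in> carrier A \<Longrightarrow> y \<in> carrier A \<Longrightarrow> x \<oplus>\<^bsub>A\<^esub> y \<in> carrier A" "x \<in> carrier A \<Longrightarrow> c \<odot>\<^bsub>A\<^esub> x \<in> carrier A" for x y c
    using calgD(2)[OF A] by auto
  note one = quot_alg_one
  show "(\<lambda>X. the_elem (f ` X)) \<in> alg_hom (quot_alg A S) B"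
    by (rule alg_homI) (auto simp: quot_alg_carrier quot_proj_ops e cl one alg_homD[OF f])
qed

end

subsection \<open>The ambient operator ring and matrix algebras\<close>

text \<open>The ring of operators as a record.\<close>

definition op_alg :: "(complex, aop) module" where
  "op_alg = \<lparr>carrier = UNIV, monoid.mult = (*), one = 1, zero = 0, add = (+), smult = scl\<rparr>"

lemma op_alg_simps [simp]:
  "carrier op_alg = UNIV" "monoid.mult op_alg = (*)" "one op_alg = 1" "zero op_alg = 0" "add op_alg = (+)" "smult op_alg = scl"
  by (simp_all add: op_alg_def)

lemma class_ring:
  fixes A :: "(complex, 'a::ring_1) module"
  assumes "carrier A = UNIV" "monoid.mult A = (*)" "one A = 1" "zero A = 0" "add A = (+)"
  shows "ring A"
proof (rule ringI)
  show "abelian_group A"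
    by (rule abelian_groupI) (auto simp: assms algebra_simps intro: exI[of _ "- _"])
  show "Group.monoid A" by (rule Group.monoidI) (auto simp: assms mult.assoc)
qed (auto simp: assms algebra_simps)

lemma calg_op: "calg op_alg"
  unfolding calg_def by (intro conjI class_ring) simp_all

lemma finsum_op: "finite S \<Longrightarrow> (\<Oplus>\<^bsub>op_alg\<^esub>i\<in>S. g i) = (\<Sum>i\<in>S. g i)"
proof (induction S rule: finite_induct)
  interpret ring op_alg using calg_op by (rule calgD)
  { case empty show ?case by simp }
  { case (insert i S) then show ?case by (simp add: finsum_insert Pi_def) }
qed

lemma a_minus_op: "x \<ominus>\<^bsub>op_alg\<^esub> y = x - y"
proof -
  interpret ring op_alg using calg_op by (rule calgD)
  have "x \<ominus>\<^bsub>op_alg\<^esub> y \<oplus>\<^bsub>op_alg\<^esub> y = x" by (simp add: a_minus_def a_assoc l_neg del: op_alg_simps(2-))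
  then show ?thesis by (simp add: algebra_simps)
qed

lemma calg_complex: "calg complex_alg"
  unfolding calg_def by (intro conjI class_ring) (simp_all add: complex_alg_def)

lemma calg_End: "calg (End_alg n)"
proof -
  interpret ring "ring_mat TYPE(complex) n ()" by (rule ring_mat)
  have "ring (End_alg n)"
    by (rule ring_cong[OF ring_axioms]) (simp_all add: End_alg_def ring_mat_simps module_mat_simps)
  then show ?thesis
    by (auto simp: calg_def End_alg_def module_mat_simps)
qed

lemma End_simps [simp]:
  "carrier (End_alg n) = carrier_mat n n" "monoid.mult (End_alg n) = (*)" "one (End_alg n) = 1\<^sub>m n"
  "zero (End_alg n) = 0\<^sub>m n n" "add (End_alg n) = (+)" "smult (End_alg n) = (\<cdot>\<^sub>m)"
  by (simp_all add: End_alg_def module_mat_simps)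

lemma qm_hom: "d > 0 \<Longrightarrow> qm d \<in> alg_hom (End_alg d) op_alg"
  by (rule alg_homI) (simp_all add: qm_one qm_mult qm_add qm_scl)

lemma scl_hom: "cst \<in> alg_hom complex_alg op_alg"
  by (rule alg_homI) (simp_all add: complex_alg_def scl_distrib mult.commute)

subsection \<open>The free algebra\<close>

lemma calg_free: "calg (free_alg :: (complex, 'g free) module)"
  unfolding calg_def
proof (intro conjI class_ring)
  show "\<forall>c. \<forall>x\<in>carrier free_alg. c \<odot>\<^bsub>free_alg\<^esub> x = (c \<odot>\<^bsub>free_alg\<^esub> \<one>\<^bsub>free_alg\<^esub>) \<otimes>\<^bsub>free_alg\<^esub> (x :: 'g free)"
    by (simp add: free_alg_def mult.assoc[symmetric])
qed (simp_all add: free_alg_def)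

text \<open>The evaluation of free algebra elements at operators, with sums and products of the ring of operators.\<close>

definition opev :: "('g \<Rightarrow> aop) \<Rightarrow> 'g free \<Rightarrow> aop" where
  "opev g p = (\<Sum>w\<in>Poly_Mapping.keys p. Poly_Mapping.lookup p w \<cdot>\<^sub>C prod_list (map g w))"

lemma opev_superset:
  "finite W \<Longrightarrow> Poly_Mapping.keys p \<subseteq> W \<Longrightarrow> opev g p = (\<Sum>w\<in>W. Poly_Mapping.lookup p w \<cdot>\<^sub>C prod_list (map g w))"
  unfolding opev_def by (rule sum.mono_neutral_left) (auto simp: in_keys_iff)

lemma opev_add: "opev g (p + r) = opev g p + opev g r"
proof -
  let ?W = "Poly_Mapping.keys p \<union> Poly_Mapping.keys r"
  have "Poly_Mapping.keys (p + r) \<subseteq> ?W" by (rule Poly_Mapping.keys_add)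
  then show ?thesis
    using opev_superset[of ?W p g] opev_superset[of ?W r g] opev_superset[of ?W "p + r" g]
    by (simp add: lookup_add scl_distrib sum.distrib)
qed

lemma opev_zero: "opev g 0 = 0" by (simp add: opev_def)

lemma opev_single: "opev g (Poly_Mapping.single w c) = c \<cdot>\<^sub>C prod_list (map g w)"
  by (simp add: opev_def lookup_single)

lemma opev_sum: "opev g (sum f S) = (\<Sum>i\<in>S. opev g (f i))"
  by (induction S rule: infinite_finite_induct) (simp_all add: opev_add opev_zero)

lemma free_expand: "p = (\<Sum>w\<in>Poly_Mapping.keys p. Poly_Mapping.single w (Poly_Mapping.lookup p w))"
  by (rule poly_mapping_eqI) (simp add: lookup_sum lookup_single when_def in_keys_iff)

lemma opev_mult: "opev g (p * r) = opev g p * opev g r"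
proof -
  have 1: "opev g (Poly_Mapping.single w c * Poly_Mapping.single w' c')
      = opev g (Poly_Mapping.single w c) * opev g (Poly_Mapping.single w' c')" for w w' c c'
    by (simp add: mult_single opev_single plus_list_def mult.commute)
  let ?s = "\<lambda>p. \<Sum>w\<in>Poly_Mapping.keys p. Poly_Mapping.single w (Poly_Mapping.lookup p w)"
  have "opev g (?s p * ?s r) = opev g (?s p) * opev g (?s r)"
    by (simp only: sum_distrib_left sum_distrib_right opev_sum 1)
  then show ?thesis by (simp only: free_expand[symmetric])
qed

lemma opev_hom: "opev g \<in> alg_hom free_alg op_alg"
proof (rule alg_homI)
  show "opev g \<one>\<^bsub>free_alg\<^esub> = \<one>\<^bsub>op_alg\<^esub>"
  proof -
    have e: "(1 :: 'a free) = Poly_Mapping.single [] 1" by (metis single_one zero_list_def)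
    have "opev g 1 = 1" unfolding e opev_single by simp
    then show ?thesis by (simp add: free_alg_def)
  qed
  fix c and x :: "'a free"
  show "opev g (c \<odot>\<^bsub>free_alg\<^esub> x) = c \<odot>\<^bsub>op_alg\<^esub> opev g x"
    by (simp add: free_alg_def const_def opev_mult opev_single)
qed (simp_all add: opev_add opev_mult free_alg_def)

lemma free_eval_End:
  assumes f: "\<And>g. f g \<in> carrier_mat d d" and d: "d > 0"
  shows "free_eval (End_alg d) f p \<in> carrier_mat d d"
    and "qm d (free_eval (End_alg d) f p) = opev (\<lambda>g. qm d (f g)) p"
proof -
  interpret ring "End_alg d" using calg_End by (rule calgD)
  have w: "foldr (\<lambda>g x. f g \<otimes>\<^bsub>End_alg d\<^esub> x) w \<one>\<^bsub>End_alg d\<^esub> \<in> carrier_mat d d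
     \<and> qm d (foldr (\<lambda>g x. f g \<otimes>\<^bsub>End_alg d\<^esub> x) w \<one>\<^bsub>End_alg d\<^esub>) = prod_list (map (\<lambda>g. qm d (f g)) w)" for w
    by (induction w) (auto simp: f qm_one d qm_mult intro!: mult_carrier_mat[of _ d d])
  then have c: "Poly_Mapping.lookup p w \<odot>\<^bsub>End_alg d\<^esub> foldr (\<lambda>g x. f g \<otimes>\<^bsub>End_alg d\<^esub> x) w \<one>\<^bsub>End_alg d\<^esub> \<in> carrier (End_alg d)" for w
    by simp
  show "free_eval (End_alg d) f p \<in> carrier_mat d d"
    unfolding free_eval_def End_simps(1)[symmetric] by (rule finsum_closed) (use c in auto)
  show "qm d (free_eval (End_alg d) f p) = opev (\<lambda>g. qm d (f g)) p"
    unfolding free_eval_def opev_def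
    using alg_hom_finsum[OF qm_hom[OF d] calgD(1)[OF calg_End] calgD(1)[OF calg_op] finite_keys, of p] c w
    by (simp add: finsum_op qm_scl d)
qed

text \<open>Evaluation of the free algebra in matrices is a homomorphism. It is compared with evaluation in operators
through the embedding \<open>qm d\<close>.\<close>

lemma free_eval_hom:
  assumes f: "\<And>g. f g \<in> carrier_mat d d" and d: "d > 0"
  shows "free_eval (End_alg d) f \<in> alg_hom free_alg (End_alg d)"
proof -
  note e = free_eval_End[OF f d]
  note o = alg_homD[OF opev_hom]
  have inj: "X = Y" if "X \<in> carrier_mat d d" "Y \<in> carrier_mat d d" "qm d X = qm d Y" for X Y
    using that by (rule qm_inj)
  show ?thesis
  proof (rule alg_homI)
    show "free_eval (End_alg d) f \<one>\<^bsub>free_alg\<^esub> = \<one>\<^bsub>End_alg d\<^esub>"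
      by (rule inj) (simp_all add: e qm_one d o)
  qed (auto intro!: inj mult_carrier_mat[of _ d d] simp: e qm_mult qm_add qm_scl d o)
qed

section \<open>Blocks of matrices as operators\<close>

text \<open>The \<open>r \<times> c\<close> block of a matrix whose first entry has index \<open>(i0, j0)\<close>, as an operator; the entries are mapped
to quantum operators by \<open>\<phi>\<close>.\<close>

definition bl :: "('a \<Rightarrow> aop) \<Rightarrow> nat \<Rightarrow> nat \<Rightarrow> nat \<Rightarrow> nat \<Rightarrow> 'a mat \<Rightarrow> aop" where
  "bl \<phi> r c i0 j0 X = (\<Sum>i<r. \<Sum>j<c. \<phi> (X $$ (i0 + i, j0 + j)) * un i j)"

text \<open>All entries lie in the carrier of the algebra.\<close>

definition mat_in :: "(complex, 'a) module \<Rightarrow> 'a mat \<Rightarrow> bool" where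
  "mat_in A X \<longleftrightarrow> (\<forall>i<dim_row X. \<forall>j<dim_col X. X $$ (i, j) \<in> carrier A)"

text \<open>The index at which the block with boolean index \<open>p\<close> begins, if the blocks have size \<open>s\<close>.\<close>

definition off :: "nat \<Rightarrow> bool \<Rightarrow> nat" where "off s p = (if p then s else 0)"

lemma off_div_mod: "i < s \<Longrightarrow> (off s p + i) div s = of_bool p" "i < s \<Longrightarrow> (off s p + i) mod s = i"
  by (auto simp: off_def)

lemma app_bl_scl:
  "app (bl cst r c i0 j0 M) x (a, s) = (if a < r then \<Sum>j<c. M $$ (i0 + a, j0 + j) * x (j, s) else 0)"
proof -
  have "app (bl cst r c i0 j0 M) x (a, s)
      = (\<Sum>i<r. if a = i then \<Sum>j<c. M $$ (i0 + i, j0 + j) * x (j, s) else 0)"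
    unfolding bl_def app_sum_op by (intro sum.cong refl) auto
  then show ?thesis by simp
qed

lemma un_sum_mult:
  assumes "\<And>l j. l < s \<Longrightarrow> j < c \<Longrightarrow> quantum (b l j)"
  shows "(\<Sum>i<r. \<Sum>l<s. a i l * un i l) * (\<Sum>l<s. \<Sum>j<c. b l j * un l j)
    = (\<Sum>i<r. \<Sum>j<c. (\<Sum>l<s. a i l * b l j) * un i j)"
proof -
  have t: "a i l * un i l * (b l' j * un l' j) = (if l = l' then a i l * b l' j * un i j else 0)"
    if "l' < s" "j < c" for i l l' j
  proof -
    have "un i l * b l' j = b l' j * un i l" using assms[OF that] by (simp add: quantum_def)
    then have "a i l * un i l * (b l' j * un l' j) = a i l * b l' j * (un i l * un l' j)"
      by (simp add: mult.assoc[symmetric]) (simp add: mult.assoc)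
    then show ?thesis by (simp add: un_mult)
  qed
  have "(\<Sum>i<r. \<Sum>l<s. a i l * un i l) * (\<Sum>l<s. \<Sum>j<c. b l j * un l j)
      = (\<Sum>i<r. \<Sum>l<s. \<Sum>l'<s. \<Sum>j<c. a i l * un i l * (b l' j * un l' j))"
    by (simp only: sum_distrib_right) (simp only: sum_distrib_left)
  also have "\<dots> = (\<Sum>i<r. \<Sum>l<s. \<Sum>l'<s. \<Sum>j<c. if l = l' then a i l * b l' j * un i j else 0)"
    by (intro sum.cong refl) (simp add: t)
  also have "\<dots> = (\<Sum>i<r. \<Sum>l<s. \<Sum>j<c. \<Sum>l'<s. if l = l' then a i l * b l' j * un i j else 0)"
    by (intro sum.cong refl sum.swap)
  also have "\<dots> = (\<Sum>i<r. \<Sum>l<s. \<Sum>j<c. a i l * b l j * un i j)"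
    by (intro sum.cong refl) simp
  also have "\<dots> = (\<Sum>i<r. \<Sum>j<c. \<Sum>l<s. a i l * b l j * un i j)"
    by (intro sum.cong refl sum.swap)
  finally show ?thesis by (simp only: sum_distrib_right)
qed

lemma sum_lessThan_add: "(\<Sum>l<s + t. g l) = (\<Sum>l<s. g l) + (\<Sum>l<t. g (s + l))"
  for g :: "nat \<Rightarrow> 'a::comm_monoid_add"
  by (induction t) (simp_all add: add.assoc)

lemma mat_dims [simp]:
  "dim_row (mat_mul A X Y) = dim_row X" "dim_col (mat_mul A X Y) = dim_col Y"
  "dim_row (kron A X Y) = dim_row X * dim_row Y" "dim_col (kron A X Y) = dim_col X * dim_col Y"
  "dim_row (id_mat A n) = n" "dim_col (id_mat A n) = n"
  "dim_row (scalar_mat A M) = dim_row M" "dim_col (scalar_mat A M) = dim_col M"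
  "dim_row (mat1 m n f) = m" "dim_col (mat1 m n f) = n"
  by (simp_all add: mat_mul_def kron_def id_mat_def scalar_mat_def mat1_def)

text \<open>A representation of an algebra by quantum operators. Products of matrices over the algebra become products
of operators, blockwise.\<close>

locale op_rep =
  fixes A :: "(complex, 'a) module" and \<phi> :: "'a \<Rightarrow> aop"
  assumes calg: "calg A" and hom: "\<phi> \<in> alg_hom A op_alg" and qnt: "\<And>x. x \<in> carrier A \<Longrightarrow> quantum (\<phi> x)"
begin

interpretation A: ring A using calg by (rule calgD)

lemmas phi = alg_homD[OF hom, simplified]

lemma phi_zero: "\<phi> \<zero>\<^bsub>A\<^esub> = 0"
  using alg_hom_zero[OF hom calgD(1)[OF calg] calgD(1)[OF calg_op]] by simp

lemma mat_in_mult: "mat_in A X \<Longrightarrow> mat_in A Y \<Longrightarrow> dim_col X = dim_row Y \<Longrightarrow> mat_in A (X \<star>\<^bsub>A\<^esub> Y)"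
  unfolding mat_in_def mat_mul_def by (auto intro!: A.finsum_closed A.m_closed)

lemma mat_in_kron: "mat_in A X \<Longrightarrow> mat_in A Y \<Longrightarrow> mat_in A (kron A X Y)"
  unfolding mat_in_def kron_def
  by (auto intro!: A.m_closed simp: less_mult_imp_div_less)
     (metis gr0I less_nat_zero_code mod_less_divisor mult_0_right)+

lemma mat_in_id: "mat_in A (id_mat A n)" by (simp add: mat_in_def id_mat_def)

lemma mat_in_scalar: "mat_in A (scalar_mat A M)"
  using calgD(2)[OF calg] by (simp add: mat_in_def scalar_mat_def)

lemma phi_mult:
  assumes "mat_in A X" "mat_in A Y" "dim_col X = dim_row Y" "i < dim_row X" "k < dim_col Y"
  shows "\<phi> ((X \<star>\<^bsub>A\<^esub> Y) $$ (i, k)) = (\<Sum>l<dim_col X. \<phi> (X $$ (i, l)) * \<phi> (Y $$ (l, k)))"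
proof -
  have c: "X $$ (i, l) \<in> carrier A" "Y $$ (l, k) \<in> carrier A" if "l < dim_col X" for l
    using assms that by (auto simp: mat_in_def)
  have "\<phi> ((X \<star>\<^bsub>A\<^esub> Y) $$ (i, k)) = \<phi> (\<Oplus>\<^bsub>A\<^esub>l\<in>{..<dim_col X}. X $$ (i, l) \<otimes>\<^bsub>A\<^esub> Y $$ (l, k))"
    using assms by (simp add: mat_mul_def)
  also have "\<dots> = (\<Oplus>\<^bsub>op_alg\<^esub>l\<in>{..<dim_col X}. \<phi> (X $$ (i, l) \<otimes>\<^bsub>A\<^esub> Y $$ (l, k)))"
    using c by (intro alg_hom_finsum[OF hom calgD(1)[OF calg] calgD(1)[OF calg_op]]) auto
  also have "\<dots> = (\<Sum>l<dim_col X. \<phi> (X $$ (i, l)) * \<phi> (Y $$ (l, k)))"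
    using c by (simp add: finsum_op phi)
  finally show ?thesis .
qed

lemma bl_mult1:
  assumes "mat_in A X" "mat_in A Y" "dim_col X = s" "dim_row Y = s" "i0 + r \<le> dim_row X" "j0 + c \<le> dim_col Y"
  shows "bl \<phi> r c i0 j0 (X \<star>\<^bsub>A\<^esub> Y) = bl \<phi> r s i0 0 X * bl \<phi> s c 0 j0 Y"
proof -
  have q: "quantum (\<phi> (Y $$ (0 + l, j0 + j)))" if "l < s" "j < c" for l j
    using assms that by (intro qnt) (auto simp: mat_in_def)
  have "bl \<phi> r s i0 0 X * bl \<phi> s c 0 j0 Y
      = (\<Sum>i<r. \<Sum>j<c. (\<Sum>l<s. \<phi> (X $$ (i0 + i, 0 + l)) * \<phi> (Y $$ (0 + l, j0 + j))) * un i j)"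
    unfolding bl_def by (rule un_sum_mult) (rule q)
  also have "\<dots> = bl \<phi> r c i0 j0 (X \<star>\<^bsub>A\<^esub> Y)"
    unfolding bl_def using assms by (intro sum.cong refl) (simp add: phi_mult)
  finally show ?thesis ..
qed

lemma bl_mult2:
  assumes "mat_in A X" "mat_in A Y" "dim_col X = 2 * s" "dim_row Y = 2 * s" "i0 + r \<le> dim_row X" "j0 + c \<le> dim_col Y"
  shows "bl \<phi> r c i0 j0 (X \<star>\<^bsub>A\<^esub> Y) = (\<Sum>l\<in>UNIV. bl \<phi> r s i0 (off s l) X * bl \<phi> s c (off s l) j0 Y)"
proof -
  have q: "quantum (\<phi> (Y $$ (o' + l, j0 + j)))" if "l < s" "j < c" "o' \<le> s" for l j o'
    using assms that by (intro qnt) (auto simp: mat_in_def)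
  have e: "bl \<phi> r s i0 o' X * bl \<phi> s c o' j0 Y
      = (\<Sum>i<r. \<Sum>j<c. (\<Sum>l<s. \<phi> (X $$ (i0 + i, o' + l)) * \<phi> (Y $$ (o' + l, j0 + j))) * un i j)" if "o' \<le> s" for o'
    unfolding bl_def by (rule un_sum_mult) (rule q[OF _ _ that])
  have "bl \<phi> r c i0 j0 (X \<star>\<^bsub>A\<^esub> Y) = (\<Sum>i<r. \<Sum>j<c.
      ((\<Sum>l<s. \<phi> (X $$ (i0 + i, 0 + l)) * \<phi> (Y $$ (0 + l, j0 + j)))
       + (\<Sum>l<s. \<phi> (X $$ (i0 + i, s + l)) * \<phi> (Y $$ (s + l, j0 + j)))) * un i j)"
    unfolding bl_def using assms
    by (intro sum.cong refl) (simp add: phi_mult mult_2 sum_lessThan_add)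
  then show ?thesis
    by (simp add: UNIV_bool off_def e distrib_right sum.distrib add.commute)
qed

lemma bl_scalar:
  assumes "i0 + r \<le> dim_row M" "j0 + c \<le> dim_col M"
  shows "bl \<phi> r c i0 j0 (scalar_mat A M) = bl cst r c i0 j0 M"
  unfolding bl_def using assms by (intro sum.cong refl) (simp add: scalar_mat_def phi)

lemma bl_kron_id:
  assumes "dim_row K = 2" "dim_col K = 2" "mat_in A K"
  shows "bl \<phi> s s (off s p) (off s q) (kron A K (id_mat A s)) = \<phi> (K $$ (of_bool p, of_bool q)) * Pr s"
proof (cases "s = 0")
  case True
  have "Pr 0 = 0" by (auto intro!: aop_eqI simp: Pr_def)
  then show ?thesis using True by (simp add: bl_def)
next
  case False
  have c: "K $$ (of_bool p, of_bool q) \<in> carrier A" for p q using assms by (auto simp: mat_in_def of_bool_def)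
  note d = off_div_mod
  have l: "off s p + i < 2 * s" if "i < s" for p i using that by (auto simp: off_def)
  have "bl \<phi> s s (off s p) (off s q) (kron A K (id_mat A s))
      = (\<Sum>i<s. \<Sum>j<s. if i = j then \<phi> (K $$ (of_bool p, of_bool q)) * un i j else 0)"
    unfolding bl_def using assms c
    by (intro sum.cong refl) (auto simp: kron_def id_mat_def d l phi phi_zero)
  also have "\<dots> = \<phi> (K $$ (of_bool p, of_bool q)) * (\<Sum>i<s. un i i)"
    by (simp add: sum_distrib_left)
  also have "(\<Sum>i<s. un i i) = Pr s"
    by (auto intro!: aop_eqI simp: Pr_def)
  finally show ?thesis .
qed

lemma bl_id_kron:
  assumes "dim_row Y = s" "dim_col Y = s" "mat_in A Y"
  shows "bl \<phi> s s (off s p) (off s q) (kron A (id_mat A 2) Y) = (if p = q then bl \<phi> s s 0 0 Y else 0)"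
proof (cases "s = 0")
  case True then show ?thesis by (simp add: bl_def)
next
  case False
  note d = off_div_mod
  have l: "off s p + i < 2 * s" if "i < s" for p i using that by (auto simp: off_def)
  have id2: "id_mat A 2 $$ (of_bool p, of_bool q) = (if p = q then \<one>\<^bsub>A\<^esub> else \<zero>\<^bsub>A\<^esub>)" for p q
    by (auto simp: id_mat_def)
  have c: "Y $$ (i, j) \<in> carrier A" if "i < s" "j < s" for i j using assms that by (auto simp: mat_in_def)
  have "\<phi> (kron A (id_mat A 2) Y $$ (off s p + i, off s q + j)) = (if p = q then \<phi> (Y $$ (i, j)) else 0)"
    if "i < s" "j < s" for i j
    using assms that c[OF that] by (simp add: kron_def d l id2 phi phi_zero)
  then show ?thesis
    unfolding bl_def by simp
qed

end

section \<open>Blocks of the fusion matrices, spin matrices and R-matrices\<close>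

context qparam begin

lemma E_diag_eps: "E_diag q (Suc n) k = eps n k"
  by (simp add: E_diag_def eps_def beta_def)

lemma fuse_E_entry_upper:
  "a \<le> n \<Longrightarrow> fuse_E_entry q (Suc n) (Suc a) (Suc j) = (if a = j then eps n a else 0)"
  by (auto simp: fuse_E_entry_def E_diag_eps)

lemma fuse_E_entry_lower:
  "fuse_E_entry q (Suc n) (Suc (Suc n + a)) (Suc j) = (if j = Suc a \<and> a \<le> n then eta n a else 0)"
proof (cases "j = Suc a \<and> a \<le> n")
  case True
  have "int (Suc n) + 2 - 2 * (int (Suc j) - 1) = int (Suc n) - 2 * int a" using True by simp
  then show ?thesis using True
    by (auto simp: fuse_E_entry_def E_diag_eps eta_def beta_def algebra_simps)
next
  case False then show ?thesis by (auto simp: fuse_E_entry_def)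
qed

lemma bl_fuse_E: "bl cst (Suc n) (n + 2) (off (Suc n) i) 0 (fuse_E q (Suc n)) = Eop n i"
proof (rule aop_eqI)
  fix x :: "nat \<times> nat \<Rightarrow> complex" and a s
  have "app (bl cst (Suc n) (n + 2) (off (Suc n) i) 0 (fuse_E q (Suc n))) x (a, s)
     = (if a < Suc n then \<Sum>j<n + 2. (if i then if j = Suc a then eta n a else 0 else if a = j then eps n a else 0) * x (j, s) else 0)"
    unfolding app_bl_scl
    by (auto intro!: sum.cong simp: off_def fuse_E_def mat1_def fuse_E_entry_upper fuse_E_entry_lower[simplified])
  also have "\<dots> = app (Eop n i) x (a, s)"
    by (auto simp: Eop_def eps_zero eta_zero if_distrib[of "\<lambda>z. z * _"] cong: if_cong)
  finally show "app (bl cst (Suc n) (n + 2) (off (Suc n) i) 0 (fuse_E q (Suc n))) x (a, s) = app (Eop n i) x (a, s)" .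
qed

lemma fuse_F_off_psi: "k < n \<Longrightarrow> fuse_F_off q (Suc n) (Suc (Suc k)) = psi n k"
  using fuse_E_entry_upper[of "Suc k" n "Suc k"] fuse_E_entry_lower[of n k "Suc k"]
  by (simp add: fuse_F_off_def psi_def add.commute)

lemma fuse_F_left:
  assumes "r < n + 2" "j < Suc n"
  shows "fuse_F q (Suc n) $$ (r, j) = (if r = j then phi n r else 0)"
proof (cases r)
  case 0 then show ?thesis using assms by (auto simp: fuse_F_def mat1_def phi_def)
next
  case (Suc k)
  then show ?thesis
    using assms fuse_E_entry_upper[of "Suc k" n "Suc k"] fuse_E_entry_lower[of n k "Suc k"]
    by (auto simp: fuse_F_def mat1_def phi_def fuse_F_off_psi add.commute)
qed

lemma fuse_F_right:
  assumes "r < n + 2" "j < Suc n"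
  shows "fuse_F q (Suc n) $$ (r, Suc n + j) = (if r = Suc j then psi n j else 0)"
proof (cases r)
  case 0 then show ?thesis using assms by (auto simp: fuse_F_def mat1_def)
next
  case (Suc k)
  then show ?thesis
    using assms fuse_E_entry_lower[of n n "Suc n"]
    by (auto simp: fuse_F_def mat1_def fuse_F_off_psi psi_def mult_2)
qed

lemma bl_fuse_F: "bl cst (n + 2) (Suc n) 0 (off (Suc n) i) (fuse_F q (Suc n)) = Fop n i"
proof (rule aop_eqI)
  fix x :: "nat \<times> nat \<Rightarrow> complex" and a s
  have "app (bl cst (n + 2) (Suc n) 0 (off (Suc n) i) (fuse_F q (Suc n))) x (a, s)
     = (if a < n + 2 then \<Sum>j<Suc n. (if i then if a = Suc j then psi n j else 0 else if a = j then phi n a else 0) * x (j, s) else 0)"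
    unfolding app_bl_scl
    by (auto intro!: sum.cong simp: off_def fuse_F_left fuse_F_right[simplified])
  also have "\<dots> = app (Fop n i) x (a, s)"
    by (cases a) (auto simp: Fop_def phi_def psi_def if_distrib[of "\<lambda>z. z * _"] cong: if_cong)
  finally show "app (bl cst (n + 2) (Suc n) 0 (off (Suc n) i) (fuse_F q (Suc n))) x (a, s) = app (Fop n i) x (a, s)" .
qed

lemma S_minus_entry: "a < Suc n \<Longrightarrow> b < Suc n \<Longrightarrow> S_minus q n $$ (a, b) = (if a = Suc b then beta n b else 0)"
  by (simp add: S_minus_def mat1_def beta_def algebra_simps)

lemma S_plus_entry: "a < Suc n \<Longrightarrow> b < Suc n \<Longrightarrow> S_plus q n $$ (a, b) = (if b = Suc a then beta n a else 0)"
  by (simp add: S_plus_def mat1_def beta_def algebra_simps)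

lemma K_power_entry: "a < Suc n \<Longrightarrow> b < Suc n \<Longrightarrow> K_power_mat h s n $$ (a, b) = (if a = b then h powi (s * (int n - 2 * int a)) else 0)"
  by (simp add: K_power_mat_def mat1_def S3_entry_def algebra_simps)

lemma bl_S_minus: "bl cst (Suc n) (Suc n) 0 0 (S_minus q n) = Sm n * Pr (Suc n)"
proof (rule aop_eqI)
  fix x :: "nat \<times> nat \<Rightarrow> complex" and a s
  have "app (bl cst (Suc n) (Suc n) 0 0 (S_minus q n)) x (a, s)
      = (if a < Suc n then \<Sum>j<Suc n. (if a = Suc j then beta n j else 0) * x (j, s) else 0)"
    unfolding app_bl_scl by (auto intro!: sum.cong simp: S_minus_entry)
  also have "\<dots> = app (Sm n * Pr (Suc n)) x (a, s)"
    by (cases a; cases "a = Suc n") (auto simp: Sm_def Pr_def if_distrib[of "\<lambda>z. z * _"] cong: if_cong)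
  finally show "app (bl cst (Suc n) (Suc n) 0 0 (S_minus q n)) x (a, s) = app (Sm n * Pr (Suc n)) x (a, s)" .
qed

lemma bl_S_plus: "bl cst (Suc n) (Suc n) 0 0 (S_plus q n) = Sp n * Pr (Suc n)"
proof (rule aop_eqI)
  fix x :: "nat \<times> nat \<Rightarrow> complex" and a s
  have "app (bl cst (Suc n) (Suc n) 0 0 (S_plus q n)) x (a, s)
      = (if a < Suc n then \<Sum>j<Suc n. (if j = Suc a then beta n a else 0) * x (j, s) else 0)"
    unfolding app_bl_scl by (auto intro!: sum.cong simp: S_plus_entry)
  also have "\<dots> = app (Sp n * Pr (Suc n)) x (a, s)"
    by (cases "a = n") (auto simp: Sp_def Pr_def if_distrib[of "\<lambda>z. z * _"] cong: if_cong)
  finally show "app (bl cst (Suc n) (Suc n) 0 0 (S_plus q n)) x (a, s) = app (Sp n * Pr (Suc n)) x (a, s)" .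
qed

lemma bl_K_power: "bl cst (Suc n) (Suc n) 0 0 (K_power_mat h s n) = kap n s * Pr (Suc n)"
proof (rule aop_eqI)
  fix x :: "nat \<times> nat \<Rightarrow> complex" and a s'
  have "app (bl cst (Suc n) (Suc n) 0 0 (K_power_mat h s n)) x (a, s')
      = (if a < Suc n then \<Sum>j<Suc n. (if a = j then h powi (s * (int n - 2 * int a)) else 0) * x (j, s') else 0)"
    unfolding app_bl_scl by (auto intro!: sum.cong simp: K_power_entry)
  also have "\<dots> = app (kap n s * Pr (Suc n)) x (a, s')"
    by (auto simp: kap_def Pr_def if_distrib[of "\<lambda>z. z * _"] cong: if_cong)
  finally show "app (bl cst (Suc n) (Suc n) 0 0 (K_power_mat h s n)) x (a, s') = app (kap n s * Pr (Suc n)) x (a, s')" .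
qed

lemma R_mat_entry:
  assumes "n > 0" "a < Suc n" "b < Suc n"
  shows "R_mat h n w $$ (off (Suc n) p + a, off (Suc n) r + b)
    = pref n w * (if p then if r then w * h * K_power_mat h (- 1) n $$ (a, b) - inverse (w * h) * K_power_mat h 1 n $$ (a, b)
          else dlt * S_plus q n $$ (a, b)
        else if r then dlt * S_minus q n $$ (a, b)
          else w * h * K_power_mat h 1 n $$ (a, b) - inverse (w * h) * K_power_mat h (- 1) n $$ (a, b))"
proof -
  note d = off_div_mod[of _ "Suc n"]
  have l: "off (Suc n) p + a < 2 * Suc n" if "a < Suc n" for p a using that by (auto simp: off_def)
  have sig: "sigma_plus $$ (of_bool p, of_bool r) = (if \<not> p \<and> r then 1 else 0)"
    "sigma_minus $$ (of_bool p, of_bool r) = (if p \<and> \<not> r then 1 else 0)" for p r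
    by (auto simp: sigma_plus_def sigma_minus_def mat_of_rows_list_def)
  have dims: "dim_row sigma_plus = 2" "dim_col sigma_plus = 2" "dim_row sigma_minus = 2" "dim_col sigma_minus = 2"
    "dim_row (S_plus q n) = Suc n" "dim_col (S_plus q n) = Suc n" "dim_row (S_minus q n) = Suc n" "dim_col (S_minus q n) = Suc n"
    by (simp_all add: sigma_plus_def sigma_minus_def mat_of_rows_list_def S_plus_def S_minus_def)
  define I J where "I = off (Suc n) p + a" and "J = off (Suc n) r + b"
  define kp km dg where "kp = kron complex_alg sigma_plus (S_minus q n)" and "km = kron complex_alg sigma_minus (S_plus q n)"
    and "dg = mat1 (2 * (n + 1)) (2 * (n + 1)) (\<lambda>i k. if i = k then w * h powi R_exponent n i - inverse w * h powi - R_exponent n i else 0)"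
  have IJ: "I < 2 * Suc n" "J < 2 * Suc n" using l assms by (simp_all only: I_def J_def)
  have kd: "dim_row kp = 2 * Suc n" "dim_col kp = 2 * Suc n" "dim_row km = 2 * Suc n" "dim_col km = 2 * Suc n"
    "dim_row dg = 2 * Suc n" "dim_col dg = 2 * Suc n"
    by (simp_all only: kp_def km_def dg_def mat_dims dims Suc_eq_plus1)
  have eq: "I = J \<longleftrightarrow> p = r \<and> a = b" using assms by (auto simp: off_def I_def J_def)
  have rx: "R_exponent n (Suc I) = (if p then 1 + (2 * int a - int n) else 1 + (int n - 2 * int a))"
    using assms by (auto simp: R_exponent_def off_def S3_entry_def I_def)
  have dm: "I div Suc n = of_bool p" "I mod Suc n = a" "J div Suc n = of_bool r" "J mod Suc n = b"
    unfolding I_def J_def using d assms by blast+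
  have e: "kp $$ (I, J) = (if \<not> p \<and> r then S_minus q n $$ (a, b) else 0)"
    "km $$ (I, J) = (if p \<and> \<not> r then S_plus q n $$ (a, b) else 0)"
    unfolding kp_def km_def kron_def dims index_mat(1)[OF IJ] prod.case dm sig by (simp_all add: complex_alg_def)
  have IJ': "I < 2 * (n + 1)" "J < 2 * (n + 1)" using IJ by simp_all
  have e3: "dg $$ (I, J) = (if p = r \<and> a = b then w * h powi R_exponent n (Suc I) - inverse w * h powi - R_exponent n (Suc I) else 0)"
    unfolding dg_def mat1_def index_mat(1)[OF IJ'] prod.case using eq by auto
  have "R_mat h n w = pref n w \<cdot>\<^sub>m (dlt \<cdot>\<^sub>m (kp + km) + dg)"
    unfolding R_mat_def Let_def kp_def km_def dg_def pref_def dlt_def q_h using assms(1) by simp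
  then have "R_mat h n w $$ (I, J) = pref n w * (dlt * (kp $$ (I, J) + km $$ (I, J)) + dg $$ (I, J))"
    using IJ by (simp only: index_smult_mat index_add_mat kd)
  moreover have "h powi (1 + z) = h * h powi z" "h powi - (1 + z) = inverse h * h powi - z" for z
    using h_powi_add[of 1 z] h_powi_add[of "-1" "- z"] by simp_all
  note this[of "int n - 2 * int a"] this[of "2 * int a - int n"]
  ultimately show ?thesis
    unfolding e e3 rx I_def[symmetric] J_def[symmetric]
    using assms by (cases p; cases r; cases "a = b"; simp add: K_power_entry mult.assoc[symmetric])
qed

lemma bl_R_mat: "bl cst (Suc n) (Suc n) (off (Suc n) p) (off (Suc n) r) (R_mat h n w) = Rop n w p r"
proof (cases "n = 0")
  case True
  then show ?thesis
    by (cases p; cases r) (auto intro!: aop_eqI simp: app_bl_scl Rop_def R_mat_def off_def Pr_def)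
next
  case False
  let ?b = "bl cst (Suc n) (Suc n)"
  have sums: "?b o1 o2 M = (\<Sum>i<Suc n. \<Sum>j<Suc n. (M $$ (o1 + i, o2 + j)) \<cdot>\<^sub>C un i j)" for o1 o2 M
    by (simp add: bl_def)
  have lin: "(\<Sum>i<Suc n. \<Sum>j<Suc n. (c * M $$ (i, j)) \<cdot>\<^sub>C un i j) = c \<cdot>\<^sub>C ?b 0 0 M" for c M
    by (simp add: sums scl_sum del: sum.lessThan_Suc)
  have lin2: "(\<Sum>i<Suc n. \<Sum>j<Suc n. (c * M $$ (i, j) - d * M' $$ (i, j)) \<cdot>\<^sub>C un i j) = c \<cdot>\<^sub>C ?b 0 0 M - d \<cdot>\<^sub>C ?b 0 0 M'" for c d M M'
    by (simp only: scl_distrib sum_subtractf lin)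
  have "?b (off (Suc n) p) (off (Suc n) r) (R_mat h n w)
    = pref n w \<cdot>\<^sub>C (\<Sum>i<Suc n. \<Sum>j<Suc n. (if p then if r then w * h * K_power_mat h (- 1) n $$ (i, j) - inverse (w * h) * K_power_mat h 1 n $$ (i, j)
          else dlt * S_plus q n $$ (i, j)
        else if r then dlt * S_minus q n $$ (i, j)
          else w * h * K_power_mat h 1 n $$ (i, j) - inverse (w * h) * K_power_mat h (- 1) n $$ (i, j)) \<cdot>\<^sub>C un i j)"
    unfolding sums scl_sum using False
    by (intro sum.cong refl) (simp only: R_mat_entry lessThan_iff scl_simps)
  also have "\<dots> = Rop n w p r"
    using False
    by (cases p; cases r; simp only: if_True if_False lin lin2 bl_K_power bl_S_minus bl_S_plus)
      (simp_all add: Rop_def rr_def lax_def left_diff_distrib)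
  finally show ?thesis .
qed

lemma K_half_entry: "K_half (h\<^sup>2) kp km ep em u $$ (of_bool i, of_bool j) = kmat kp km ep em u i j"
  by (auto simp: K_half_def kmat_def mat_of_rows_list_def q_h dlt_def)

end

section \<open>Fused matrices as operators\<close>

locale op_rep_q = op_rep A \<phi> + qparam q h
  for A :: "(complex, 'a) module" and \<phi> :: "'a \<Rightarrow> aop" and q h :: complex
begin

text \<open>A fused K-matrix over any represented algebra is the fused K-operator in the ring of operators.\<close>

lemma bl_fused_K:
  assumes K: "\<And>u. dim_row (K u) = 2 \<and> dim_col (K u) = 2 \<and> mat_in A (K u)"
  shows "mat_in A (fused_K A h K n u) \<and> dim_row (fused_K A h K n u) = Suc n \<and> dim_col (fused_K A h K n u) = Suc n
    \<and> bl \<phi> (Suc n) (Suc n) 0 0 (fused_K A h K n u) = fuseK (\<lambda>u i j. \<phi> (K u $$ (of_bool i, of_bool j))) n u"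
proof (induction n arbitrary: u)
  case 0
  have "Pr 1 = un 0 0" by (auto intro!: aop_eqI simp: Pr_def)
  then show ?case by (simp add: mat_in_id bl_def) (simp add: id_mat_def phi)
next
  case (Suc n u)
  let ?s = "Suc n"
  let ?F = "scalar_mat A (fuse_F (h\<^sup>2) (Suc n))"
  let ?K1 = "kron A (K (u * h powi (- int n))) (id_mat A (Suc n))"
  let ?R = "scalar_mat A (R_mat h n (u\<^sup>2 * h powi (1 - int n)))"
  let ?K2 = "kron A (id_mat A 2) (fused_K A h K n (u * h))"
  let ?E = "scalar_mat A (fuse_E (h\<^sup>2) (Suc n))"
  note IH = Suc.IH[of "u * h"]
  note K' = K[of "u * h powi (- int n)"]
  have Rd: "dim_row (R_mat h n w) = 2 * ?s" "dim_col (R_mat h n w) = 2 * ?s" for w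
    by (simp_all add: R_mat_def Let_def)
  have d: "dim_row ?F = n + 2" "dim_col ?F = 2 * ?s" "dim_row ?K1 = 2 * ?s" "dim_col ?K1 = 2 * ?s"
    "dim_row ?R = 2 * ?s" "dim_col ?R = 2 * ?s" "dim_row ?K2 = 2 * ?s" "dim_col ?K2 = 2 * ?s"
    "dim_row ?E = 2 * ?s" "dim_col ?E = n + 2"
    using IH K' Rd by (simp_all add: fuse_F_def fuse_E_def)
  have m: "mat_in A ?F" "mat_in A ?K1" "mat_in A ?R" "mat_in A ?K2" "mat_in A ?E"
    using IH K' by (auto intro: mat_in_kron mat_in_id mat_in_scalar)
  have m2: "mat_in A (?F \<star>\<^bsub>A\<^esub> ?K1)" by (rule mat_in_mult[OF m(1,2)]) (simp only: d)
  have m3: "mat_in A (?F \<star>\<^bsub>A\<^esub> ?K1 \<star>\<^bsub>A\<^esub> ?R)" by (rule mat_in_mult[OF m2 m(3)]) (simp only: d mat_dims(1,2))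
  have m4: "mat_in A (?F \<star>\<^bsub>A\<^esub> ?K1 \<star>\<^bsub>A\<^esub> ?R \<star>\<^bsub>A\<^esub> ?K2)" by (rule mat_in_mult[OF m3 m(4)]) (simp only: d mat_dims(1,2))
  have m5: "mat_in A (?F \<star>\<^bsub>A\<^esub> ?K1 \<star>\<^bsub>A\<^esub> ?R \<star>\<^bsub>A\<^esub> ?K2 \<star>\<^bsub>A\<^esub> ?E)" by (rule mat_in_mult[OF m4 m(5)]) (simp only: d mat_dims(1,2))
  have o: "off ?s p + ?s \<le> 2 * ?s" for p by (simp add: off_def)
  have fd: "dim_row (fuse_F q (Suc n)) = n + 2" "dim_col (fuse_F q (Suc n)) = 2 * Suc n"
    "dim_row (fuse_E q (Suc n)) = 2 * Suc n" "dim_col (fuse_E q (Suc n)) = n + 2"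
    by (simp_all add: fuse_F_def fuse_E_def)
  have bF: "bl \<phi> (n + 2) ?s 0 (off ?s i) ?F = Fop n i" for i
    by (subst bl_scalar) (simp_all only: q_h fd o add_0 order_refl bl_fuse_F)
  have bE: "bl \<phi> ?s (n + 2) (off ?s i) 0 ?E = Eop n i" for i
    by (subst bl_scalar) (simp_all only: q_h fd o add_0 order_refl bl_fuse_E)
  have bR: "bl \<phi> ?s ?s (off ?s i) (off ?s j) ?R = Rop n (u\<^sup>2 * h powi (1 - int n)) i j" for i j
    using o Rd by (subst bl_scalar) (simp_all only: bl_R_mat)
  have bK1: "bl \<phi> ?s ?s (off ?s i) (off ?s j) ?K1 = \<phi> (K (u * h powi (- int n)) $$ (of_bool i, of_bool j)) * Pr ?s" for i j
    using K' by (intro bl_kron_id) auto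
  have bK2: "bl \<phi> ?s ?s (off ?s i) (off ?s j) ?K2 = (if i = j then bl \<phi> ?s ?s 0 0 (fused_K A h K n (u * h)) else 0)" for i j
    using IH by (intro bl_id_kron) auto
  have "bl \<phi> (n + 2) (n + 2) 0 0 (?F \<star>\<^bsub>A\<^esub> ?K1 \<star>\<^bsub>A\<^esub> ?R \<star>\<^bsub>A\<^esub> ?K2 \<star>\<^bsub>A\<^esub> ?E)
    = (\<Sum>m'\<in>UNIV. (\<Sum>m\<in>UNIV. (\<Sum>l\<in>UNIV. (\<Sum>i\<in>UNIV. bl \<phi> (n + 2) ?s 0 (off ?s i) ?F * bl \<phi> ?s ?s (off ?s i) (off ?s l) ?K1)
        * bl \<phi> ?s ?s (off ?s l) (off ?s m) ?R) * bl \<phi> ?s ?s (off ?s m) (off ?s m') ?K2) * bl \<phi> ?s (n + 2) (off ?s m') 0 ?E)"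
  proof -
    have "bl \<phi> (n + 2) ?s 0 (off ?s l) (?F \<star>\<^bsub>A\<^esub> ?K1) = (\<Sum>i\<in>UNIV. bl \<phi> (n + 2) ?s 0 (off ?s i) ?F * bl \<phi> ?s ?s (off ?s i) (off ?s l) ?K1)" for l
      by (rule bl_mult2[OF m(1) m(2)]) (simp_all only: d o add_0 order_refl)
    moreover have "bl \<phi> (n + 2) ?s 0 (off ?s r) (?F \<star>\<^bsub>A\<^esub> ?K1 \<star>\<^bsub>A\<^esub> ?R) = (\<Sum>l\<in>UNIV. bl \<phi> (n + 2) ?s 0 (off ?s l) (?F \<star>\<^bsub>A\<^esub> ?K1) * bl \<phi> ?s ?s (off ?s l) (off ?s r) ?R)" for r
      by (rule bl_mult2[OF m2 m(3)]) (simp_all only: mat_dims(1,2) d o add_0 order_refl)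
    moreover have "bl \<phi> (n + 2) ?s 0 (off ?s r) (?F \<star>\<^bsub>A\<^esub> ?K1 \<star>\<^bsub>A\<^esub> ?R \<star>\<^bsub>A\<^esub> ?K2) = (\<Sum>l\<in>UNIV. bl \<phi> (n + 2) ?s 0 (off ?s l) (?F \<star>\<^bsub>A\<^esub> ?K1 \<star>\<^bsub>A\<^esub> ?R) * bl \<phi> ?s ?s (off ?s l) (off ?s r) ?K2)" for r
      by (rule bl_mult2[OF m3 m(4)]) (simp_all only: mat_dims(1,2) d o add_0 order_refl)
    moreover have "bl \<phi> (n + 2) (n + 2) 0 0 (?F \<star>\<^bsub>A\<^esub> ?K1 \<star>\<^bsub>A\<^esub> ?R \<star>\<^bsub>A\<^esub> ?K2 \<star>\<^bsub>A\<^esub> ?E) = (\<Sum>l\<in>UNIV. bl \<phi> (n + 2) ?s 0 (off ?s l) (?F \<star>\<^bsub>A\<^esub> ?K1 \<star>\<^bsub>A\<^esub> ?R \<star>\<^bsub>A\<^esub> ?K2) * bl \<phi> ?s (n + 2) (off ?s l) 0 ?E)"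
      by (rule bl_mult2[OF m4 m(5)]) (simp_all only: mat_dims(1,2) d o add_0 order_refl)
    ultimately show ?thesis by (simp only:)
  qed
  also have "\<dots> = fuseK (\<lambda>u i j. \<phi> (K u $$ (of_bool i, of_bool j))) (Suc n) u"
  proof -
    have P: "Pr ?s * (Rop n w l m * z) = Rop n w l m * z" for w l m z
      by (simp add: mult.assoc[symmetric])
    have T: "bl \<phi> ?s ?s 0 0 (fused_K A h K n (u * h)) = fuseK (\<lambda>u i j. \<phi> (K u $$ (of_bool i, of_bool j))) n (u * h)"
      using IH by blast
    show ?thesis
      unfolding bF bE bR bK1 bK2 T fuseK.simps(2)
      by (simp only: sum_bool mult.assoc P distrib_left distrib_right simp_thms if_True if_False mult_zero_left mult_zero_right add_0_left add_0_right add_ac)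
  qed
  finally show ?case using m5 d by simp
qed

end

section \<open>Kronecker products of complex matrices and operators on one site\<close>

abbreviation kr :: "complex mat \<Rightarrow> complex mat \<Rightarrow> complex mat" where "kr \<equiv> kron complex_alg"

lemma kr_dim:
  assumes "X \<in> carrier_mat a a'" "Y \<in> carrier_mat b b'"
  shows "kr X Y \<in> carrier_mat (a * b) (a' * b')"
  by (rule carrier_matI) (simp_all only: mat_dims carrier_matD[OF assms(1)] carrier_matD[OF assms(2)])

lemma kr_entry:
  "i < dim_row X * dim_row Y \<Longrightarrow> j < dim_col X * dim_col Y \<Longrightarrow>
    kr X Y $$ (i, j) = X $$ (i div dim_row Y, j div dim_col Y) * Y $$ (i mod dim_row Y, j mod dim_col Y)"
  by (simp add: kron_def complex_alg_def)

lemma sum_div_mod: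
  fixes F :: "nat \<Rightarrow> nat \<Rightarrow> 'a::comm_monoid_add"
  shows "(\<Sum>l<a * b. F (l div b) (l mod b)) = (\<Sum>i<a. \<Sum>j<b. F i j)"
proof (cases "b = 0")
  case False
  show ?thesis
  proof (induction a)
    case (Suc a)
    have "(\<Sum>l<Suc a * b. F (l div b) (l mod b))
        = (\<Sum>l<a * b. F (l div b) (l mod b)) + (\<Sum>l<b. F ((a * b + l) div b) ((a * b + l) mod b))"
      unfolding mult_Suc add.commute[of b] by (rule sum_lessThan_add)
    also have "(\<Sum>l<b. F ((a * b + l) div b) ((a * b + l) mod b)) = (\<Sum>j<b. F a j)"
      using False by (intro sum.cong) auto
    finally show ?case using Suc by simp
  qed simp
qed simp

lemma div_mod_less: "i < a * b \<Longrightarrow> i div b < a \<and> i mod b < (b::nat)"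
  by (cases "b = 0") (simp_all add: less_mult_imp_div_less)

lemma kr_mult:
  assumes "X \<in> carrier_mat a a" "X' \<in> carrier_mat a a" "Y \<in> carrier_mat b b" "Y' \<in> carrier_mat b b"
  shows "kr X Y * kr X' Y' = kr (X * X') (Y * Y')"
proof (rule eq_matI)
  have dm: "dim_row X = a" "dim_col X = a" "dim_row X' = a" "dim_col X' = a"
    "dim_row Y = b" "dim_col Y = b" "dim_row Y' = b" "dim_col Y' = b"
    using assms by (simp_all only: carrier_matD)
  fix i j assume "i < dim_row (kr (X * X') (Y * Y'))" "j < dim_col (kr (X * X') (Y * Y'))"
  then have ij: "i < a * b" "j < a * b" by (simp_all only: mat_dims index_mult_mat dm)
  have prod: "(M * M') $$ (i, j) = (\<Sum>l<n. M $$ (i, l) * M' $$ (l, j))"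
    if "M \<in> carrier_mat n n" "M' \<in> carrier_mat n n" "i < n" "j < n" for M M' :: "complex mat" and n i j
    using that by (auto simp: scalar_prod_def lessThan_atLeast0 intro!: sum.cong)
  have e: "kr M M' $$ (i, j) = M $$ (i div b, j div b) * M' $$ (i mod b, j mod b)"
    if "M \<in> carrier_mat a a" "M' \<in> carrier_mat b b" "i < a * b" "j < a * b" for M M' i j
    using kr_entry[of i M M' j] that by (simp only: carrier_matD)
  have "(kr X Y * kr X' Y') $$ (i, j) = (\<Sum>l<a * b. kr X Y $$ (i, l) * kr X' Y' $$ (l, j))"
    by (rule prod[OF kr_dim[OF assms(1,3)] kr_dim[OF assms(2,4)] ij])
  also have "\<dots> = (\<Sum>l<a * b. (X $$ (i div b, l div b) * Y $$ (i mod b, l mod b)) * (X' $$ (l div b, j div b) * Y' $$ (l mod b, j mod b)))"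
    by (intro sum.cong refl) (simp only: lessThan_iff e[OF assms(1,3)] e[OF assms(2,4)] ij)
  also have "\<dots> = (\<Sum>k<a. \<Sum>l<b. (X $$ (i div b, k) * Y $$ (i mod b, l)) * (X' $$ (k, j div b) * Y' $$ (l, j mod b)))"
    by (rule sum_div_mod)
  also have "\<dots> = (\<Sum>k<a. X $$ (i div b, k) * X' $$ (k, j div b)) * (\<Sum>l<b. Y $$ (i mod b, l) * Y' $$ (l, j mod b))"
    by (simp add: sum_product mult_ac)
  also have "\<dots> = (X * X') $$ (i div b, j div b) * (Y * Y') $$ (i mod b, j mod b)"
    using div_mod_less[OF ij(1)] div_mod_less[OF ij(2)] assms by (simp only: prod)
  also have "\<dots> = kr (X * X') (Y * Y') $$ (i, j)"
    using e[OF mult_carrier_mat[OF assms(1,2)] mult_carrier_mat[OF assms(3,4)] ij] ..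
  finally show "(kr X Y * kr X' Y') $$ (i, j) = kr (X * X') (Y * Y') $$ (i, j)" .
qed (simp_all only: mat_dims index_mult_mat)

lemma kr_assoc: "kr (kr X Y) Z = kr X (kr Y Z)"
proof (rule eq_matI)
  fix i j assume "i < dim_row (kr X (kr Y Z))" "j < dim_col (kr X (kr Y Z))"
  then have ij: "i < dim_row X * (dim_row Y * dim_row Z)" "j < dim_col X * (dim_col Y * dim_col Z)"
    "i < (dim_row X * dim_row Y) * dim_row Z" "j < (dim_col X * dim_col Y) * dim_col Z" by (simp_all add: mult.assoc)
  have dd: "i div dim_row Z < dim_row X * dim_row Y" "j div dim_col Z < dim_col X * dim_col Y"
    "i mod (dim_row Y * dim_row Z) < dim_row Y * dim_row Z" "j mod (dim_col Y * dim_col Z) < dim_col Y * dim_col Z"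
    using ij div_mod_less by blast+
  have m: "p mod (b * c) div c = p div c mod b" "p mod (b * c) mod c = p mod c" "p div c div b = p div (b * c)" for p b c :: nat
    by (simp_all add: mod_mult2_eq div_mult2_eq mult.commute[of b c])
      (cases "c = 0"; simp add: mod_mult2_eq)
  show "kr (kr X Y) Z $$ (i, j) = kr X (kr Y Z) $$ (i, j)"
    using ij dd by (simp add: kr_entry m mult.assoc)
qed (simp_all add: mult.assoc)

lemma kr_one: "kr (1\<^sub>m a) (1\<^sub>m b) = 1\<^sub>m (a * b)"
proof (rule eq_matI)
  fix i j assume "i < dim_row (1\<^sub>m (a * b))" "j < dim_col (1\<^sub>m (a * b))"
  then have ij: "i < a * b" "j < a * b" by auto
  note dm = div_mod_less[OF ij(1)] div_mod_less[OF ij(2)]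
  have "i = j \<longleftrightarrow> i div b = j div b \<and> i mod b = j mod b" by (metis div_mult_mod_eq)
  then show "kr (1\<^sub>m a) (1\<^sub>m b) $$ (i, j) = 1\<^sub>m (a * b) $$ (i, j)"
    using ij dm by (auto simp: kr_entry)
qed auto

lemma kr_add_left:
  "X \<in> carrier_mat a a \<Longrightarrow> X' \<in> carrier_mat a a \<Longrightarrow> Y \<in> carrier_mat b b \<Longrightarrow> kr (X + X') Y = kr X Y + kr X' Y"
  by (rule eq_matI) (auto simp: kr_entry div_mod_less distrib_right)

lemma kr_add_right:
  "X \<in> carrier_mat a a \<Longrightarrow> Y \<in> carrier_mat b b \<Longrightarrow> Y' \<in> carrier_mat b b \<Longrightarrow> kr X (Y + Y') = kr X Y + kr X Y'"
  by (rule eq_matI) (auto simp: kr_entry div_mod_less distrib_left)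

lemma kr_smult_left: "X \<in> carrier_mat a a \<Longrightarrow> Y \<in> carrier_mat b b \<Longrightarrow> kr (c \<cdot>\<^sub>m X) Y = c \<cdot>\<^sub>m kr X Y"
  by (rule eq_matI) (auto simp: kr_entry div_mod_less)

lemma kr_smult_right: "X \<in> carrier_mat a a \<Longrightarrow> Y \<in> carrier_mat b b \<Longrightarrow> kr X (c \<cdot>\<^sub>m Y) = c \<cdot>\<^sub>m kr X Y"
  by (rule eq_matI) (auto simp: kr_entry div_mod_less)

lemma prod_split_at:
  fixes f :: "'b \<Rightarrow> nat"
  assumes "finite A" "finite B" "n \<notin> A" "n \<notin> B" "A \<inter> B = {}"
  shows "prod f (A \<union> ({n} \<union> B)) = prod f A * (f n * prod f B)"
  using assms by (subst prod.union_disjoint) auto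

lemma chain_dim_split:
  assumes "n \<in> {1..N}"
  shows "chain_dim N ts = (\<Prod>k\<in>{n+1..N}. ts k + 1) * ((ts n + 1) * (\<Prod>k\<in>{1..<n}. ts k + 1))"
proof -
  have "{1..N} = {n+1..N} \<union> ({n} \<union> {1..<n})" using assms by auto
  then show ?thesis unfolding chain_dim_def by (simp only:) (rule prod_split_at; auto)
qed

lemma chain_dim_pos: "chain_dim N ts > 0"
  unfolding chain_dim_def by (simp add: prod_pos)

lemma site_op_hom:
  assumes "n \<in> {1..N}"
  shows "site_op N ts n \<in> alg_hom (End_alg (ts n + 1)) (End_alg (chain_dim N ts))"
proof -
  let ?a = "\<Prod>k\<in>{n+1..N}. ts k + 1" and ?b = "\<Prod>k\<in>{1..<n}. ts k + 1" and ?t = "ts n + 1"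
  have d: "chain_dim N ts = ?a * (?t * ?b)" by (rule chain_dim_split[OF assms])
  have one: "1\<^sub>m ?a \<in> carrier_mat ?a ?a" "1\<^sub>m ?b \<in> carrier_mat ?b ?b" by auto
  have kc: "kr X (1\<^sub>m ?b) \<in> carrier_mat (?t * ?b) (?t * ?b)" if "X \<in> carrier_mat ?t ?t" for X
    by (rule kr_dim[OF that one(2)])
  show ?thesis
  proof (rule alg_homI; unfold End_simps site_op_def d)
    show "kr (1\<^sub>m ?a) (kr (1\<^sub>m ?t) (1\<^sub>m ?b)) = 1\<^sub>m (?a * (?t * ?b))" by (simp only: kr_one)
    fix X :: "complex mat" assume X: "X \<in> carrier_mat ?t ?t"
    show "kr (1\<^sub>m ?a) (kr X (1\<^sub>m ?b)) \<in> carrier_mat (?a * (?t * ?b)) (?a * (?t * ?b))"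
      by (rule kr_dim[OF one(1) kc[OF X]])
    show "kr (1\<^sub>m ?a) (kr (c \<cdot>\<^sub>m X) (1\<^sub>m ?b)) = c \<cdot>\<^sub>m kr (1\<^sub>m ?a) (kr X (1\<^sub>m ?b))" for c
      using kr_smult_left[OF X one(2)] kr_smult_right[OF one(1) kc[OF X]] by simp
    fix Y :: "complex mat" assume Y: "Y \<in> carrier_mat ?t ?t"
    show "kr (1\<^sub>m ?a) (kr (X * Y) (1\<^sub>m ?b)) = kr (1\<^sub>m ?a) (kr X (1\<^sub>m ?b)) * kr (1\<^sub>m ?a) (kr Y (1\<^sub>m ?b))"
      using kr_mult[OF X Y one(2) one(2)] kr_mult[OF one(1) one(1) kc[OF X] kc[OF Y]] by simp
    show "kr (1\<^sub>m ?a) (kr (X + Y) (1\<^sub>m ?b)) = kr (1\<^sub>m ?a) (kr X (1\<^sub>m ?b)) + kr (1\<^sub>m ?a) (kr Y (1\<^sub>m ?b))"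
      using kr_add_left[OF X Y one(2)] kr_add_right[OF one(1) kc[OF X] kc[OF Y]] by simp
  qed
qed

text \<open>With \<open>m < n\<close>, both operators are of the form \<open>1 \<otimes> _\<close>, and inside they act on different tensor factors.\<close>

lemma site_op_commute_less:
  assumes mn: "m \<in> {1..N}" "n \<in> {1..N}" "m < n"
    and X: "X \<in> carrier_mat (ts n + 1) (ts n + 1)" and Y: "Y \<in> carrier_mat (ts m + 1) (ts m + 1)"
  shows "site_op N ts n X * site_op N ts m Y = site_op N ts m Y * site_op N ts n X"
proof -
  let ?P = "\<lambda>A. \<Prod>k\<in>A. ts k + 1"
  let ?a = "?P {n+1..N}" and ?b = "?P {1..<n}" and ?t = "ts n + 1" and ?c = "?P {m+1..<n}"
    and ?t' = "ts m + 1" and ?b' = "?P {1..<m}"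
  have "{m+1..N} = {n+1..N} \<union> ({n} \<union> {m+1..<n})" using mn by auto
  then have a': "?P {m+1..N} = ?a * (?t * ?c)" by (simp only:) (rule prod_split_at; auto)
  have "{1..<n} = {m+1..<n} \<union> ({m} \<union> {1..<m})" using mn by auto
  then have b: "?b = ?c * (?t' * ?b')" by (simp only:) (rule prod_split_at; auto)
  define Z where "Z = kr (1\<^sub>m ?c) (kr Y (1\<^sub>m ?b'))"
  have Z: "Z \<in> carrier_mat ?b ?b" unfolding Z_def b using Y by (intro kr_dim one_carrier_mat)
  have sm: "site_op N ts m Y = kr (1\<^sub>m ?a) (kr (1\<^sub>m ?t) Z)"
    unfolding site_op_def a' Z_def by (simp only: kr_one[symmetric] kr_assoc)
  have sn: "site_op N ts n X = kr (1\<^sub>m ?a) (kr X (1\<^sub>m ?b))" by (simp only: site_op_def)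
  have one: "1\<^sub>m ?a \<in> carrier_mat ?a ?a" "1\<^sub>m ?b \<in> carrier_mat ?b ?b" "1\<^sub>m ?t \<in> carrier_mat ?t ?t" by auto
  have c: "kr X (1\<^sub>m ?b) \<in> carrier_mat (?t * ?b) (?t * ?b)" "kr (1\<^sub>m ?t) Z \<in> carrier_mat (?t * ?b) (?t * ?b)"
    by (rule kr_dim[OF X one(2)], rule kr_dim[OF one(3) Z])
  show ?thesis
    unfolding sm sn kr_mult[OF one(1) one(1) c] kr_mult[OF one(1) one(1) c(2) c(1)]
      kr_mult[OF X one(3) one(2) Z] kr_mult[OF one(3) X Z one(2)]
    using X Z by simp
qed

lemma site_op_commute:
  assumes "m \<in> {1..N}" "n \<in> {1..N}" "m \<noteq> n"
    and "X \<in> carrier_mat (ts n + 1) (ts n + 1)" "Y \<in> carrier_mat (ts m + 1) (ts m + 1)"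
  shows "site_op N ts n X * site_op N ts m Y = site_op N ts m Y * site_op N ts n X"
  using assms site_op_commute_less[of m N n X ts Y] site_op_commute_less[of n N m Y ts X] by (metis nat_neq_iff)

section \<open>The spin representations\<close>

lemma bl_scl_inj:
  assumes X: "X \<in> carrier_mat m m" and Y: "Y \<in> carrier_mat m m"
    and e: "bl cst m m 0 0 X = bl cst m m 0 0 Y"
  shows "X = Y"
proof (rule eq_matI)
  fix i j assume "i < dim_row Y" "j < dim_col Y"
  then have ij: "i < m" "j < m" using Y by auto
  let ?x = "\<lambda>(a::nat, s::nat). if a = j then 1 else 0 :: complex"
  have "app (bl cst m m 0 0 M) ?x (i, 0) = M $$ (i, j)" for M
    unfolding app_bl_scl using ij by (simp add: if_distrib cong: if_cong)
  from this[of X] this[of Y] e show "X $$ (i, j) = Y $$ (i, j)" by simp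
qed (use X Y in auto)

lemma bl_scl_ops:
  assumes X: "X \<in> carrier_mat m m" and Y: "Y \<in> carrier_mat m m"
  shows "bl cst m m 0 0 (X * Y) = bl cst m m 0 0 X * bl cst m m 0 0 Y"
    "bl cst m m 0 0 (X + Y) = bl cst m m 0 0 X + bl cst m m 0 0 Y"
    "bl cst m m 0 0 (c \<cdot>\<^sub>m X) = c \<cdot>\<^sub>C bl cst m m 0 0 X"
    "bl cst m m 0 0 (1\<^sub>m m) = Pr m"
proof -
  have "bl cst m m 0 0 X * bl cst m m 0 0 Y
      = (\<Sum>i<m. \<Sum>j<m. (\<Sum>l<m. X $$ (0 + i, 0 + l) \<cdot>\<^sub>C 1 * Y $$ (0 + l, 0 + j) \<cdot>\<^sub>C 1) * un i j)"
    unfolding bl_def by (rule un_sum_mult) (rule quantum_scl_one)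
  also have "\<dots> = bl cst m m 0 0 (X * Y)"
  proof -
    have s: "(\<Sum>l<m. f l \<cdot>\<^sub>C (1::aop)) = (\<Sum>l<m. f l) \<cdot>\<^sub>C 1" for f
      by (induction m) (simp_all add: scl_distrib)
    have p: "(X * Y) $$ (i, j) = (\<Sum>l<m. X $$ (i, l) * Y $$ (l, j))" if "i < m" "j < m" for i j
      using that X Y by (auto simp: scalar_prod_def lessThan_atLeast0 intro!: sum.cong)
    show ?thesis unfolding bl_def
      by (intro sum.cong refl arg_cong2[where f = "(*)"]) (simp add: s p mult.commute)
  qed
  finally show "bl cst m m 0 0 (X * Y) = bl cst m m 0 0 X * bl cst m m 0 0 Y" ..
  show "bl cst m m 0 0 (X + Y) = bl cst m m 0 0 X + bl cst m m 0 0 Y"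
    unfolding bl_def sum.distrib[symmetric] using X Y by (intro sum.cong refl) (auto simp: scl_distrib distrib_right)
  show "bl cst m m 0 0 (c \<cdot>\<^sub>m X) = c \<cdot>\<^sub>C bl cst m m 0 0 X"
    unfolding bl_def scl_sum using X by (intro sum.cong refl) auto
  show "bl cst m m 0 0 (1\<^sub>m m) = Pr m"
  proof (rule aop_eqI)
    fix x :: "nat \<times> nat \<Rightarrow> complex" and a s
    have "app (bl cst m m 0 0 (1\<^sub>m m)) x (a, s) = (if a < m then \<Sum>j<m. (if a = j then 1 else 0) * x (j, s) else 0)"
      unfolding app_bl_scl by (auto intro!: sum.cong)
    then show "app (bl cst m m 0 0 (1\<^sub>m m)) x (a, s) = app (Pr m) x (a, s)"
      by (simp add: Pr_def if_distrib[of "\<lambda>z. z * _"] cong: if_cong)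
  qed
qed

context qparam begin

lemma spin_mats_carrier:
  "S_plus q n \<in> carrier_mat (Suc n) (Suc n)" "S_minus q n \<in> carrier_mat (Suc n) (Suc n)" "K_power_mat h s n \<in> carrier_mat (Suc n) (Suc n)"
  by (rule carrier_matI; simp add: S_plus_def S_minus_def K_power_mat_def)+

text \<open>The spin matrices satisfy the relations of \<open>U\<^sub>qsl\<^sub>2\<close>, because the spin operators without cutoff do.\<close>

lemma spin_mats_rels:
  fixes n :: nat
  defines "E \<equiv> S_plus q n" and "F \<equiv> S_minus q n" and "K \<equiv> K_power_mat h 1 n" and "Ki \<equiv> K_power_mat h (- 1) n"
  shows "K * Ki = 1\<^sub>m (Suc n)" "Ki * K = 1\<^sub>m (Suc n)" "K * E = q \<cdot>\<^sub>m (E * K)" "K * F = inverse q \<cdot>\<^sub>m (F * K)"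
    "E * F = F * E + inverse dlt \<cdot>\<^sub>m (K * K + (-1) \<cdot>\<^sub>m (Ki * Ki))"
proof -
  let ?m = "Suc n"
  let ?B = "bl cst ?m ?m 0 0"
  let ?P = "Pr ?m"
  have cc: "E \<in> carrier_mat ?m ?m" "F \<in> carrier_mat ?m ?m" "K \<in> carrier_mat ?m ?m" "Ki \<in> carrier_mat ?m ?m"
    unfolding E_def F_def K_def Ki_def by (rule spin_mats_carrier)+
  note mc = mult_carrier_mat[of _ ?m ?m _ ?m]
  have b: "?B E = Sp n * ?P" "?B F = Sm n * ?P" "?B K = kap n 1 * ?P" "?B Ki = kap n (- 1) * ?P"
    unfolding E_def F_def K_def Ki_def by (rule bl_S_plus bl_S_minus bl_K_power)+
  have mul: "?B (X * Y) = (x * y) * ?P"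
    if "X \<in> carrier_mat ?m ?m" "Y \<in> carrier_mat ?m ?m" "?B X = x * ?P" "?B Y = y * ?P" "y * ?P = ?P * y" for X Y x y
  proof -
    have "?B (X * Y) = x * (?P * y) * ?P" using that(3,4) by (simp add: bl_scl_ops(1)[OF that(1,2)] mult.assoc)
    then show ?thesis unfolding that(5)[symmetric] by (simp add: mult.assoc)
  qed
  have B: "?B (K * Ki) = (kap n 1 * kap n (- 1)) * ?P" "?B (Ki * K) = (kap n (- 1) * kap n 1) * ?P"
    "?B (K * E) = (kap n 1 * Sp n) * ?P" "?B (E * K) = (Sp n * kap n 1) * ?P"
    "?B (K * F) = (kap n 1 * Sm n) * ?P" "?B (F * K) = (Sm n * kap n 1) * ?P"
    "?B (E * F) = (Sp n * Sm n) * ?P" "?B (F * E) = (Sm n * Sp n) * ?P"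
    "?B (K * K) = (kap n 1 * kap n 1) * ?P" "?B (Ki * Ki) = (kap n (- 1) * kap n (- 1)) * ?P"
    by (rule mul; (rule cc b Sp_Pr Sm_Pr kap_Pr))+
  note r = Uq_quadD[OF Uq_quad_spin[of n]]
  note sm = bl_scl_ops(3)[of _ ?m "1\<^sub>m ?m", OF _ one_carrier_mat]
  have one: "?B (1\<^sub>m ?m) = ?P" by (rule bl_scl_ops(4)[OF one_carrier_mat one_carrier_mat])
  show "K * Ki = 1\<^sub>m ?m" by (rule bl_scl_inj[OF mc[OF cc(3,4)] one_carrier_mat]) (simp only: B one r mult_1)
  show "Ki * K = 1\<^sub>m ?m" by (rule bl_scl_inj[OF mc[OF cc(4,3)] one_carrier_mat]) (simp only: B one r mult_1)
  show "K * E = q \<cdot>\<^sub>m (E * K)"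
    by (rule bl_scl_inj[OF mc[OF cc(3,1)] smult_carrier_mat[OF mc[OF cc(1,3)]]])
      (simp only: B sm[OF mc[OF cc(1,3)]] r(3) scl_simps)
  show "K * F = inverse q \<cdot>\<^sub>m (F * K)"
    by (rule bl_scl_inj[OF mc[OF cc(3,2)] smult_carrier_mat[OF mc[OF cc(2,3)]]])
      (simp only: B sm[OF mc[OF cc(2,3)]] r(4) scl_simps)
  let ?D = "K * K + (-1) \<cdot>\<^sub>m (Ki * Ki)"
  have D: "?D \<in> carrier_mat ?m ?m" using cc by auto
  have BD: "?B ?D = (kap n 1 * kap n 1 - kap n (- 1) * kap n (- 1)) * ?P"
    unfolding bl_scl_ops(2)[OF mc[OF cc(3,3)] smult_carrier_mat[OF mc[OF cc(4,4)]]] sm[OF mc[OF cc(4,4)]] B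
    by (simp add: scl_minus left_diff_distrib)
  show "E * F = F * E + inverse dlt \<cdot>\<^sub>m ?D"
  proof (rule bl_scl_inj[OF mc[OF cc(1,2)]])
    show "F * E + inverse dlt \<cdot>\<^sub>m ?D \<in> carrier_mat ?m ?m" using D mc[OF cc(2,1)] by auto
    show "?B (E * F) = ?B (F * E + inverse dlt \<cdot>\<^sub>m ?D)"
      unfolding bl_scl_ops(2)[OF mc[OF cc(2,1)] smult_carrier_mat[OF D]] sm[OF D] B BD r(7)
      by (simp add: distrib_right)
  qed
qed

lemma spin_rep_hom: "spin_rep h n \<in> alg_hom (Uq q) (End_alg (n + 1))"
  and spin_rep_gen: "spin_rep h n (Uq_gen q g) = spin_rep_gen h n g"
proof -
  let ?f = "spin_rep_gen h n" and ?d = "n + 1"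
  have c: "?f g \<in> carrier_mat ?d ?d" for g
    by (cases g) (use spin_mats_carrier in \<open>auto simp: q_h\<close>)
  have hom: "free_eval (End_alg ?d) ?f \<in> alg_hom free_alg (End_alg ?d)"
    by (rule free_eval_hom) (use c in auto)
  have fg: "free_eval (End_alg ?d) ?f (gen g) = ?f g" for g
  proof (rule qm_inj[of _ ?d])
    show "qm ?d (free_eval (End_alg ?d) ?f (gen g)) = qm ?d (?f g)"
      by (subst free_eval_End) (use c in \<open>auto simp: gen_def opev_single\<close>)
  qed (use free_eval_End(1)[of ?f ?d] c in auto)
  have fc: "free_eval (End_alg ?d) ?f (const z * p) = z \<cdot>\<^sub>m free_eval (End_alg ?d) ?f p" for z p
    using alg_homD(5)[OF hom, of p z] by (simp add: free_alg_def)
  have fm: "free_eval (End_alg ?d) ?f (p * r) = free_eval (End_alg ?d) ?f p * free_eval (End_alg ?d) ?f r"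
    and fa: "free_eval (End_alg ?d) ?f (p + r) = free_eval (End_alg ?d) ?f p + free_eval (End_alg ?d) ?f r"
    and f1: "free_eval (End_alg ?d) ?f 1 = 1\<^sub>m ?d" for p r
    using alg_homD(2-4)[OF hom] by (simp_all add: free_alg_def)
  have m1: "p - r = p + const (-1) * r" for p r :: "uq_gen free"
  proof -
    have c1: "const 1 = (1 :: uq_gen free)" by (simp add: const_def flip: zero_list_def)
    have "const (-1) = (- const 1 :: uq_gen free)" by (simp add: const_def single_uminus)
    then have "const (-1) * r = - r" unfolding c1 by simp
    then show ?thesis by simp
  qed
  have cf: "free_eval (End_alg ?d) ?f p \<in> carrier_mat ?d ?d" for p
    using alg_homD(1)[OF hom, of p] by (simp add: free_alg_def)
  define ev where "ev = free_eval (End_alg ?d) ?f"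
  have fmg: "ev (gen g * p) = ?f g * ev p" for g p unfolding ev_def fm fg ..
  note ev = fc[folded ev_def] fmg fa[folded ev_def] f1[folded ev_def] fg[folded ev_def]
  note rel = spin_mats_rels[of n]
  have kill: "ev s = \<zero>\<^bsub>End_alg ?d\<^esub>" if "s \<in> Uq_rels q" for s
  proof -
    have z: "X + (-1) \<cdot>\<^sub>m X = 0\<^sub>m ?d ?d" if "X \<in> carrier_mat ?d ?d" for X :: "complex mat"
      using that by (intro eq_matI) auto
    have eq: "ev (a - b) = 0\<^sub>m ?d ?d" if "ev a = ev b" for a b
      unfolding m1 ev that by (rule z[OF cf[folded ev_def]])
    have "ev (gen UK * gen UKi - 1) = 0\<^sub>m ?d ?d"
      "ev (gen UKi * gen UK - 1) = 0\<^sub>m ?d ?d"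
      "ev (gen UK * gen UE - const q * gen UE * gen UK) = 0\<^sub>m ?d ?d"
      "ev (gen UK * gen UF - const (inverse q) * gen UF * gen UK) = 0\<^sub>m ?d ?d"
      "ev (gen UE * gen UF - (gen UF * gen UE + const (inverse (q - inverse q)) * (gen UK * gen UK - gen UKi * gen UKi))) = 0\<^sub>m ?d ?d"
      by (rule eq, simp add: ev m1 mult.assoc rel[unfolded dlt_def] q_h)+
    then show ?thesis using that
      by (auto simp: Uq_rels_def diff_diff_eq)
  qed
  have S: "Uq_rels q \<subseteq> carrier free_alg" by (simp add: free_alg_def)
  note fac = hom_factor[OF calg_free S hom calgD(1)[OF calg_End] kill[unfolded ev_def]]
  show "spin_rep h n \<in> alg_hom (Uq q) (End_alg (n + 1))"
    using fac(1) by (simp add: spin_rep_def[abs_def] induced_hom_def[abs_def] Uq_def)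
  show "spin_rep h n (Uq_gen q g) = spin_rep_gen h n g"
    using fac(2)[of "gen g"] fg[of g] by (simp add: spin_rep_def induced_hom_def Uq_gen_def free_alg_def)
qed

end

section \<open>Fused Lax operators\<close>

lemma calg_Uq: "calg (Uq q)"
  unfolding Uq_def by (rule quot_alg_calg[OF calg_free]) (simp add: free_alg_def)

lemma Uq_gen_carrier: "Uq_gen q g \<in> carrier (Uq q)"
  unfolding Uq_gen_def Uq_def
  by (subst quot_alg_carrier[OF calg_free]) (auto simp: free_alg_def)

lemma Lax_half_dims: "dim_row (Lax_half h u) = 2" "dim_col (Lax_half h u) = 2"
  by (simp_all add: Lax_half_def Let_def mat_of_rows_list_def)

lemma Lax_half_in: "mat_in (Uq (h\<^sup>2)) (Lax_half h u)"
proof -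
  interpret ring "Uq (h\<^sup>2)" using calg_Uq by (rule calgD)
  note c = Uq_gen_carrier[of "h\<^sup>2"] and s = calgD(2)[OF calg_Uq]
  show ?thesis
    unfolding mat_in_def Lax_half_dims
  proof (intro allI impI)
    fix i j :: nat assume "i < 2" "j < 2"
    then show "Lax_half h u $$ (i, j) \<in> carrier (Uq (h\<^sup>2))"
      by (auto simp: Lax_half_def Let_def mat_of_rows_list_def less_2_cases_iff intro!: minus_closed s c)
  qed
qed

text \<open>A representation of \<open>U\<^sub>qsl\<^sub>2\<close> by quantum operators.\<close>

locale Lax_rep = qparam q h for q h :: complex +
  fixes \<phi> :: "uq_gen free set \<Rightarrow> aop"
  assumes phi_hom: "\<phi> \<in> alg_hom (Uq q) op_alg" and phi_qnt: "\<And>x. x \<in> carrier (Uq q) \<Longrightarrow> quantum (\<phi> x)"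
begin

sublocale R: op_rep_q "Uq q" \<phi> q h
  by unfold_locales (rule calg_Uq phi_hom phi_qnt; assumption)+

lemma Lax_half_phi: "\<phi> (Lax_half h u $$ (of_bool i, of_bool j))
    = lax (\<phi> (Uq_gen q UE)) (\<phi> (Uq_gen q UF)) (\<phi> (Uq_gen q UK)) (\<phi> (Uq_gen q UKi)) u i j"
proof -
  note c = Uq_gen_carrier[of q] and s = calgD(2)[OF calg_Uq]
  have m: "\<phi> (x \<ominus>\<^bsub>Uq q\<^esub> y) = \<phi> x - \<phi> y" if "x \<in> carrier (Uq q)" "y \<in> carrier (Uq q)" for x y
    using alg_hom_a_minus[OF phi_hom calgD(1)[OF calg_Uq] calgD(1)[OF calg_op] that] by (simp add: a_minus_op)
  show ?thesis
    by (auto simp: Lax_half_def Let_def mat_of_rows_list_def lax_def q_h m s c R.phi dlt_def)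
qed

lemma bl_Lax:
  "mat_in (Uq q) (Lax h n u) \<and> dim_row (Lax h n u) = Suc n \<and> dim_col (Lax h n u) = Suc n
    \<and> bl \<phi> (Suc n) (Suc n) 0 0 (Lax h n u)
      = fuseL (lax (\<phi> (Uq_gen q UE)) (\<phi> (Uq_gen q UF)) (\<phi> (Uq_gen q UK)) (\<phi> (Uq_gen q UKi))) n u"
proof (induction n arbitrary: u)
  case 0
  have "Pr 1 = un 0 0" by (auto intro!: aop_eqI simp: Pr_def)
  then show ?case by (simp add: R.mat_in_id bl_def q_h) (simp add: id_mat_def R.phi)
next
  case (Suc n u)
  let ?s = "Suc n" and ?A = "Uq q"
  let ?F = "scalar_mat ?A (fuse_F q (Suc n))"
  let ?K1 = "kron ?A (Lax_half h (u * h powi (- int n))) (id_mat ?A (Suc n))"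
  let ?K2 = "kron ?A (id_mat ?A 2) (Lax h n (u * h))"
  let ?E = "scalar_mat ?A (fuse_E q (Suc n))"
  note IH = Suc.IH[of "u * h"]
  have fd: "dim_row (fuse_F q (Suc n)) = n + 2" "dim_col (fuse_F q (Suc n)) = 2 * Suc n"
    "dim_row (fuse_E q (Suc n)) = 2 * Suc n" "dim_col (fuse_E q (Suc n)) = n + 2"
    by (simp_all add: fuse_F_def fuse_E_def)
  have d: "dim_row ?F = n + 2" "dim_col ?F = 2 * ?s" "dim_row ?K1 = 2 * ?s" "dim_col ?K1 = 2 * ?s"
    "dim_row ?K2 = 2 * ?s" "dim_col ?K2 = 2 * ?s"
    "dim_row ?E = 2 * ?s" "dim_col ?E = n + 2"
    using IH by (simp_all add: fd Lax_half_dims)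
  have m: "mat_in ?A ?F" "mat_in ?A ?K1" "mat_in ?A ?K2" "mat_in ?A ?E"
    using IH Lax_half_in[of h] by (auto intro: R.mat_in_kron R.mat_in_id R.mat_in_scalar simp: q_h)
  have m2: "mat_in ?A (?F \<star>\<^bsub>?A\<^esub> ?K1)" by (rule R.mat_in_mult[OF m(1,2)]) (simp only: d)
  have m3: "mat_in ?A (?F \<star>\<^bsub>?A\<^esub> ?K1 \<star>\<^bsub>?A\<^esub> ?K2)" by (rule R.mat_in_mult[OF m2 m(3)]) (simp only: d mat_dims(1,2))
  have m4: "mat_in ?A (?F \<star>\<^bsub>?A\<^esub> ?K1 \<star>\<^bsub>?A\<^esub> ?K2 \<star>\<^bsub>?A\<^esub> ?E)" by (rule R.mat_in_mult[OF m3 m(4)]) (simp only: d mat_dims(1,2))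
  have o: "off ?s p + ?s \<le> 2 * ?s" for p by (simp add: off_def)
  have bF: "bl \<phi> (n + 2) ?s 0 (off ?s i) ?F = Fop n i" for i
    by (subst R.bl_scalar) (simp_all only: fd o add_0 order_refl bl_fuse_F)
  have bE: "bl \<phi> ?s (n + 2) (off ?s i) 0 ?E = Eop n i" for i
    by (subst R.bl_scalar) (simp_all only: fd o add_0 order_refl bl_fuse_E)
  have bK1: "bl \<phi> ?s ?s (off ?s i) (off ?s j) ?K1 = \<phi> (Lax_half h (u * h powi (- int n)) $$ (of_bool i, of_bool j)) * Pr ?s" for i j
    using Lax_half_in[of h] by (intro R.bl_kron_id Lax_half_dims) (simp add: q_h)
  have bK2: "bl \<phi> ?s ?s (off ?s i) (off ?s j) ?K2 = (if i = j then bl \<phi> ?s ?s 0 0 (Lax h n (u * h)) else 0)" for i j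
    using IH by (intro R.bl_id_kron) auto
  have "bl \<phi> (n + 2) (n + 2) 0 0 (?F \<star>\<^bsub>?A\<^esub> ?K1 \<star>\<^bsub>?A\<^esub> ?K2 \<star>\<^bsub>?A\<^esub> ?E)
    = (\<Sum>m\<in>UNIV. (\<Sum>l\<in>UNIV. (\<Sum>i\<in>UNIV. bl \<phi> (n + 2) ?s 0 (off ?s i) ?F * bl \<phi> ?s ?s (off ?s i) (off ?s l) ?K1)
        * bl \<phi> ?s ?s (off ?s l) (off ?s m) ?K2) * bl \<phi> ?s (n + 2) (off ?s m) 0 ?E)"
  proof -
    have "bl \<phi> (n + 2) ?s 0 (off ?s l) (?F \<star>\<^bsub>?A\<^esub> ?K1) = (\<Sum>i\<in>UNIV. bl \<phi> (n + 2) ?s 0 (off ?s i) ?F * bl \<phi> ?s ?s (off ?s i) (off ?s l) ?K1)" for l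
      by (rule R.bl_mult2[OF m(1) m(2)]) (simp_all only: d o add_0 order_refl)
    moreover have "bl \<phi> (n + 2) ?s 0 (off ?s r) (?F \<star>\<^bsub>?A\<^esub> ?K1 \<star>\<^bsub>?A\<^esub> ?K2) = (\<Sum>l\<in>UNIV. bl \<phi> (n + 2) ?s 0 (off ?s l) (?F \<star>\<^bsub>?A\<^esub> ?K1) * bl \<phi> ?s ?s (off ?s l) (off ?s r) ?K2)" for r
      by (rule R.bl_mult2[OF m2 m(3)]) (simp_all only: mat_dims(1,2) d o add_0 order_refl)
    moreover have "bl \<phi> (n + 2) (n + 2) 0 0 (?F \<star>\<^bsub>?A\<^esub> ?K1 \<star>\<^bsub>?A\<^esub> ?K2 \<star>\<^bsub>?A\<^esub> ?E) = (\<Sum>l\<in>UNIV. bl \<phi> (n + 2) ?s 0 (off ?s l) (?F \<star>\<^bsub>?A\<^esub> ?K1 \<star>\<^bsub>?A\<^esub> ?K2) * bl \<phi> ?s (n + 2) (off ?s l) 0 ?E)"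
      by (rule R.bl_mult2[OF m3 m(4)]) (simp_all only: mat_dims(1,2) d o add_0 order_refl)
    ultimately show ?thesis by (simp only:)
  qed
  also have "\<dots> = fuseL (lax (\<phi> (Uq_gen q UE)) (\<phi> (Uq_gen q UF)) (\<phi> (Uq_gen q UK)) (\<phi> (Uq_gen q UKi))) (Suc n) u"
  proof -
    let ?L = "lax (\<phi> (Uq_gen q UE)) (\<phi> (Uq_gen q UF)) (\<phi> (Uq_gen q UK)) (\<phi> (Uq_gen q UKi))"
    have P: "Pr ?s * (fuseL ?L n w * z) = fuseL ?L n w * z" for w z
      by (simp add: mult.assoc[symmetric])
    have T: "bl \<phi> ?s ?s 0 0 (Lax h n (u * h)) = fuseL ?L n (u * h)" using IH by blast
    show ?thesis
      unfolding bF bE bK1 bK2 T Lax_half_phi fuseL.simps(2)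
      by (simp only: sum_bool mult.assoc P distrib_left distrib_right simp_thms if_True if_False mult_zero_left mult_zero_right add_0_left add_0_right add_ac)
  qed
  finally show ?case using m4 d by (simp add: Let_def q_h)
qed

end

section \<open>The algebras of the spin chain\<close>

lemma calg_Aq: "calg (Aq q r)"
  unfolding Aq_def by (rule quot_alg_calg[OF calg_free]) (simp add: free_alg_def)

lemma Aq_gen_carrier: "Aq_gen q r g \<in> carrier (Aq q r)"
  unfolding Aq_gen_def Aq_def
  by (subst quot_alg_carrier[OF calg_free]) (auto simp: free_alg_def)

lemma AqN_rels_carrier: "AqN_rels q r N d eP eM \<subseteq> carrier (Aq q r)"
proof -
  interpret ring "Aq q r" using calg_Aq by (rule calgD)
  note s = calgD(2)[OF calg_Aq] and g = Aq_gen_carrier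
  show ?thesis
    unfolding AqN_rels_def Let_def by (auto intro!: a_closed finsum_closed s g)
qed

lemma calg_AqN: "calg (AqN q r N d eP eM)"
  unfolding AqN_def by (rule quot_alg_calg[OF calg_Aq AqN_rels_carrier])

lemma AqN_gen_carrier: "AqN_gen q r N d eP eM g \<in> carrier (AqN q r N d eP eM)"
  unfolding AqN_gen_def AqN_def
  using quot_alg_carrier[OF calg_Aq AqN_rels_carrier] Aq_gen_carrier by blast

lemma KN_half_dims: "dim_row (KN_half q kp km N d eP eM u) = 2" "dim_col (KN_half q kp km N d eP eM u) = 2"
  by (simp_all add: KN_half_def Let_def mat_of_rows_list_def)

lemma KN_half_in: "mat_in (AqN q (rho_par q kp km) N d eP eM) (KN_half q kp km N d eP eM u)"
proof -
  interpret ring "AqN q (rho_par q kp km) N d eP eM" using calg_AqN by (rule calgD)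
  note s = calgD(2)[OF calg_AqN] and g = AqN_gen_carrier
  show ?thesis
    unfolding mat_in_def KN_half_dims
  proof (intro allI impI)
    fix i j :: nat assume "i < 2" "j < 2"
    then show "KN_half q kp km N d eP eM u $$ (i, j) \<in> carrier (AqN q (rho_par q kp km) N d eP eM)"
      by (auto simp: KN_half_def Let_def mat_of_rows_list_def less_2_cases_iff
          intro!: minus_closed a_closed finsum_closed one_closed s g)
  qed
qed

section \<open>The dressed K-matrices as operators\<close>

lemma sum_lessThan_2: "(\<Sum>l<2. g l) = (\<Sum>l\<in>UNIV. g (of_bool l))" for g :: "nat \<Rightarrow> 'a::comm_monoid_add"
  by (simp add: numeral_2_eq_2 sum_bool)

lemma of_bool_less_2 [simp]: "of_bool b < (2::nat)"
  by simp

lemma op_rep_End: "d > 0 \<Longrightarrow> op_rep (End_alg d) (qm d)"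
  by unfold_locales (simp_all add: calg_End qm_hom quantum_qm)

text \<open>A matrix over the endomorphisms can be recovered from its operator.\<close>

lemma bl_qm_inj:
  assumes "dim_row X = m" "dim_col X = m" "dim_row Y = m" "dim_col Y = m"
    and "mat_in (End_alg d) X" "mat_in (End_alg d) Y"
    and e: "bl (qm d) m m 0 0 X = bl (qm d) m m 0 0 Y"
  shows "X = Y"
proof (rule eq_matI)
  fix i j assume "i < dim_row Y" "j < dim_col Y"
  then have ij: "i < m" "j < m" using assms by auto
  have ent: "un 0 i * bl (qm d) m m 0 0 Z * un j 0 = qm d (Z $$ (i, j)) * un 0 0" for Z
  proof -
    have c: "un 0 i * (qm d M * z) = qm d M * (un 0 i * z)" for M z
      using quantum_qm[of d M] by (simp add: quantum_def mult.assoc[symmetric])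
    have "un 0 i * bl (qm d) m m 0 0 Z * un j 0
        = (\<Sum>i'<m. \<Sum>j'<m. if i = i' then if j' = j then qm d (Z $$ (i', j')) * un 0 0 else 0 else 0)"
      unfolding bl_def sum_distrib_left sum_distrib_right
      by (intro sum.cong refl) (simp add: mult.assoc c un_mult)
    also have "\<dots> = (\<Sum>i'<m. if i = i' then \<Sum>j'<m. if j' = j then qm d (Z $$ (i', j')) * un 0 0 else 0 else 0)"
      by (intro sum.cong refl) simp
    also have "\<dots> = qm d (Z $$ (i, j)) * un 0 0" using ij by simp
    finally show ?thesis .
  qed
  have c: "X $$ (i, j) \<in> carrier_mat d d" "Y $$ (i, j) \<in> carrier_mat d d"
    using assms(1-6) ij by (auto simp: mat_in_def)
  show "X $$ (i, j) = Y $$ (i, j)"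
  proof (rule eq_matI)
    fix a b assume "a < dim_row (Y $$ (i, j))" "b < dim_col (Y $$ (i, j))"
    then have ab: "a < d" "b < d" using c by auto
    let ?x = "\<lambda>p::nat \<times> nat. if snd p = b then 1 else 0 :: complex"
    have "app (qm d M * un 0 0) ?x (0, a) = M $$ (a, b)" for M
    proof -
      have "app (qm d M * un 0 0) ?x (0, a) = (\<Sum>r<d. M $$ (a, r) * (if r = b then 1 else 0))"
        using ab by simp
      also have "\<dots> = (\<Sum>r<d. if r = b then M $$ (a, r) else 0)" by (intro sum.cong refl) simp
      finally show ?thesis using ab by simp
    qed
    from this[of "X $$ (i, j)"] this[of "Y $$ (i, j)"] show "X $$ (i, j) $$ (a, b) = Y $$ (i, j) $$ (a, b)"
      unfolding ent[symmetric] e by simp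
  qed (use c in auto)
qed (use assms in auto)

text \<open>The parameters of the spin chain. No condition is imposed on the spins; the inhomogeneities have to be
nonzero only where this is assumed explicitly.\<close>

locale spin_chain = qparam q h for q h :: complex +
  fixes kp km ep em :: complex and N :: nat and ts :: "nat \<Rightarrow> nat" and v :: "nat \<Rightarrow> complex"
begin

abbreviation D :: nat where "D \<equiv> chain_dim N ts"

text \<open>The spin representation at site \<open>s\<close>, in the ring of operators, with its Lax matrix \<open>Ls\<close>; and the scalar
K-matrix \<open>Ks\<close>.\<close>

definition site_rep :: "nat \<Rightarrow> uq_gen free set \<Rightarrow> aop" where
  "site_rep s x = qm D (site_op N ts s (spin_rep h (ts s) x))"

definition Ls :: "nat \<Rightarrow> complex \<Rightarrow> bool \<Rightarrow> bool \<Rightarrow> aop" where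
  "Ls s = lax (site_rep s (Uq_gen q UE)) (site_rep s (Uq_gen q UF)) (site_rep s (Uq_gen q UK)) (site_rep s (Uq_gen q UKi))"

definition Ks :: "complex \<Rightarrow> bool \<Rightarrow> bool \<Rightarrow> aop" where
  "Ks u i j = kmat kp km ep em u i j \<cdot>\<^sub>C 1"

lemma D_pos: "D > 0" by (rule chain_dim_pos)

sublocale Q: op_rep_q "End_alg D" "qm D" q h
  using op_rep_End[OF D_pos] qparam_axioms by (simp add: op_rep_q_def)

lemma Lax_rep_site:
  assumes "s \<in> {1..N}" shows "Lax_rep q h (site_rep s)"
proof -
  have "site_rep s \<in> alg_hom (Uq q) op_alg"
    unfolding site_rep_def
    using alg_hom_comp[OF alg_hom_comp[OF spin_rep_hom site_op_hom[OF assms]] qm_hom[OF D_pos]] .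
  then show ?thesis
    by unfold_locales (simp_all add: site_rep_def quantum_qm)
qed

lemma site_quad:
  assumes "s \<in> {1..N}"
  shows "Uq_quad (site_rep s (Uq_gen q UE)) (site_rep s (Uq_gen q UF)) (site_rep s (Uq_gen q UK)) (site_rep s (Uq_gen q UKi))"
proof -
  have hom: "(\<lambda>X. qm D (site_op N ts s X)) \<in> alg_hom (End_alg (ts s + 1)) op_alg"
    using alg_hom_comp[OF site_op_hom[OF assms] qm_hom[OF D_pos]] .
  define g where "g = (\<lambda>X. qm D (site_op N ts s X))"
  let ?m = "Suc (ts s)"
  note H = alg_homD[OF hom[folded g_def], simplified]
  let ?E = "S_plus q (ts s)" and ?F = "S_minus q (ts s)" and ?K = "K_power_mat h 1 (ts s)" and ?Ki = "K_power_mat h (- 1) (ts s)"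
  have c: "?E \<in> carrier_mat ?m ?m" "?F \<in> carrier_mat ?m ?m" "?K \<in> carrier_mat ?m ?m" "?Ki \<in> carrier_mat ?m ?m"
    by (rule spin_mats_carrier)+
  note mc = mult_carrier_mat[of _ ?m ?m _ ?m]
  have e: "site_rep s (Uq_gen q UE) = g ?E" "site_rep s (Uq_gen q UF) = g ?F" "site_rep s (Uq_gen q UK) = g ?K"
    "site_rep s (Uq_gen q UKi) = g ?Ki"
    by (simp_all add: site_rep_def spin_rep_gen g_def q_h)
  note rel = spin_mats_rels[of "ts s"]
  have "g ?K * g ?Ki = 1" "g ?Ki * g ?K = 1"
    using H(3)[OF c(3,4)] H(3)[OF c(4,3)] H(2) unfolding rel by simp_all
  moreover have "g ?K * g ?E = q \<cdot>\<^sub>C (g ?E * g ?K)"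
    using H(3)[OF c(3,1)] H(3)[OF c(1,3)] H(5)[OF mc[OF c(1,3)], of q] unfolding rel by simp
  moreover have "g ?K * g ?F = inverse q \<cdot>\<^sub>C (g ?F * g ?K)"
    using H(3)[OF c(3,2)] H(3)[OF c(2,3)] H(5)[OF mc[OF c(2,3)], of "inverse q"] unfolding rel by simp
  moreover have "g ?E * g ?F - g ?F * g ?E = inverse dlt \<cdot>\<^sub>C (g ?K * g ?K - g ?Ki * g ?Ki)"
  proof -
    let ?X = "?K * ?K + (-1) \<cdot>\<^sub>m (?Ki * ?Ki)"
    have X: "?X \<in> carrier_mat ?m ?m" by (rule add_carrier_mat[OF smult_carrier_mat[OF mc[OF c(4,4)]]])
    have "g ?E * g ?F = g (?E * ?F)" by (rule H(3)[OF c(1,2), symmetric])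
    also have "\<dots> = g (?F * ?E) + inverse dlt \<cdot>\<^sub>C g ?X"
      unfolding rel(5) H(4)[OF mc[OF c(2,1)] smult_carrier_mat[OF X]] H(5)[OF X] ..
    also have "g ?X = g ?K * g ?K - g ?Ki * g ?Ki"
      unfolding H(4)[OF mc[OF c(3,3)] smult_carrier_mat[OF mc[OF c(4,4)]]] H(5)[OF mc[OF c(4,4)]] H(3)[OF c(3,3)] H(3)[OF c(4,4)]
      by (simp add: scl_minus)
    also have "g (?F * ?E) = g ?F * g ?E" by (rule H(3)[OF c(2,1)])
    finally show ?thesis by simp
  qed
  ultimately show ?thesis unfolding e Uq_quad_def by blast
qed

lemma site_quantum: "quantum (site_rep s x)"
  by (simp add: site_rep_def quantum_qm)

lemma spin_rep_carrier: "x \<in> carrier (Uq q) \<Longrightarrow> spin_rep h n x \<in> carrier_mat (n + 1) (n + 1)"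
  using alg_homD(1)[OF spin_rep_hom[of n]] by simp

lemma site_commute:
  assumes "s \<in> {1..N}" "s' \<in> {1..N}" "s \<noteq> s'" "x \<in> carrier (Uq q)" "y \<in> carrier (Uq q)"
  shows "site_rep s x * site_rep s' y = site_rep s' y * site_rep s x"
proof -
  have X: "spin_rep h (ts s) x \<in> carrier_mat (ts s + 1) (ts s + 1)" and Y: "spin_rep h (ts s') y \<in> carrier_mat (ts s' + 1) (ts s' + 1)"
    using assms spin_rep_carrier by auto
  have c: "site_op N ts s (spin_rep h (ts s) x) \<in> carrier_mat D D" "site_op N ts s' (spin_rep h (ts s') y) \<in> carrier_mat D D"
    using alg_homD(1)[OF site_op_hom[OF assms(1)]] alg_homD(1)[OF site_op_hom[OF assms(2)]] X Y by auto
  show ?thesis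
    unfolding site_rep_def qm_mult[OF c D_pos, symmetric] qm_mult[OF c(2,1) D_pos, symmetric]
    by (subst site_op_commute[OF assms(2,1) assms(3)[symmetric] X Y]) simp
qed

lemma Ls_entry: "s \<in> {1..N} \<Longrightarrow> site_rep s (Lax_half h u $$ (of_bool i, of_bool j)) = Ls s u i j"
  unfolding Ls_def by (rule Lax_rep.Lax_half_phi[OF Lax_rep_site])

lemma Ls_commute:
  assumes "s \<in> {1..N}" "s' \<in> {1..N}" "s \<noteq> s'"
  shows "Ls s u i j * Ls s' u' i' j' = Ls s' u' i' j' * Ls s u i j"
proof -
  have "Lax_half h u $$ (of_bool i, of_bool j) \<in> carrier (Uq q)" for u i j
    using Lax_half_in[of h u] by (auto simp: mat_in_def Lax_half_dims q_h)
  then show ?thesis using site_commute[OF assms] Ls_entry[OF assms(1)] Ls_entry[OF assms(2)] by metis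
qed

lemma site_Lax_in:
  assumes "s \<in> {1..N}" "mat_in (Uq q) (L u)"
  shows "mat_in (End_alg D) (site_Lax h N ts L s u)" "dim_row (site_Lax h N ts L s u) = dim_row (L u)"
    "dim_col (site_Lax h N ts L s u) = dim_col (L u)"
    "\<And>i j. i < dim_row (L u) \<Longrightarrow> j < dim_col (L u) \<Longrightarrow> qm D (site_Lax h N ts L s u $$ (i, j)) = site_rep s (L u $$ (i, j))"
proof -
  have "site_op N ts s (spin_rep h (ts s) x) \<in> carrier_mat D D" if "x \<in> carrier (Uq q)" for x
    using alg_homD(1)[OF site_op_hom[OF assms(1)]] spin_rep_carrier[OF that] by auto
  then show "mat_in (End_alg D) (site_Lax h N ts L s u)"
    using assms(2) by (auto simp: mat_in_def site_Lax_def)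
qed (simp_all add: site_Lax_def site_rep_def)

lemma dressing_half:
  assumes "n \<le> N"
  shows "mat_in (End_alg D) (dressing h N ts v (Lax_half h) (K_half (h\<^sup>2) kp km ep em) u n)
    \<and> dim_row (dressing h N ts v (Lax_half h) (K_half (h\<^sup>2) kp km ep em) u n) = 2
    \<and> dim_col (dressing h N ts v (Lax_half h) (K_half (h\<^sup>2) kp km ep em) u n) = 2
    \<and> (\<forall>i j. qm D (dressing h N ts v (Lax_half h) (K_half (h\<^sup>2) kp km ep em) u n $$ (of_bool i, of_bool j)) = dressH Ls Ks v n u i j)"
  using assms
proof (induction n)
  case 0
  have d: "dim_row (K_half (h\<^sup>2) kp km ep em u) = 2" "dim_col (K_half (h\<^sup>2) kp km ep em u) = 2"
    by (simp_all add: K_half_def mat_of_rows_list_def)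
  have "qm D (scalar_mat (End_alg D) (K_half (h\<^sup>2) kp km ep em u) $$ (of_bool i, of_bool j)) = Ks u i j" for i j
    using d K_half_entry[of kp km ep em u i j] D_pos by (simp add: scalar_mat_def qm_scl qm_one Ks_def split del: split_of_bool split_of_bool_asm)
  then show ?case using d by (simp add: Q.mat_in_scalar)
next
  case (Suc n)
  let ?D = "dressing h N ts v (Lax_half h) (K_half (h\<^sup>2) kp km ep em) u n"
  let ?X = "site_Lax h N ts (Lax_half h) (Suc n) (u * v (Suc n))"
  let ?Y = "site_Lax h N ts (Lax_half h) (Suc n) (u * inverse (v (Suc n)))"
  have s: "Suc n \<in> {1..N}" using Suc.prems by simp
  note IH = Suc.IH[OF Suc_leD[OF Suc.prems]]
  have LL: "mat_in (Uq q) (Lax_half h w)" for w using Lax_half_in[of h w] by (simp add: q_h)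
  note X = site_Lax_in[of _ "Lax_half h" "u * v (Suc n)", OF s LL] and Y = site_Lax_in[of _ "Lax_half h" "u * inverse (v (Suc n))", OF s LL]
  have XD: "mat_in (End_alg D) (?X \<star>\<^bsub>End_alg D\<^esub> ?D)" using X IH by (intro Q.mat_in_mult) (auto simp: Lax_half_dims)
  have XDY: "mat_in (End_alg D) (?X \<star>\<^bsub>End_alg D\<^esub> ?D \<star>\<^bsub>End_alg D\<^esub> ?Y)"
    using XD X Y IH by (intro Q.mat_in_mult) (auto simp: Lax_half_dims)
  have e1: "qm D ((?X \<star>\<^bsub>End_alg D\<^esub> ?D) $$ (of_bool i, of_bool j)) = (\<Sum>k\<in>UNIV. Ls (Suc n) (u * v (Suc n)) i k * dressH Ls Ks v n u k j)" for i j
    using X IH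
    by (subst Q.phi_mult) (simp_all add: Lax_half_dims sum_lessThan_2 Ls_entry[OF s] split del: split_of_bool split_of_bool_asm)
  have "qm D ((?X \<star>\<^bsub>End_alg D\<^esub> ?D \<star>\<^bsub>End_alg D\<^esub> ?Y) $$ (of_bool i, of_bool j)) = dressH Ls Ks v (Suc n) u i j" for i j
  proof -
    have "qm D ((?X \<star>\<^bsub>End_alg D\<^esub> ?D \<star>\<^bsub>End_alg D\<^esub> ?Y) $$ (of_bool i, of_bool j))
      = (\<Sum>l\<in>UNIV. (\<Sum>k\<in>UNIV. Ls (Suc n) (u * v (Suc n)) i k * dressH Ls Ks v n u k l) * Ls (Suc n) (u * inverse (v (Suc n))) l j)"
      using X Y IH XD
      by (subst Q.phi_mult) (simp_all add: Lax_half_dims sum_lessThan_2 Ls_entry[OF s] e1 split del: split_of_bool split_of_bool_asm)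
    then show ?thesis by (simp add: sum_bool distrib_right distrib_left add_ac mult.assoc)
  qed
  then show ?case using XDY X Y by (simp add: Let_def Lax_half_dims)
qed

lemma K_spin_bl:
  "dim_row (K_spin h kp km ep em t u) = Suc t \<and> dim_col (K_spin h kp km ep em t u) = Suc t
    \<and> bl cst (Suc t) (Suc t) 0 0 (K_spin h kp km ep em t u) = fuseK Ks t u"
proof -
  interpret C: op_rep_q complex_alg "\<lambda>c. c \<cdot>\<^sub>C 1" q h
    by unfold_locales (simp_all add: calg_complex scl_hom quantum_scl_one)
  have "mat_in complex_alg M" for M by (simp add: mat_in_def complex_alg_def)
  then have "dim_row (K_half (h\<^sup>2) kp km ep em u) = 2 \<and> dim_col (K_half (h\<^sup>2) kp km ep em u) = 2 \<and> mat_in complex_alg (K_half (h\<^sup>2) kp km ep em u)" for u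
    by (simp add: K_half_def mat_of_rows_list_def)
  from C.bl_fused_K[of "K_half (h\<^sup>2) kp km ep em", OF this] show ?thesis
    by (simp add: K_spin_def K_half_entry Ks_def[abs_def])
qed

lemma dressing_full:
  assumes "n \<le> N"
  shows "mat_in (End_alg D) (dressing h N ts v (Lax h t) (K_spin h kp km ep em t) u n)
    \<and> dim_row (dressing h N ts v (Lax h t) (K_spin h kp km ep em t) u n) = Suc t
    \<and> dim_col (dressing h N ts v (Lax h t) (K_spin h kp km ep em t) u n) = Suc t
    \<and> bl (qm D) (Suc t) (Suc t) 0 0 (dressing h N ts v (Lax h t) (K_spin h kp km ep em t) u n) = dressF Ls Ks v t n u"
  using assms
proof (induction n)
  case 0
  show ?case using K_spin_bl[of t u] by (simp add: Q.mat_in_scalar Q.bl_scalar)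
next
  case (Suc n)
  let ?D = "dressing h N ts v (Lax h t) (K_spin h kp km ep em t) u n"
  let ?X = "site_Lax h N ts (Lax h t) (Suc n) (u * v (Suc n))"
  let ?Y = "site_Lax h N ts (Lax h t) (Suc n) (u * inverse (v (Suc n)))"
  have s: "Suc n \<in> {1..N}" using Suc.prems by simp
  note IH = Suc.IH[OF Suc_leD[OF Suc.prems]]
  interpret S: Lax_rep q h "site_rep (Suc n)" by (rule Lax_rep_site[OF s])
  have LL: "mat_in (Uq q) (Lax h t w)" "dim_row (Lax h t w) = Suc t" "dim_col (Lax h t w) = Suc t"
    "bl (site_rep (Suc n)) (Suc t) (Suc t) 0 0 (Lax h t w) = fuseL (Ls (Suc n)) t w" for w
    using S.bl_Lax[of t w] by (simp_all add: Ls_def)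
  note X = site_Lax_in[of _ "Lax h t" "u * v (Suc n)", OF s LL(1)] and Y = site_Lax_in[of _ "Lax h t" "u * inverse (v (Suc n))", OF s LL(1)]
  have b: "bl (qm D) (Suc t) (Suc t) 0 0 (site_Lax h N ts (Lax h t) (Suc n) w) = fuseL (Ls (Suc n)) t w" for w
    unfolding LL(4)[symmetric] bl_def using site_Lax_in(4)[of _ "Lax h t" w, OF s LL(1)] LL(2,3)
    by (intro sum.cong refl) simp
  have XD: "mat_in (End_alg D) (?X \<star>\<^bsub>End_alg D\<^esub> ?D)" using X IH by (intro Q.mat_in_mult) (auto simp: LL)
  have XDY: "mat_in (End_alg D) (?X \<star>\<^bsub>End_alg D\<^esub> ?D \<star>\<^bsub>End_alg D\<^esub> ?Y)"
    using XD X Y IH by (intro Q.mat_in_mult) (auto simp: LL)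
  have "bl (qm D) (Suc t) (Suc t) 0 0 (?X \<star>\<^bsub>End_alg D\<^esub> ?D)
      = bl (qm D) (Suc t) (Suc t) 0 0 ?X * bl (qm D) (Suc t) (Suc t) 0 0 ?D"
    using X IH by (intro Q.bl_mult1) (simp_all add: LL)
  moreover have "bl (qm D) (Suc t) (Suc t) 0 0 (?X \<star>\<^bsub>End_alg D\<^esub> ?D \<star>\<^bsub>End_alg D\<^esub> ?Y)
      = bl (qm D) (Suc t) (Suc t) 0 0 (?X \<star>\<^bsub>End_alg D\<^esub> ?D) * bl (qm D) (Suc t) (Suc t) 0 0 ?Y"
    using XD X Y IH by (intro Q.bl_mult1) (simp_all add: LL)
  ultimately show ?case using XDY X Y IH by (simp add: Let_def LL b)
qed

text \<open>Both sides are determined by their operators, and these agree by \<open>fuseK_dress\<close>.\<close>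

lemma K_operator_image:
  assumes v: "\<And>s. s \<in> {1..N} \<Longrightarrow> v s \<noteq> 0" and rep: "spin_chain_rep h kp km ep em N ts v \<psi>" and u: "u \<noteq> 0"
  shows "map_mat \<psi> (chain_KN h kp km ep em N ts v t u) = dressing h N ts v (Lax h t) (K_spin h kp km ep em t) u N"
proof -
  let ?A = "chain_alg (h\<^sup>2) kp km ep em N ts v"
  let ?KN = "chain_KN_half (h\<^sup>2) kp km ep em N ts v"
  let ?\<phi> = "\<lambda>x. qm D (\<psi> x)"
  have psi: "\<psi> \<in> alg_hom ?A (End_alg D)"
    and half: "\<And>u. u \<noteq> 0 \<Longrightarrow> map_mat \<psi> (?KN u) = dressing h N ts v (Lax_half h) (K_half (h\<^sup>2) kp km ep em) u N"
    using rep by (auto simp: spin_chain_rep_def)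
  interpret P: op_rep_q ?A ?\<phi> q h
    by unfold_locales (simp_all add: chain_alg_def calg_AqN quantum_qm
        alg_hom_comp[OF psi[unfolded chain_alg_def] qm_hom[OF D_pos]])
  have KN: "dim_row (?KN u) = 2 \<and> dim_col (?KN u) = 2 \<and> mat_in ?A (?KN u)" for u
    by (simp add: chain_KN_half_def chain_alg_def KN_half_dims KN_half_in)
  note F = P.bl_fused_K[of ?KN, OF KN, of t u]
  have ent: "?\<phi> (?KN u $$ (of_bool i, of_bool j)) = dressH Ls Ks v N u i j" if "u \<noteq> 0" for u i j
  proof -
    have "\<psi> (?KN u $$ (of_bool i, of_bool j)) = map_mat \<psi> (?KN u) $$ (of_bool i, of_bool j)" using KN[of u] by simp
    then show ?thesis using dressing_half[of N u] unfolding half[OF that] by simp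
  qed
  have core: "fuseK (\<lambda>u i j. ?\<phi> (?KN u $$ (of_bool i, of_bool j))) t u = dressF Ls Ks v t N u"
  proof -
    have Ld: "Ls = (\<lambda>s. lax (site_rep s (Uq_gen q UE)) (site_rep s (Uq_gen q UF)) (site_rep s (Uq_gen q UK)) (site_rep s (Uq_gen q UKi)))"
      and Kd: "Ks = (\<lambda>u i j. kmat kp km ep em u i j \<cdot>\<^sub>C 1)"
      by (simp_all add: Ls_def[abs_def] Ks_def[abs_def])
    show ?thesis
      unfolding Ld Kd
      by (rule fuseK_dress[of N _ _ _ _ v, OF site_quad _ v Ls_commute[unfolded Ld] ent[unfolded Ld Kd] u])
        (simp_all add: site_quantum)
  qed
  show ?thesis
  proof (rule bl_qm_inj[of _ "Suc t" _ D])
    show "bl (qm D) (Suc t) (Suc t) 0 0 (map_mat \<psi> (chain_KN h kp km ep em N ts v t u))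
        = bl (qm D) (Suc t) (Suc t) 0 0 (dressing h N ts v (Lax h t) (K_spin h kp km ep em t) u N)"
    proof -
      have "bl (qm D) (Suc t) (Suc t) 0 0 (map_mat \<psi> (chain_KN h kp km ep em N ts v t u))
          = bl ?\<phi> (Suc t) (Suc t) 0 0 (chain_KN h kp km ep em N ts v t u)"
        unfolding bl_def using F by (intro sum.cong refl) (simp add: chain_KN_def)
      also have "\<dots> = dressF Ls Ks v t N u" using F core by (simp add: chain_KN_def)
      finally show ?thesis using dressing_full[of N t u] by simp
    qed
    show "mat_in (End_alg D) (map_mat \<psi> (chain_KN h kp km ep em N ts v t u))"
      using F alg_homD(1)[OF psi] by (auto simp: mat_in_def chain_KN_def)
  qed (use F dressing_full[of N t u] in \<open>simp_all add: chain_KN_def\<close>)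
qed

end

theorem proposition4p10:
  fixes q h kp km ep em :: complex
    and N :: nat and ts :: "nat \<Rightarrow> nat" and v :: "nat \<Rightarrow> complex"
    and \<psi> :: "aq_gen free set set \<Rightarrow> complex mat"
    and t :: nat and u :: complex
  assumes "q \<noteq> 0" and "\<And>n::nat. n \<ge> 1 \<Longrightarrow> q ^ n \<noteq> 1" and "h\<^sup>2 = q"
    and "kp \<noteq> 0" and "km \<noteq> 0"
    and "N \<ge> 1"
    and "\<And>n. n \<in> {1..N} \<Longrightarrow> ts n \<ge> 1"
    and "\<And>n. n \<in> {1..N} \<Longrightarrow> v n \<noteq> 0"
    and "spin_chain_rep h kp km ep em N ts v \<psi>"
    and "t \<ge> 1" and "u \<noteq> 0"
  shows "map_mat \<psi> (chain_KN h kp km ep em N ts v t u)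
         = dressing h N ts v (Lax h t) (K_spin h kp km ep em t) u N"
proof -
  interpret spin_chain q h kp km ep em N ts v
    by unfold_locales (fact assms(1-3))+
  show ?thesis by (rule K_operator_image[OF assms(8,9,11)])
qed

end
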